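(* There exists an infinite family of transitive Boolean functions $F_i:\{0,1\}^{N_i}\to\{0,1\}$ ($i\in\mathbb{N}$), with $N_i\to\infty$ and $D(F_i)\to\infty$, such that simultaneously $$D(F_i)=\widetilde{\Omega}\big(Q(F_i)^4\big),\qquad D(F_i)=\widetilde{\Omega}\big(R_0(F_i)^2\big),\qquad D(F_i)=\widetilde{\Omega}\big(\deg(F_i)^2\big).$$
   Context: A subgroup $G\le S_N$ is transitive if for all $i,j\in[N]$ there is $\sigma\in G$ with $\sigma(i)=j$. A function $f:\{0,1\}^N\to\{0,1\}$ is transitive if there is a transitive group $G\le S_N$ such that $f(x_1,\dots,x_N)=f(x_{\sigma(1)},\dots,x_{\sigma(N)})$ for all $x\in\{0,1\}^N$ and all $\sigma\in G$. For total $f:\{0,1\}^N\to\{0,1\}$ (an algorithm accesses $x$ by querying bits $x_i$): - $D(f)$, deterministic query complexity, is the worst-case number of queries of the best deterministic query algorithm (decision tree) computing $f$. - $R_0(f)$, zero-error randomized query complexity, is the minimum over randomized query algorithms that never err on any input of the worst-case (over inputs) expected number of queries. - $Q(f)$, quantum query complexity, is the minimum number of queries of a quantum query algorithm (standard quantum oracle model) that outputs $f(x)$ with error probability at most $1/3$ on every input $x$. - $\deg(f)$ is the degree of the unique real multilinear polynomial that agrees with $f$ on $\{0,1\}^N$. Notation: for quantities $A_i,B_i$ attached to $F_i$, $A_i=\widetilde{\Omega}(B_i)$ means that there are constants $c>0$ and $C\ge 0$ with $A_i\ge c\,B_i/(\log N_i)^C$ for all sufficiently large $i$. *)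

theory Defs
  imports
    "HOL-Algebra.Sym_Groups"
    "HOL-Probability.Probability_Mass_Function"
    "Jordan_Normal_Form.Schur_Decomposition"
begin

text \<open>
  A function on \<open>{0,1}\<close>-strings of length \<open>N\<close> is a HOL function \<open>(nat \<Rightarrow> bool) \<Rightarrow> bool\<close>, of which only
  the values on \<open>cube N\<close> matter.  The positions are \<open>1, \<dots>, N\<close>, as in \<^const>\<open>sym_group\<close>.
\<close>

definition cube :: "nat \<Rightarrow> (nat \<Rightarrow> bool) set" where
  "cube N = {1..N} \<rightarrow>\<^sub>E UNIV"


section \<open>Transitive functions\<close>

definition transitive_perm_group :: "nat \<Rightarrow> (nat \<Rightarrow> nat) set \<Rightarrow> bool" where
  "transitive_perm_group N G \<longleftrightarrow>
     subgroup G (sym_group N) \<and> (\<forall>i\<in>{1..N}. \<forall>j\<in>{1..N}. \<exists>\<sigma>\<in>G. \<sigma> i = j)"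

definition transitive_function :: "nat \<Rightarrow> ((nat \<Rightarrow> bool) \<Rightarrow> bool) \<Rightarrow> bool" where
  "transitive_function N f \<longleftrightarrow>
     (\<exists>G. transitive_perm_group N G \<and> (\<forall>x\<in>cube N. \<forall>\<sigma>\<in>G. f x = f (x \<circ> \<sigma>)))"


section \<open>Deterministic query complexity\<close>

datatype dtree = Answer bool | Query nat dtree dtree

primrec dt_queries :: "dtree \<Rightarrow> nat set" where
  "dt_queries (Answer b) = {}"
| "dt_queries (Query i t0 t1) = insert i (dt_queries t0 \<union> dt_queries t1)"

primrec dt_eval :: "dtree \<Rightarrow> (nat \<Rightarrow> bool) \<Rightarrow> bool" where
  "dt_eval (Answer b) x = b"
| "dt_eval (Query i t0 t1) x = (if x i then dt_eval t1 x else dt_eval t0 x)"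

primrec dt_cost :: "dtree \<Rightarrow> (nat \<Rightarrow> bool) \<Rightarrow> nat" where
  "dt_cost (Answer b) x = 0"
| "dt_cost (Query i t0 t1) x = Suc (if x i then dt_cost t1 x else dt_cost t0 x)"

definition dt_computes :: "nat \<Rightarrow> ((nat \<Rightarrow> bool) \<Rightarrow> bool) \<Rightarrow> dtree \<Rightarrow> bool" where
  "dt_computes N f t \<longleftrightarrow> dt_queries t \<subseteq> {1..N} \<and> (\<forall>x\<in>cube N. dt_eval t x = f x)"

definition det_query_complexity :: "nat \<Rightarrow> ((nat \<Rightarrow> bool) \<Rightarrow> bool) \<Rightarrow> nat" where
  "det_query_complexity N f =
     (LEAST d. \<exists>t. dt_computes N f t \<and> d = (MAX x\<in>cube N. dt_cost t x))"


section \<open>Zero-error randomized query complexity\<close>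

text \<open>
  A randomized query algorithm is a probability distribution on decision trees; it never errs iff
  every tree in its support computes \<open>f\<close>.  Expectations are taken in \<^typ>\<open>ennreal\<close>, because the
  Bochner integral would assign the value \<open>0\<close> to an infinite expected number of queries.
\<close>

definition zero_error_query_complexity :: "nat \<Rightarrow> ((nat \<Rightarrow> bool) \<Rightarrow> bool) \<Rightarrow> real" where
  "zero_error_query_complexity N f =
     enn2real (INF P \<in> {P :: dtree pmf. \<forall>t\<in>set_pmf P. dt_computes N f t}.
       SUP x\<in>cube N. \<integral>\<^sup>+ t. of_nat (dt_cost t x) \<partial>measure_pmf P)"


section \<open>Quantum query complexity\<close>

text \<open>
  The state space is \<open>\<complex>\<^sup>N \<otimes> \<complex>\<^sup>2 \<otimes> \<complex>\<^sup>m\<close> (query register, answer qubit, workspace of any dimension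
  \<open>m \<ge> 1\<close>), of dimension \<open>2Nm\<close>.  The basis vector \<open>|i, b, w\<rangle>\<close> with \<open>i \<in> {1..N}\<close>, \<open>b \<in> {0,1}\<close> and
  \<open>w < m\<close> carries the number \<open>(2(i - 1) + b)m + w\<close>; the next three functions decode this number.
\<close>

definition query_reg :: "nat \<Rightarrow> nat \<Rightarrow> nat" where
  "query_reg m k = k div (2 * m) + 1"

definition answer_reg :: "nat \<Rightarrow> nat \<Rightarrow> bool" where
  "answer_reg m k = odd (k div m)"

definition work_reg :: "nat \<Rightarrow> nat \<Rightarrow> nat" where
  "work_reg m k = k mod m"

lemma bij_betw_basis:
  "bij_betw (\<lambda>k. (query_reg m k, answer_reg m k, work_reg m k)) {..<2 * N * m}
     ({1..N} \<times> UNIV \<times> {..<m})"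
proof (rule bij_betw_byWitness[where f' = "\<lambda>(i, b, w). (2 * (i - 1) + of_bool b) * m + w"])
  show "\<forall>k\<in>{..<2 * N * m}. (case (query_reg m k, answer_reg m k, work_reg m k) of
          (i, b, w) \<Rightarrow> (2 * (i - 1) + of_bool b) * m + w) = k"
  proof
    fix k
    have "2 * (k div (2 * m)) + of_bool (odd (k div m)) = k div m"
      by (metis div_mult2_eq mod2_eq_if mult.commute mult_div_mod_eq of_bool_def)
    then show "(case (query_reg m k, answer_reg m k, work_reg m k) of
          (i, b, w) \<Rightarrow> (2 * (i - 1) + of_bool b) * m + w) = k"
      by (simp add: query_reg_def answer_reg_def work_reg_def)
  qed
next
  have *: "((2 * i + of_bool b) * m + w) div m = 2 * i + of_bool b" if "w < m" for i w :: nat and b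
    using that by simp
  then have "((2 * i + of_bool b) * m + w) div (2 * m) = i" if "w < m" for i w :: nat and b
    using that by (simp add: mult.commute[of 2 m] div_mult2_eq del: div_mult_self3)
  with * show "\<forall>a'\<in>{1..N} \<times> UNIV \<times> {..<m}. (\<lambda>k. (query_reg m k, answer_reg m k, work_reg m k))
          (case a' of (i, b, w) \<Rightarrow> (2 * (i - 1) + of_bool b) * m + w) = a'"
    by (auto simp: query_reg_def answer_reg_def work_reg_def)
next
  have "k div (2 * m) < N" "m > 0" if "k < 2 * N * m" for k
    using that by (auto simp: less_mult_imp_div_less mult_ac intro: gr0I)
  then show "(\<lambda>k. (query_reg m k, answer_reg m k, work_reg m k)) ` {..<2 * N * m}
      \<subseteq> {1..N} \<times> UNIV \<times> {..<m}"
    by (auto simp: query_reg_def work_reg_def Suc_le_eq)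
next
  have "(2 * (i - 1) + of_bool b) * m + w < 2 * N * m" if "i \<in> {1..N}" "w < m" for i w and b
  proof -
    have "(2 * (i - 1) + of_bool b) * m + w < (2 * (i - 1) + of_bool b + 1) * m"
      using that by simp
    also have "\<dots> \<le> 2 * N * m"
      using that by (intro mult_right_mono) (auto simp: of_bool_def)
    finally show ?thesis .
  qed
  then show "(\<lambda>(i, b, w). (2 * (i - 1) + of_bool b) * m + w) ` ({1..N} \<times> UNIV \<times> {..<m})
      \<subseteq> {..<2 * N * m}"
    by auto
qed

text \<open>The oracle maps \<open>|i, b, w\<rangle>\<close> to \<open>|i, b \<oplus> x\<^sub>i, w\<rangle>\<close>; on \<^typ>\<open>bool\<close>, \<open>\<noteq>\<close> is \<open>\<oplus>\<close>.\<close>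

definition oracle_mat :: "nat \<Rightarrow> nat \<Rightarrow> (nat \<Rightarrow> bool) \<Rightarrow> complex mat" where
  "oracle_mat N m x = mat (2 * N * m) (2 * N * m) (\<lambda>(r, k).
     of_bool (query_reg m r = query_reg m k \<and> work_reg m r = work_reg m k \<and>
              answer_reg m r = (answer_reg m k \<noteq> x (query_reg m k))))"

definition unitary_mat :: "nat \<Rightarrow> complex mat \<Rightarrow> bool" where
  "unitary_mat d U \<longleftrightarrow> U \<in> carrier_mat d d \<and> mat_adjoint U * U = 1\<^sub>m d"

text \<open>\<open>q_state N m U x t = U\<^sub>t O\<^sub>x U\<^sub>t\<^sub>-\<^sub>1 \<cdots> O\<^sub>x U\<^sub>0 |1, 0, 0\<rangle>\<close>, the state after \<open>t\<close> queries.\<close>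

primrec q_state :: "nat \<Rightarrow> nat \<Rightarrow> (nat \<Rightarrow> complex mat) \<Rightarrow> (nat \<Rightarrow> bool) \<Rightarrow> nat \<Rightarrow> complex vec" where
  "q_state N m U x 0 = U 0 *\<^sub>v unit_vec (2 * N * m) 0"
| "q_state N m U x (Suc t) = U (Suc t) *\<^sub>v (oracle_mat N m x *\<^sub>v q_state N m U x t)"

text \<open>
  The final state is measured in the computational basis and the algorithm outputs \<open>1\<close> iff the
  outcome lies in \<open>A\<close>.
\<close>

definition q_error_prob ::
  "nat \<Rightarrow> nat \<Rightarrow> (nat \<Rightarrow> complex mat) \<Rightarrow> nat set \<Rightarrow> nat \<Rightarrow> ((nat \<Rightarrow> bool) \<Rightarrow> bool) \<Rightarrow> (nat \<Rightarrow> bool) \<Rightarrow> real" where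
  "q_error_prob N m U A T f x =
     (\<Sum>k | k < 2 * N * m \<and> (k \<in> A) \<noteq> f x. (cmod (vec_index (q_state N m U x T) k))\<^sup>2)"

definition quantum_query_complexity :: "nat \<Rightarrow> ((nat \<Rightarrow> bool) \<Rightarrow> bool) \<Rightarrow> nat" where
  "quantum_query_complexity N f =
     (LEAST T. \<exists>m U A. m \<ge> 1 \<and> (\<forall>t\<le>T. unitary_mat (2 * N * m) (U t)) \<and>
        (\<forall>x\<in>cube N. q_error_prob N m U A T f x \<le> 1 / 3))"


section \<open>Degree\<close>

text \<open>
  A real multilinear polynomial in \<open>x\<^sub>1, \<dots>, x\<^sub>N\<close> is given by its coefficients \<open>c S\<close> of the monomials
  \<open>\<Prod>i\<in>S. x\<^sub>i\<close>, \<open>S \<subseteq> {1..N}\<close>.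
\<close>

definition represents :: "nat \<Rightarrow> ((nat \<Rightarrow> bool) \<Rightarrow> bool) \<Rightarrow> (nat set \<Rightarrow> real) \<Rightarrow> bool" where
  "represents N f c \<longleftrightarrow>
     (\<forall>S. \<not> S \<subseteq> {1..N} \<longrightarrow> c S = 0) \<and>
     (\<forall>x\<in>cube N. (\<Sum>S\<in>Pow {1..N}. c S * (\<Prod>i\<in>S. of_bool (x i))) = of_bool (f x))"

lemma represents_iff:
  "represents N f c \<longleftrightarrow>
     (\<forall>S. \<not> S \<subseteq> {1..N} \<longrightarrow> c S = 0) \<and>
     (\<forall>S\<in>Pow {1..N}. (\<Sum>T\<in>Pow S. c T) = of_bool (f (\<lambda>i\<in>{1..N}. i \<in> S)))"
proof -
  have *: "(\<Sum>T\<in>Pow {1..N}. c T * (\<Prod>i\<in>T. of_bool (x i))) = (\<Sum>T\<in>Pow {i\<in>{1..N}. x i}. c T)" for x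
  proof -
    have "(\<Sum>T\<in>Pow {1..N}. c T * (\<Prod>i\<in>T. of_bool (x i))) =
          (\<Sum>T\<in>Pow {1..N}. if T \<in> Pow {i\<in>{1..N}. x i} then c T else 0)"
    proof (rule sum.cong[OF refl])
      fix T assume T: "T \<in> Pow {1..N}"
      then have "finite T" by (auto intro: finite_subset)
      show "c T * (\<Prod>i\<in>T. of_bool (x i)) = (if T \<in> Pow {i\<in>{1..N}. x i} then c T else 0)"
      proof (cases "\<forall>i\<in>T. x i")
        case True
        then show ?thesis using T by auto
      next
        case False
        then have "(\<Prod>i\<in>T. of_bool (x i) :: real) = 0"
          using \<open>finite T\<close> by auto
        then show ?thesis using False by auto
      qed
    qed
    also have "\<dots> = (\<Sum>T\<in>Pow {i\<in>{1..N}. x i}. c T)"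
      by (subst sum.inter_restrict[symmetric]) (auto intro!: sum.cong)
    finally show ?thesis .
  qed
  have ind: "{i\<in>{1..N}. (\<lambda>i\<in>{1..N}. i \<in> S) i} = S" if "S \<subseteq> {1..N}" for S
    using that by auto
  have x: "(\<lambda>i\<in>{1..N}. i \<in> {i\<in>{1..N}. x i}) = x" if "x \<in> cube N" for x
    using that by (intro ext) (auto simp: cube_def PiE_def extensional_def restrict_def)
  have mem: "(\<lambda>i\<in>{1..N}. i \<in> S) \<in> cube N" for S
    by (auto simp: cube_def)
  show ?thesis
    unfolding represents_def *
  proof (intro conj_cong refl iffI ballI)
    fix S assume H: "\<forall>x\<in>cube N. (\<Sum>T\<in>Pow {i\<in>{1..N}. x i}. c T) = of_bool (f x)"
      and "S \<in> Pow {1..N}"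
    then show "(\<Sum>T\<in>Pow S. c T) = of_bool (f (\<lambda>i\<in>{1..N}. i \<in> S))"
      using bspec[OF H mem[of S]] ind[of S] by simp
  next
    fix x assume H: "\<forall>S\<in>Pow {1..N}. (\<Sum>T\<in>Pow S. c T) = of_bool (f (\<lambda>i\<in>{1..N}. i \<in> S))"
      and "x \<in> cube N"
    have "{i\<in>{1..N}. x i} \<in> Pow {1..N}" by auto
    from bspec[OF H this] show "(\<Sum>T\<in>Pow {i\<in>{1..N}. x i}. c T) = of_bool (f x)"
      unfolding x[OF \<open>x \<in> cube N\<close>] .
  qed
qed

lemma ex1_represents: "\<exists>!c. represents N f c"
proof (rule ex_ex1I)
  define g :: "nat set \<Rightarrow> real" where "g S = of_bool (f (\<lambda>i\<in>{1..N}. i \<in> S))" for S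
  define P where "P n c \<longleftrightarrow> (\<forall>S. \<not> S \<subseteq> {1..N} \<longrightarrow> c S = 0) \<and>
    (\<forall>S. S \<subseteq> {1..N} \<longrightarrow> card S < n \<longrightarrow> (\<Sum>T\<in>Pow S. c T) = g S)" for n c
  have "\<exists>c. P n c" for n
  proof (induction n)
    case 0
    show ?case by (rule exI[of _ "\<lambda>_. 0"]) (simp add: P_def)
  next
    case (Suc n)
    then obtain c where c: "P n c" by blast
    define d where "d S = (if S \<subseteq> {1..N} \<and> card S = n
      then g S - (\<Sum>T\<in>Pow S - {S}. c T) else c S)" for S
    have "(\<Sum>T\<in>Pow S. d T) = g S" if S: "S \<subseteq> {1..N}" "card S < Suc n" for S
    proof -
      have fin: "finite S" using S by (auto intro: finite_subset)
      have "(\<Sum>T\<in>Pow S - {S}. d T) = (\<Sum>T\<in>Pow S - {S}. c T)"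
      proof (rule sum.cong[OF refl])
        fix T assume "T \<in> Pow S - {S}"
        then have "card T < card S" using fin by (auto intro: psubset_card_mono)
        then show "d T = c T" using S by (simp add: d_def)
      qed
      then have "(\<Sum>T\<in>Pow S. d T) = d S + (\<Sum>T\<in>Pow S - {S}. c T)"
        using fin by (subst sum.remove[of _ S]) auto
      moreover have "(\<Sum>T\<in>Pow S. c T) = c S + (\<Sum>T\<in>Pow S - {S}. c T)"
        using fin by (subst sum.remove[of _ S]) auto
      ultimately show ?thesis
        using S c unfolding P_def by (cases "card S = n") (simp_all add: d_def)
    qed
    moreover have "d S = 0" if "\<not> S \<subseteq> {1..N}" for S
      using that c by (simp add: d_def P_def)
    ultimately have "P (Suc n) d" unfolding P_def by blast
    then show ?case by blast
  qed
  then obtain c where c: "P (Suc N) c" by blast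
  have "card S < Suc N" if "S \<subseteq> {1..N}" for S
    using card_mono[OF _ that] by simp
  with c have "(\<Sum>T\<in>Pow S. c T) = g S" if "S \<subseteq> {1..N}" for S
    using that unfolding P_def by blast
  moreover have "\<forall>S. \<not> S \<subseteq> {1..N} \<longrightarrow> c S = 0"
    using c unfolding P_def by blast
  ultimately have "represents N f c"
    unfolding represents_iff g_def by blast
  then show "\<exists>c. represents N f c" by blast
next
  fix c d assume c: "represents N f c" and d: "represents N f d"
  have "c S = d S" for S
  proof (cases "S \<subseteq> {1..N}")
    case True
    then have "finite S" by (auto intro: finite_subset)
    then show ?thesis using True
    proof (induction S rule: finite_psubset_induct)
      case (psubset S)
      have "(\<Sum>T\<in>Pow S. c T) = (\<Sum>T\<in>Pow S. d T)"
        using c d psubset.prems unfolding represents_iff by simp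
      moreover have "(\<Sum>T\<in>Pow S - {S}. c T) = (\<Sum>T\<in>Pow S - {S}. d T)"
        using psubset by (intro sum.cong) auto
      ultimately show ?case
        using psubset.hyps sum.remove[of "Pow S" S c] sum.remove[of "Pow S" S d] by simp
    qed
  next
    case False
    then show ?thesis using c d unfolding represents_def by simp
  qed
  then show "c = d" by auto
qed

definition multilinear_degree :: "nat \<Rightarrow> ((nat \<Rightarrow> bool) \<Rightarrow> bool) \<Rightarrow> nat" where
  "multilinear_degree N f =
     (let c = THE c. represents N f c in Max (insert 0 (card ` {S. c S \<noteq> 0})))"


section \<open>Asymptotic notation\<close>

text \<open>The base of the logarithm is immaterial, since it can be absorbed into \<open>c\<close>.\<close>

definition tilde_Omega :: "(nat \<Rightarrow> nat) \<Rightarrow> (nat \<Rightarrow> real) \<Rightarrow> (nat \<Rightarrow> real) \<Rightarrow> bool" where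
  "tilde_Omega N A B \<longleftrightarrow>
     (\<exists>c>0. \<exists>C\<ge>0. \<forall>\<^sub>F i in sequentially. A i \<ge> c * B i / (ln (real (N i)) powr C))"

end

theory Submission
  imports Defs
begin

text \<open>
  The functions are pointer functions in the style of Goos--Pitassi--Watson and
  Ambainis--Balodis--Belovs--Lee--Santha--Smotrovs: in an \<open>n \<times> n\<close> array there has to be a column \<open>b\<close>
  without zeros, and a binary tree of pointers that starts in \<open>b\<close> and leads to a zero in every other
  column, each of these zeros pointing back to \<open>b\<close>.  All pointers are offsets with respect to bitwise
  exclusive or, and the contents of a cell is read off its bits by a map that is invariant under
  exclusive-or translations of the bit positions, so the translations are a transitive group of symmetries.

  An adversary that reveals zeros only in the second half of each column forces order \<open>n\<^sup>2\<close> deterministic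
  queries.  The value is a sum of \<open>n\<close> disjoint certificates, each checked with about \<open>n\<close> queries, which
  bounds the degree.  To find \<open>b\<close>, follow a back pointer to a column that has no zero in a random sample
  of \<open>2\<^sup>k\<close> rows, hence at most about \<open>n / 2\<^sup>k\<close> zeros, and hence that many candidates for the next
  phase: the phases cost about \<open>n\<close> classically and, with nested search, about \<open>sqrt n\<close> in the quantum case.

  The quantum costs are computed with weighted solutions of the dual adversary bound.  A solution of
  size \<open>W\<close> gives two reflections for which the start vector overlaps a fixed vector of their product
  (value 1) or is a coboundary with a transfer vector of length \<open>O(W)\<close> (value 0); averaging over \<open>O(W)\<close>
  steps separates the two cases.
\<close>

section \<open>Real isometries and quantum circuits\<close>

text \<open>With n = \<open>2 ^ L\<close> the targets are order n^2 for D, n for the zero-error cost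
  and the degree, and sqrt n for Q, up to powers of \<open>L\<close>. With absolute addresses a
  permutation of the positions would destroy the meaning of the pointers; offsets avoid that. Inside
  a cell a block of \<open>K\<close> bits splits the \<open>2 ^ K\<close> strings into translation
  orbits of at most \<open>K\<close> strings, so \<open>K = 16 * L\<close> leaves an orbit for each
  of the \<open>2 ^ (6 * L)\<close> contents.

  Exactly one root is demanded in the column of a certificate: otherwise a check of one column would
  have to try up to n trees. Back pointers are what the search lives on, since every column other
  than \<open>b\<close> holds a zero that names \<open>b\<close>.

  The current column of the search depends on the sample, and all phases share one sample, so a good
  sample must reject dense columns everywhere at once. Which samples are good depends on the input.
  Classically a bad sample only costs more; a dual adversary solution, however, is bounded on its
  whole domain. Hence each sample gets its own domain of inputs, and the circuit runs on a
  superposition of samples.\<close>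

lemma finite_cube: "finite (cube m)"
  by (auto simp: cube_def intro: finite_PiE)

text \<open>States are real functions on a fixed finite index set; values outside it never matter.
  Real amplitudes suffice, since everything applied between oracle calls is assembled from
  reflections and sign changes.\<close>

definition inner_on :: "'b set \<Rightarrow> ('b \<Rightarrow> real) \<Rightarrow> ('b \<Rightarrow> real) \<Rightarrow> real" where
  "inner_on S f g = (\<Sum>s\<in>S. f s * g s)"

lemma inner_on_commute: "inner_on S f g = inner_on S g f"
  by (simp add: inner_on_def mult.commute)

lemma inner_on_cong: "(\<And>s. s \<in> S \<Longrightarrow> f s = f' s) \<Longrightarrow> (\<And>s. s \<in> S \<Longrightarrow> g s = g' s) \<Longrightarrow> inner_on S f g = inner_on S f' g'"
  by (simp add: inner_on_def)

lemma inner_on_add_left: "inner_on S (\<lambda>s. f s + g s) h = inner_on S f h + inner_on S g h"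
  by (simp add: inner_on_def sum.distrib distrib_right)

lemma inner_on_diff_left: "inner_on S (\<lambda>s. f s - g s) h = inner_on S f h - inner_on S g h"
  by (simp add: inner_on_def sum_subtractf left_diff_distrib)

lemma inner_on_scale_left: "inner_on S (\<lambda>s. a * f s) h = a * inner_on S f h"
  by (simp add: inner_on_def sum_distrib_left mult.assoc)

lemma inner_on_minus_left: "inner_on S (\<lambda>s. - f s) h = - inner_on S f h"
  by (simp add: inner_on_def sum_negf)

lemma inner_on_add_right: "inner_on S h (\<lambda>s. f s + g s) = inner_on S h f + inner_on S h g"
  by (simp add: inner_on_def sum.distrib distrib_left)

lemma inner_on_diff_right: "inner_on S h (\<lambda>s. f s - g s) = inner_on S h f - inner_on S h g"
  by (simp add: inner_on_def sum_subtractf right_diff_distrib)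

lemma inner_on_scale_right: "inner_on S h (\<lambda>s. a * f s) = a * inner_on S h f"
  by (simp add: inner_on_def sum_distrib_left ac_simps)

lemma inner_on_minus_right: "inner_on S h (\<lambda>s. - f s) = - inner_on S h f"
  by (simp add: inner_on_def sum_negf)

lemma inner_on_divide_left: "inner_on S (\<lambda>s. f s / a) h = inner_on S f h / a"
  by (simp add: inner_on_def sum_divide_distrib)

lemma inner_on_divide_right: "inner_on S h (\<lambda>s. f s / a) = inner_on S h f / a"
  by (simp add: inner_on_def sum_divide_distrib)

lemma inner_on_sum_right: "inner_on S h (\<lambda>s. \<Sum>t\<in>T. f t s) = (\<Sum>t\<in>T. inner_on S h (f t))"
  unfolding inner_on_def sum_distrib_left by (rule sum.swap)

lemmas inner_on_linear = inner_on_add_left inner_on_diff_left inner_on_scale_left inner_on_minus_left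
  inner_on_add_right inner_on_diff_right inner_on_scale_right inner_on_minus_right
  inner_on_divide_left inner_on_divide_right

lemma inner_on_self_nonneg: "0 \<le> inner_on S f f"
  by (simp add: inner_on_def sum_nonneg)

lemma inner_on_self_eq_0: "finite S \<Longrightarrow> inner_on S f f = 0 \<longleftrightarrow> (\<forall>s\<in>S. f s = 0)"
  unfolding inner_on_def by (subst sum_nonneg_eq_0_iff) auto

lemma inner_on_Cauchy_Schwarz: "(inner_on S f g)\<^sup>2 \<le> inner_on S f f * inner_on S g g"
  using Cauchy_Schwarz_ineq_sum[of f g S] by (simp add: inner_on_def power2_eq_square)

lemma inner_on_diff_le: "inner_on S (\<lambda>s. f s - g s) (\<lambda>s. f s - g s) \<le> 2 * inner_on S f f + 2 * inner_on S g g"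
proof -
  have "inner_on S (\<lambda>s. f s + g s) (\<lambda>s. f s + g s) \<ge> 0" by (rule inner_on_self_nonneg)
  then show ?thesis by (simp add: inner_on_linear inner_on_commute[of S g f])
qed

lemma inner_on_of_bool: "finite S \<Longrightarrow> c \<in> S \<Longrightarrow> inner_on S f (\<lambda>s. of_bool (s = c)) = f c"
proof -
  assume "finite S" "c \<in> S"
  have "inner_on S f (\<lambda>s. of_bool (s = c)) = (\<Sum>s\<in>S. if s = c then f s else 0)"
    unfolding inner_on_def by (rule sum.cong) auto
  with \<open>finite S\<close> \<open>c \<in> S\<close> show ?thesis by simp
qed

text \<open>The middle clause is there because functions are defined on the whole type: the result
  on \<open>S\<close> may depend only on the argument on \<open>S\<close>. For finite
  \<open>S\<close>, preservation of inner products already makes the operator orthogonal.\<close>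

definition isometry_on :: "'b set \<Rightarrow> (('b \<Rightarrow> real) \<Rightarrow> 'b \<Rightarrow> real) \<Rightarrow> bool" where
  "isometry_on S L \<longleftrightarrow>
     (\<forall>f g a b. \<forall>s\<in>S. L (\<lambda>s. a * f s + b * g s) s = a * L f s + b * L g s) \<and>
     (\<forall>f g. (\<forall>s\<in>S. f s = g s) \<longrightarrow> (\<forall>s\<in>S. L f s = L g s)) \<and>
     (\<forall>f g. inner_on S (L f) (L g) = inner_on S f g)"

lemma isometry_on_linear:
  "isometry_on S L \<Longrightarrow> s \<in> S \<Longrightarrow> L (\<lambda>s. a * f s + b * g s) s = a * L f s + b * L g s"
  by (simp add: isometry_on_def)

lemma isometry_on_cong:
  "isometry_on S L \<Longrightarrow> s \<in> S \<Longrightarrow> (\<And>s. s \<in> S \<Longrightarrow> f s = g s) \<Longrightarrow> L f s = L g s"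
  by (simp add: isometry_on_def)

lemma isometry_on_inner: "isometry_on S L \<Longrightarrow> inner_on S (L f) (L g) = inner_on S f g"
  by (simp add: isometry_on_def)

lemma isometry_on_diff:
  assumes "isometry_on S L" "s \<in> S" shows "L (\<lambda>s. f s - g s) s = L f s - L g s"
  using isometry_on_linear[OF assms, of 1 f "-1" g] by simp

lemma isometry_on_scale:
  assumes "isometry_on S L" "s \<in> S" shows "L (\<lambda>s. a * f s) s = a * L f s"
  using isometry_on_linear[OF assms, of a f 0 f] by simp

lemma isometry_on_id: "isometry_on S (\<lambda>f. f)"
  by (simp add: isometry_on_def)

lemma isometry_on_comp:
  assumes A: "isometry_on S A" and B: "isometry_on S B"
  shows "isometry_on S (\<lambda>f. A (B f))"
proof -
  have "A (B (\<lambda>s. a * f s + b * g s)) s = a * A (B f) s + b * A (B g) s" if "s \<in> S" for f g a b s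
  proof -
    have "A (B (\<lambda>s. a * f s + b * g s)) s = A (\<lambda>s. a * B f s + b * B g s) s"
      by (rule isometry_on_cong[OF A that]) (rule isometry_on_linear[OF B])
    then show ?thesis by (simp add: isometry_on_linear[OF A that])
  qed
  moreover have "A (B f) s = A (B g) s" if "\<forall>s\<in>S. f s = g s" "s \<in> S" for f g s
    using that by (intro isometry_on_cong[OF A] isometry_on_cong[OF B]) auto
  ultimately show ?thesis
    unfolding isometry_on_def by (auto simp: isometry_on_inner[OF A] isometry_on_inner[OF B])
qed

lemma isometry_on_sum:
  assumes L: "isometry_on S L" and s: "s \<in> S" and fin: "finite C"
  shows "L (\<lambda>r. \<Sum>c\<in>C. a c * f c r) s = (\<Sum>c\<in>C. a c * L (f c) s)"
  using fin
proof (induction C rule: finite_induct)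
  case empty
  then show ?case using isometry_on_scale[OF L s, of 0 "\<lambda>_. 0"] by simp
next
  case (insert x C)
  then show ?case
    using isometry_on_linear[OF L s, of "a x" "f x" 1 "\<lambda>r. \<Sum>c\<in>C. a c * f c r"] by simp
qed

lemma isometry_on_expand:
  assumes L: "isometry_on S L" and s: "s \<in> S" and fin: "finite S"
  shows "L f s = (\<Sum>c\<in>S. f c * L (\<lambda>r. of_bool (r = c)) s)"
proof -
  have "L f s = L (\<lambda>r. \<Sum>c\<in>S. f c * of_bool (r = c)) s"
  proof (rule isometry_on_cong[OF L s])
    fix r assume "r \<in> S"
    have "(\<Sum>c\<in>S. f c * of_bool (r = c)) = (\<Sum>c\<in>S. if r = c then f c else 0)"
      by (rule sum.cong) auto
    with fin \<open>r \<in> S\<close> show "f r = (\<Sum>c\<in>S. f c * of_bool (r = c))" by simp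
  qed
  then show ?thesis by (simp add: isometry_on_sum[OF L s fin])
qed

text \<open>If \<open>v\<close> vanishes on \<open>S\<close>, division by zero turns this into the
  identity, so callers need no case distinction.\<close>

definition householder :: "'b set \<Rightarrow> ('b \<Rightarrow> real) \<Rightarrow> ('b \<Rightarrow> real) \<Rightarrow> 'b \<Rightarrow> real" where
  "householder S v f = (\<lambda>s. f s - 2 * inner_on S v f / inner_on S v v * v s)"

lemma isometry_on_householder: "isometry_on S (householder S v)"
proof -
  have "inner_on S (householder S v f) (householder S v g) = inner_on S f g" for f g
  proof (cases "inner_on S v v = 0")
    case True then show ?thesis by (simp add: householder_def)
  next
    case False
    define a b where "a = 2 * inner_on S v f / inner_on S v v" and "b = 2 * inner_on S v g / inner_on S v v"
    have "inner_on S (\<lambda>s. f s - a * v s) (\<lambda>s. g s - b * v s) =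
        inner_on S f g - b * inner_on S v f - a * (inner_on S v g - b * inner_on S v v)"
      by (simp add: inner_on_linear inner_on_commute[of S f v])
    also have "b * inner_on S v v = 2 * inner_on S v g" using False by (simp add: b_def)
    also have "b * inner_on S v f = a * inner_on S v g" by (simp add: a_def b_def)
    finally show ?thesis by (simp add: householder_def flip: a_def b_def)
  qed
  moreover have "householder S v f s = householder S v g s" if "\<forall>s\<in>S. f s = g s" "s \<in> S" for f g s
    using that inner_on_cong[of S v v f g] by (simp add: householder_def)
  ultimately show ?thesis
    unfolding isometry_on_def
    by (auto simp: householder_def inner_on_linear algebra_simps add_divide_distrib)
qed

text \<open>The reflection in the hyperplane orthogonal to \<open>a - b\<close> exchanges two
  vectors of equal length. State preparation and the final averaging over time both use it, in place
  of a Fourier transform.\<close>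

lemma householder_swap:
  assumes fin: "finite S" and eq: "inner_on S a a = inner_on S b b" and s: "s \<in> S"
  shows "householder S (\<lambda>s. a s - b s) a s = b s"
proof (cases "inner_on S (\<lambda>s. a s - b s) (\<lambda>s. a s - b s) = 0")
  case True
  with fin s have "a s = b s" by (auto simp: inner_on_self_eq_0)
  with True show ?thesis by (simp add: householder_def)
next
  case False
  have "2 * inner_on S (\<lambda>s. a s - b s) a = inner_on S (\<lambda>s. a s - b s) (\<lambda>s. a s - b s)"
    using eq by (simp add: inner_on_linear inner_on_commute[of S b a])
  with False show ?thesis by (simp add: householder_def)
qed

lemma householder_orthogonal: "inner_on S v f = 0 \<Longrightarrow> householder S v f = f"
  by (simp add: householder_def)

text \<open>This is the reflection that negates the span of \<open>\<Phi>\<close>, where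
  \<open>\<Phi>\<close> need be neither orthogonal nor independent: the induction performs one
  Gram-Schmidt step per vector.\<close>

lemma ex_reflection:
  assumes fin: "finite S" and "finite \<Phi>"
  shows "\<exists>R. isometry_on S R \<and> (\<forall>\<phi>\<in>\<Phi>. \<forall>s\<in>S. R \<phi> s = - \<phi> s) \<and>
             (\<forall>\<psi>. (\<forall>\<phi>\<in>\<Phi>. inner_on S \<psi> \<phi> = 0) \<longrightarrow> (\<forall>s\<in>S. R \<psi> s = \<psi> s))"
  using \<open>finite \<Phi>\<close>
proof (induction \<Phi> rule: finite_induct)
  case empty
  show ?case by (rule exI[of _ "\<lambda>f. f"]) (simp add: isometry_on_id)
next
  case (insert \<phi> \<Phi>)
  then obtain R where R: "isometry_on S R"
    and neg: "\<And>\<eta> s. \<eta> \<in> \<Phi> \<Longrightarrow> s \<in> S \<Longrightarrow> R \<eta> s = - \<eta> s"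
    and pos: "\<And>\<psi> s. (\<And>\<eta>. \<eta> \<in> \<Phi> \<Longrightarrow> inner_on S \<psi> \<eta> = 0) \<Longrightarrow> s \<in> S \<Longrightarrow> R \<psi> s = \<psi> s"
    by blast
  \<comment> \<open>The old reflection splits \<open>\<phi>\<close> into \<open>p\<close>,
    orthogonal to the old span and fixed by \<open>R\<close>, and \<open>q\<close>, negated by
    \<open>R\<close>. Only \<open>p\<close> is new, so a further Householder reflection along
    \<open>p\<close> suffices.\<close>
  define p where "p = (\<lambda>s. (\<phi> s + R \<phi> s) / 2)"
  define q where "q = (\<lambda>s. (\<phi> s - R \<phi> s) / 2)"
  have inn: "inner_on S (R f) \<eta> = - inner_on S f \<eta>" if "\<eta> \<in> \<Phi>" for f \<eta>
  proof -
    have "inner_on S (R f) \<eta> = - inner_on S (R f) (R \<eta>)"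
      using inner_on_cong[of S "R f" "R f" "R \<eta>" "\<lambda>s. - \<eta> s"] neg[OF that]
      by (simp add: inner_on_minus_right)
    then show ?thesis by (simp add: isometry_on_inner[OF R])
  qed
  have p_orth: "inner_on S p \<eta> = 0" if "\<eta> \<in> \<Phi>" for \<eta>
    by (simp add: p_def inner_on_linear inn[OF that])
  have Rp: "R p s = p s" if "s \<in> S" for s by (rule pos[OF p_orth that])
  have phi: "\<phi> s = p s + q s" and Rphi: "R \<phi> s = p s - q s" for s
    by (simp_all add: p_def q_def field_simps)
  have Rq: "R q s = - q s" if "s \<in> S" for s
  proof -
    have "R q s = R (\<lambda>s. \<phi> s - p s) s"
      by (rule isometry_on_cong[OF R that]) (simp add: phi)
    also have "\<dots> = R \<phi> s - p s" using isometry_on_diff[OF R that] Rp[OF that] by simp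
    finally show ?thesis by (simp add: Rphi)
  qed
  have pq: "inner_on S p q = 0"
    by (simp add: p_def q_def inner_on_linear isometry_on_inner[OF R] inner_on_commute[of S "R \<phi>" \<phi>]
        field_simps)
  have pphi: "inner_on S p \<phi> = inner_on S p p"
    using inner_on_cong[of S p p \<phi> "\<lambda>s. p s + q s"] phi by (simp add: inner_on_linear pq)
  have Hphi: "householder S p \<phi> s = q s - p s" if "s \<in> S" for s
  proof (cases "inner_on S p p = 0")
    case True
    with fin that have "p s = 0" by (simp add: inner_on_self_eq_0)
    with True show ?thesis using phi[of s] by (simp add: householder_def)
  next
    case False
    with pphi show ?thesis using phi[of s] by (simp add: householder_def)
  qed
  show ?case
  proof (intro exI[of _ "\<lambda>f. R (householder S p f)"] conjI allI impI ballI)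
    show "isometry_on S (\<lambda>f. R (householder S p f))"
      by (rule isometry_on_comp[OF R isometry_on_householder])
  next
    fix \<eta> s assume chi: "\<eta> \<in> insert \<phi> \<Phi>" and s: "s \<in> S"
    show "R (householder S p \<eta>) s = - \<eta> s"
    proof (cases "\<eta> = \<phi>")
      case True
      have "R (householder S p \<phi>) s = R (\<lambda>s. q s - p s) s"
        by (rule isometry_on_cong[OF R s Hphi])
      then show ?thesis
        using True phi[of s] by (simp add: isometry_on_diff[OF R s] Rp[OF s] Rq[OF s])
    next
      case False
      with chi have "\<eta> \<in> \<Phi>" by simp
      then show ?thesis using neg s p_orth by (simp add: householder_orthogonal)
    qed
  next
    fix \<psi> s assume psi: "\<forall>\<eta>\<in>insert \<phi> \<Phi>. inner_on S \<psi> \<eta> = 0" and s: "s \<in> S"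
    have R\<psi>: "R \<psi> s = \<psi> s" if "s \<in> S" for s using pos[of \<psi> s] psi that by simp
    have "inner_on S \<psi> (R \<phi>) = inner_on S (R \<psi>) (R \<phi>)" using R\<psi> by (intro inner_on_cong) auto
    then have "inner_on S p \<psi> = 0"
      using psi by (simp add: p_def inner_on_linear inner_on_commute[of S _ \<psi>] isometry_on_inner[OF R])
    then show "R (householder S p \<psi>) s = \<psi> s"
      using R\<psi>[OF s] by (simp add: householder_orthogonal)
  qed
qed

section \<open>From isometries to circuits with the bit oracle\<close>

lemma unitary_mat_of_isometry:
  assumes L: "isometry_on S L" and fin: "finite S" and \<beta>: "bij_betw \<beta> {..<d} S"
  shows "unitary_mat d (mat d d (\<lambda>(r, c). complex_of_real (L (\<lambda>p. of_bool (p = \<beta> c)) (\<beta> r))))"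
    (is "unitary_mat d ?M")
  unfolding unitary_mat_def
proof
  show "?M \<in> carrier_mat d d" by simp
  show "mat_adjoint ?M * ?M = 1\<^sub>m d"
  proof (rule eq_matI)
    fix i j assume "i < dim_row (1\<^sub>m d :: complex mat)" "j < dim_col (1\<^sub>m d :: complex mat)"
    then have i: "i < d" and j: "j < d" by auto
    let ?e = "\<lambda>c p. of_bool (p = \<beta> c) :: real"
    have "(mat_adjoint ?M * ?M) $$ (i, j) = (\<Sum>r<d. cnj (?M $$ (r, i)) * ?M $$ (r, j))"
      using i j by (simp add: mat_adjoint_def scalar_prod_def atLeast0LessThan)
    also have "\<dots> = complex_of_real (\<Sum>r<d. L (?e i) (\<beta> r) * L (?e j) (\<beta> r))"
      using i j by simp
    also have "(\<Sum>r<d. L (?e i) (\<beta> r) * L (?e j) (\<beta> r)) = inner_on S (L (?e i)) (L (?e j))"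
      unfolding inner_on_def by (rule sum.reindex_bij_betw[OF \<beta>])
    also have "\<dots> = inner_on S (?e i) (?e j)" by (rule isometry_on_inner[OF L])
    also have "\<dots> = of_bool (\<beta> j = \<beta> i)"
      using \<beta> j by (subst inner_on_of_bool[OF fin]) (auto simp: bij_betw_def)
    also have "(\<beta> j = \<beta> i) = (i = j)"
      using \<beta> i j by (auto simp: bij_betw_def inj_on_def)
    finally show "(mat_adjoint ?M * ?M) $$ (i, j) = 1\<^sub>m d $$ (i, j)" using i j by simp
  qed (simp_all add: mat_adjoint_def)
qed

lemma mat_of_isometry_mult_vec:
  assumes L: "isometry_on S L" and fin: "finite S" and \<beta>: "bij_betw \<beta> {..<d} S"
  shows "mat d d (\<lambda>(r, c). complex_of_real (L (\<lambda>p. of_bool (p = \<beta> c)) (\<beta> r))) *\<^sub>v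
           vec d (\<lambda>k. complex_of_real (\<psi> (\<beta> k))) = vec d (\<lambda>k. complex_of_real (L \<psi> (\<beta> k)))"
    (is "?M *\<^sub>v ?v = ?w")
proof (rule eq_vecI)
  fix i assume "i < dim_vec ?w"
  then have i: "i < d" by simp
  then have "\<beta> i \<in> S" using \<beta> by (auto simp: bij_betw_def)
  have "vec_index (?M *\<^sub>v ?v) i = complex_of_real (\<Sum>r<d. L (\<lambda>p. of_bool (p = \<beta> r)) (\<beta> i) * \<psi> (\<beta> r))"
    using i by (simp add: scalar_prod_def atLeast0LessThan)
  also have "(\<Sum>r<d. L (\<lambda>p. of_bool (p = \<beta> r)) (\<beta> i) * \<psi> (\<beta> r)) =
             (\<Sum>c\<in>S. L (\<lambda>p. of_bool (p = c)) (\<beta> i) * \<psi> c)"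
    by (rule sum.reindex_bij_betw[OF \<beta>])
  also have "\<dots> = L \<psi> (\<beta> i)"
    by (simp add: isometry_on_expand[OF L \<open>\<beta> i \<in> S\<close> fin, of \<psi>] mult.commute)
  finally show "vec_index (?M *\<^sub>v ?v) i = vec_index ?w i" using i by simp
qed simp

lemma oracle_mat_mult_vec:
  assumes e: "bij_betw e {..<m} S"
  defines "\<beta> \<equiv> \<lambda>k. (query_reg m k, answer_reg m k, e (work_reg m k))"
  shows "oracle_mat N m x *\<^sub>v vec (2 * N * m) (\<lambda>k. complex_of_real (\<psi> (\<beta> k))) =
         vec (2 * N * m) (\<lambda>k. complex_of_real ((\<lambda>(i, b, s). \<psi> (i, b \<noteq> x i, s)) (\<beta> k)))"
    (is "?O *\<^sub>v ?v = ?w")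
proof (rule eq_vecI)
  fix r assume "r < dim_vec ?w"
  then have r: "r < 2 * N * m" by simp
  define \<gamma> where "\<gamma> k = (query_reg m k, answer_reg m k, work_reg m k)" for k
  have bij: "bij_betw \<gamma> {..<2 * N * m} ({1..N} \<times> UNIV \<times> {..<m})"
    unfolding \<gamma>_def by (rule bij_betw_basis)
  define t where "t = (query_reg m r, answer_reg m r \<noteq> x (query_reg m r), work_reg m r)"
  have "\<gamma> r \<in> {1..N} \<times> UNIV \<times> {..<m}" using bij r by (auto simp: bij_betw_def)
  then have t: "t \<in> {1..N} \<times> UNIV \<times> {..<m}" by (auto simp: \<gamma>_def t_def)
  have "vec_index (?O *\<^sub>v ?v) r = (\<Sum>k<2 * N * m. of_bool (\<gamma> k = t) * complex_of_real (\<psi> (\<beta> k)))"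
    using r by (auto simp: oracle_mat_def scalar_prod_def atLeast0LessThan \<gamma>_def t_def intro!: sum.cong)
  also have "\<dots> = (\<Sum>k<2 * N * m. of_bool (\<gamma> k = t) * complex_of_real (\<psi> ((\<lambda>(i, b, w). (i, b, e w)) (\<gamma> k))))"
    by (simp add: \<gamma>_def \<beta>_def)
  also have "\<dots> = (\<Sum>p\<in>{1..N} \<times> UNIV \<times> {..<m}. of_bool (p = t) * complex_of_real (\<psi> ((\<lambda>(i, b, w). (i, b, e w)) p)))"
    by (rule sum.reindex_bij_betw[OF bij])
  also have "\<dots> = (\<Sum>p\<in>{1..N} \<times> UNIV \<times> {..<m}. if p = t then complex_of_real (\<psi> ((\<lambda>(i, b, w). (i, b, e w)) p)) else 0)"
    by (rule sum.cong) auto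
  also have "\<dots> = complex_of_real (\<psi> ((\<lambda>(i, b, w). (i, b, e w)) t))"
    using t by (subst sum.delta) auto
  finally show "vec_index (?O *\<^sub>v ?v) r = vec_index ?w r"
    using r by (simp add: t_def \<beta>_def)
qed (simp add: oracle_mat_def)

lemma quantum_query_complexity_le:
  fixes S :: "'b set" and L :: "nat \<Rightarrow> (nat \<times> bool \<times> 'b \<Rightarrow> real) \<Rightarrow> nat \<times> bool \<times> 'b \<Rightarrow> real"
  assumes N: "N \<ge> 1" and S: "finite S" "s0 \<in> S"
    and L: "\<And>t. t \<le> T \<Longrightarrow> isometry_on ({1..N} \<times> UNIV \<times> S) (L t)"
    and init: "\<And>x p. x \<in> cube N \<Longrightarrow> p \<in> {1..N} \<times> UNIV \<times> S \<Longrightarrow>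
                 \<Psi> x 0 p = L 0 (\<lambda>p. of_bool (p = (1, False, s0))) p"
    and step: "\<And>x t p. x \<in> cube N \<Longrightarrow> t < T \<Longrightarrow> p \<in> {1..N} \<times> UNIV \<times> S \<Longrightarrow>
                 \<Psi> x (Suc t) p = L (Suc t) (\<lambda>(i, b, s). \<Psi> x t (i, b \<noteq> x i, s)) p"
    and err: "\<And>x. x \<in> cube N \<Longrightarrow>
       (\<Sum>(i, b, s)\<in>{1..N} \<times> (UNIV :: bool set) \<times> {s\<in>S. (s \<in> A) \<noteq> f x}. (\<Psi> x T (i, b, s))\<^sup>2) \<le> 1 / 3"
  shows "quantum_query_complexity N f \<le> T"
proof -
  define m where "m = card S"
  define d where "d = 2 * N * m"
  let ?P = "{1..N} \<times> (UNIV :: bool set) \<times> S"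
  have m: "m \<ge> 1" using S by (auto simp: m_def Suc_le_eq card_gt_0_iff)
  obtain e0 where e0: "bij_betw e0 {..<m} S"
    using ex_bij_betw_nat_finite[OF S(1)] by (auto simp: m_def atLeast0LessThan)
  then obtain j where j: "j < m" "e0 j = s0" using S(2) by (auto simp: bij_betw_def)
  \<comment> \<open>The model starts in basis vector number 0, so the enumeration is rearranged to
    give \<open>s0\<close> the number 0.\<close>
  define e where "e = e0 \<circ> Transposition.transpose 0 j"
  have e: "bij_betw e {..<m} S"
    unfolding e_def using m j(1) e0
    by (intro bij_betw_trans[of _ "{..<m}" "{..<m}" _ S]) auto
  have e_0: "e 0 = s0" by (simp add: e_def j)
  define \<beta> where "\<beta> = (\<lambda>k. (query_reg m k, answer_reg m k, e (work_reg m k)))"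
  have \<beta>: "bij_betw \<beta> {..<d} ?P"
  proof -
    have "bij_betw (\<lambda>(i, b, w). (i :: nat, b :: bool, e w)) ({1..N} \<times> UNIV \<times> {..<m}) ?P"
      using e by (auto simp: bij_betw_def inj_on_def image_iff)
    from bij_betw_trans[OF bij_betw_basis[of m N] this]
    show ?thesis unfolding \<beta>_def d_def by (simp add: comp_def)
  qed
  have finP: "finite ?P" using S by simp
  define U where "U = (\<lambda>t. mat d d (\<lambda>(r, c). complex_of_real (L t (\<lambda>p. of_bool (p = \<beta> c)) (\<beta> r))))"
  have \<beta>_in: "\<beta> k \<in> ?P" if "k < d" for k using \<beta> that by (auto simp: bij_betw_def)
  have vcong: "vec d g = vec d h" if "\<And>k. k < d \<Longrightarrow> g k = h k" for g h :: "nat \<Rightarrow> complex"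
    using that by (intro eq_vecI) auto
  have state: "q_state N m U x t = vec d (\<lambda>k. complex_of_real (\<Psi> x t (\<beta> k)))"
    if x: "x \<in> cube N" and "t \<le> T" for x t
    using \<open>t \<le> T\<close>
  proof (induction t)
    case 0
    have d0: "0 < d" using N m by (simp add: d_def)
    have "\<beta> 0 = (1, False, s0)"
      by (simp add: \<beta>_def e_0 query_reg_def answer_reg_def work_reg_def)
    moreover have "\<beta> i = \<beta> 0 \<longleftrightarrow> i = 0" if "i < d" for i
      using \<beta> d0 that by (auto simp: bij_betw_def inj_on_def)
    ultimately have "unit_vec d 0 = vec d (\<lambda>k. complex_of_real (of_bool (\<beta> k = (1, False, s0))))"
      using d0 by (intro eq_vecI) (auto simp: unit_vec_def)
    then have "q_state N m U x 0 =
        vec d (\<lambda>k. complex_of_real (L 0 (\<lambda>p. of_bool (p = (1, False, s0))) (\<beta> k)))"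
      using mat_of_isometry_mult_vec[OF L finP \<beta>, of 0 "\<lambda>p. of_bool (p = (1, False, s0))"]
      by (simp add: U_def flip: d_def)
    also have "\<dots> = vec d (\<lambda>k. complex_of_real (\<Psi> x 0 (\<beta> k)))"
      by (rule vcong) (simp add: init[OF x \<beta>_in])
    finally show ?case .
  next
    case (Suc t)
    then have IH: "q_state N m U x t = vec d (\<lambda>k. complex_of_real (\<Psi> x t (\<beta> k)))" and t: "t < T" by auto
    have "oracle_mat N m x *\<^sub>v q_state N m U x t =
          vec d (\<lambda>k. complex_of_real ((\<lambda>(i, b, s). \<Psi> x t (i, b \<noteq> x i, s)) (\<beta> k)))"
      using oracle_mat_mult_vec[OF e, of N x "\<Psi> x t"] by (simp add: IH d_def \<beta>_def)
    then have "q_state N m U x (Suc t) =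
        vec d (\<lambda>k. complex_of_real (L (Suc t) (\<lambda>(i, b, s). \<Psi> x t (i, b \<noteq> x i, s)) (\<beta> k)))"
      using mat_of_isometry_mult_vec[OF L finP \<beta>, of "Suc t" "\<lambda>(i, b, s). \<Psi> x t (i, b \<noteq> x i, s)"]
        Suc.prems by (simp add: U_def)
    also have "\<dots> = vec d (\<lambda>k. complex_of_real (\<Psi> x (Suc t) (\<beta> k)))"
      by (rule vcong) (simp add: step[OF x t \<beta>_in])
    finally show ?case .
  qed
  have unit: "unitary_mat (2 * N * m) (U t)" if "t \<le> T" for t
    unfolding U_def d_def[symmetric] by (rule unitary_mat_of_isometry[OF L[OF that] finP \<beta>])
  define B where "B = {k. e (work_reg m k) \<in> A}"
  have "q_error_prob N m U B T f x \<le> 1 / 3" if x: "x \<in> cube N" for x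
  proof -
    have "q_error_prob N m U B T f x =
        (\<Sum>k | k < d \<and> (k \<in> B) \<noteq> f x. (\<Psi> x T (\<beta> k))\<^sup>2)"
      unfolding q_error_prob_def d_def[symmetric] by (rule sum.cong) (auto simp: state[OF x])
    also have "\<dots> = (\<Sum>p\<in>{1..N} \<times> (UNIV :: bool set) \<times> {s\<in>S. (s \<in> A) \<noteq> f x}. (\<Psi> x T p)\<^sup>2)"
    proof (rule sum.reindex_bij_betw)
      have "\<beta> ` {k. k < d \<and> (k \<in> B) \<noteq> f x} = {1..N} \<times> (UNIV :: bool set) \<times> {s\<in>S. (s \<in> A) \<noteq> f x}"
      proof (intro equalityI subsetI)
        fix p assume "p \<in> \<beta> ` {k. k < d \<and> (k \<in> B) \<noteq> f x}"
        then obtain k where k: "p = \<beta> k" "k < d" "(k \<in> B) \<noteq> f x" by auto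
        with \<beta>_in[of k] show "p \<in> {1..N} \<times> (UNIV :: bool set) \<times> {s\<in>S. (s \<in> A) \<noteq> f x}"
          by (auto simp: B_def \<beta>_def)
      next
        fix p assume p: "p \<in> {1..N} \<times> (UNIV :: bool set) \<times> {s\<in>S. (s \<in> A) \<noteq> f x}"
        then have "p \<in> ?P" by auto
        then obtain k where k: "k < d" "p = \<beta> k" using \<beta> by (auto simp: bij_betw_def)
        with p show "p \<in> \<beta> ` {k. k < d \<and> (k \<in> B) \<noteq> f x}"
          by (auto simp: B_def \<beta>_def)
      qed
      then show "bij_betw \<beta> {k. k < d \<and> (k \<in> B) \<noteq> f x} ({1..N} \<times> (UNIV :: bool set) \<times> {s\<in>S. (s \<in> A) \<noteq> f x})"
        using \<beta> by (auto simp: bij_betw_def intro: inj_on_subset)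
    qed
    also have "\<dots> \<le> 1 / 3" using err[OF x] by (simp add: case_prod_unfold)
    finally show ?thesis .
  qed
  with m unit show ?thesis
    unfolding quantum_query_complexity_def by (intro Least_le) blast
qed

text \<open>Later algorithms live on \<open>S\<close> alone: the basis state \<open>s\<close>
  determines the queried position \<open>q s\<close>, with 0 for "no query", and the oracle is a
  sign. \<open>V\<close> embeds \<open>S\<close> isometrically into the model's space so that the
  bit oracle acts as this sign; \<open>F\<close> and the next \<open>R t\<close> (or
  \<open>G\<close>) merge into one unitary between two queries.\<close>

lemma quantum_query_complexity_le_phase_circuit:
  fixes S :: "'b set" and q :: "'b \<Rightarrow> nat" and \<chi>\<^sub>0 :: "'b \<Rightarrow> real"
    and state :: "(nat \<Rightarrow> bool) \<Rightarrow> nat \<Rightarrow> 'b \<Rightarrow> real"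
  assumes N: "N \<ge> 1" and T: "T \<ge> 1" and S: "finite S" and q: "\<And>s. s \<in> S \<Longrightarrow> q s \<le> N"
    and unit: "inner_on S \<chi>\<^sub>0 \<chi>\<^sub>0 = 1"
    and R: "\<And>t. isometry_on S (R t)" and F: "isometry_on S F" and G: "isometry_on S G"
    and init: "\<And>x s. s \<in> S \<Longrightarrow> state x 0 s = \<chi>\<^sub>0 s"
    and step: "\<And>x t s. x \<in> cube N \<Longrightarrow> t < T \<Longrightarrow> s \<in> S \<Longrightarrow>
      state x (Suc t) s = F (\<lambda>s. if q s \<noteq> 0 \<and> x (q s) then - R t (state x t) s else R t (state x t) s) s"
    and err: "\<And>x. x \<in> cube N \<Longrightarrow> (\<Sum>s | s \<in> S \<and> (s \<in> A) \<noteq> f x. (G (state x T) s)\<^sup>2) \<le> 1 / 3"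
  shows "quantum_query_complexity N f \<le> T"
proof -
  let ?P = "{1..N} \<times> (UNIV :: bool set) \<times> S"
  have finP: "finite ?P" using S by simp
  obtain s0 where s0: "s0 \<in> S" using unit by (cases "S = {}") (auto simp: inner_on_def)
  define p where "p s = (if q s = 0 then 1 else q s)" for s
  define h :: "'b \<Rightarrow> bool \<Rightarrow> real" where "h s b = (if q s \<noteq> 0 \<and> b then - 1 else 1) / sqrt 2" for s b
  define D where "D x g s = (if q s \<noteq> 0 \<and> x (q s) then - g s else g s)" for x :: "nat \<Rightarrow> bool" and g :: "'b \<Rightarrow> real" and s
  \<comment> \<open>Phase kickback: \<open>V\<close> puts the answer qubit into the state \<open>|-\<rangle>\<close>, or \<open>|+\<rangle>\<close> where no query is wanted.\<close>
  define V where "V g = (\<lambda>(i, b, s). if i = p s then h s b * g s else 0)" for g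
  define V' where "V' g s = (\<Sum>b\<in>UNIV. h s b * g (p s, b, s))" for g s
  have p: "p s \<in> {1..N}" if "s \<in> S" for s using q[OF that] N by (auto simp: p_def)
  have hh: "h s b * h s b = 1 / 2" for s b by (simp add: h_def)
  have V'V: "V' (V g) = g" for g
    by (rule HOL.ext) (simp add: V'_def V_def UNIV_bool hh flip: mult.assoc)
  have adj: "inner_on ?P (V g) k = inner_on S g (V' k)" for g k
  proof -
    have "inner_on ?P (V g) k = (\<Sum>i\<in>{1..N}. \<Sum>b\<in>UNIV. \<Sum>s\<in>S. V g (i, b, s) * k (i, b, s))"
      by (simp add: inner_on_def sum.cartesian_product case_prod_unfold)
    also have "\<dots> = (\<Sum>s\<in>S. \<Sum>b\<in>UNIV. \<Sum>i\<in>{1..N}. V g (i, b, s) * k (i, b, s))"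
      by (subst sum.swap, subst (2) sum.swap, subst sum.swap) simp
    also have "\<dots> = (\<Sum>s\<in>S. \<Sum>b\<in>UNIV. h s b * g s * k (p s, b, s))"
    proof (intro sum.cong refl)
      fix s b assume "s \<in> S"
      have "(\<Sum>i\<in>{1..N}. V g (i, b, s) * k (i, b, s)) =
            (\<Sum>i\<in>{1..N}. if i = p s then h s b * g s * k (p s, b, s) else 0)"
        by (rule sum.cong) (auto simp: V_def)
      then show "(\<Sum>i\<in>{1..N}. V g (i, b, s) * k (i, b, s)) = h s b * g s * k (p s, b, s)"
        using p[OF \<open>s \<in> S\<close>] by simp
    qed
    finally show ?thesis
      by (simp add: inner_on_def V'_def sum_distrib_left ac_simps)
  qed
  have adj': "inner_on ?P k (V g) = inner_on S (V' k) g" for g k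
    using adj by (simp add: inner_on_commute)
  have VV: "inner_on ?P (V g) (V k) = inner_on S g k" for g k
    using adj[of g "V k"] inner_on_cong[of S g g "V' (V k)" k] by (simp add: V'V)
  have V_cong: "V g r = V k r" if "\<And>s. s \<in> S \<Longrightarrow> g s = k s" "r \<in> ?P" for g k r
    using that by (auto simp: V_def)
  \<comment> \<open>\<open>ext B\<close> is \<open>B\<close> on the range of \<open>V\<close> and the identity on its orthogonal complement.\<close>
  define ext where "ext B g = (\<lambda>r. g r + V (\<lambda>s. B (V' g) s - V' g s) r)" for B g
  have ext_iso: "isometry_on ?P (ext B)" if B: "isometry_on S B" for B
  proof -
    have V'lin: "V' (\<lambda>r. a * g r + b * k r) = (\<lambda>s. a * V' g s + b * V' k s)" for a b g k
      by (rule ext) (simp add: V'_def sum.distrib sum_distrib_left algebra_simps)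
    have Vlin: "V (\<lambda>s. a * g s + b * k s) r = a * V g r + b * V k r" for a b g k r
      by (auto simp: V_def algebra_simps split: prod.splits)
    have "ext B (\<lambda>r. a * g r + b * k r) r = a * ext B g r + b * ext B k r" if "r \<in> ?P" for a b g k r
    proof -
      have *: "V (\<lambda>s. B (V' (\<lambda>r. a * g r + b * k r)) s - V' (\<lambda>r. a * g r + b * k r) s) r =
            V (\<lambda>s. a * (B (V' g) s - V' g s) + b * (B (V' k) s - V' k s)) r"
        by (rule V_cong[OF _ that]) (simp add: V'lin isometry_on_linear[OF B] algebra_simps)
      show ?thesis unfolding ext_def * Vlin by (simp add: algebra_simps)
    qed
    moreover have "ext B g r = ext B k r" if eq: "\<forall>s\<in>?P. g s = k s" and r: "r \<in> ?P" for g k r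
    proof -
      have "V' g s = V' k s" if "s \<in> S" for s
        using eq p[OF that] that by (simp add: V'_def)
      then have "V (\<lambda>s. B (V' g) s - V' g s) r = V (\<lambda>s. B (V' k) s - V' k s) r"
        by (intro V_cong[OF _ r]) (auto intro!: arg_cong2[of _ _ _ _ "(-)"] isometry_on_cong[OF B])
      moreover have "g r = k r" using eq r by blast
      ultimately show ?thesis by (simp add: ext_def)
    qed
    moreover have "inner_on ?P (ext B g) (ext B k) = inner_on ?P g k" for g k
      unfolding ext_def inner_on_add_left inner_on_add_right VV adj adj' V'V
      by (simp add: inner_on_linear isometry_on_inner[OF B])
    ultimately show ?thesis unfolding isometry_on_def by blast
  qed
  have ext_V: "ext B (V g) r = V (B g) r" if B: "isometry_on S B" and r: "r \<in> ?P" for B g r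
  proof -
    show ?thesis unfolding ext_def V'V by (auto simp: V_def algebra_simps split: prod.splits)
  qed
  have oracle_V: "(\<lambda>(i, b, s). V g (i, b \<noteq> x i, s)) = V (D x g)" for x g
    by (rule HOL.ext) (auto simp: V_def D_def p_def h_def split: prod.splits)
  define e where "e = (\<lambda>r. of_bool (r = (1 :: nat, False, s0)) :: real)"
  \<comment> \<open>The first unitary only has to send the start vector to the embedded state, which
    a reflection does for any two unit vectors.\<close>
  define L where "L t = (if t = 0 then householder ?P (\<lambda>r. e r - V (R 0 \<chi>\<^sub>0) r)
      else if t < T then ext (\<lambda>g. R t (F g)) else ext (\<lambda>g. G (F g)))" for t
  define \<Psi> where "\<Psi> x t = (if t < T then V (R t (state x t)) else V (G (state x T)))" for x t
  have D_step: "state x (Suc t) s = F (D x (R t (state x t))) s" if "x \<in> cube N" "t < T" "s \<in> S" for x t s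
    using step[OF that] by (simp add: D_def[abs_def])
  show ?thesis
  proof (rule quantum_query_complexity_le[OF N S s0, of T L \<Psi>])
    show "isometry_on ?P (L t)" for t
      by (auto simp only: L_def isometry_on_householder ext_iso[OF isometry_on_comp[OF R F]]
          ext_iso[OF isometry_on_comp[OF G F]] split: if_split)
  next
    fix x r assume "x \<in> cube N" and r: "r \<in> ?P"
    have "inner_on ?P e e = 1"
      unfolding e_def using N s0 by (subst inner_on_of_bool[OF finP]) auto
    then have "inner_on ?P e e = inner_on ?P (V (R 0 \<chi>\<^sub>0)) (V (R 0 \<chi>\<^sub>0))"
      by (simp only: VV isometry_on_inner[OF R] unit)
    note sw = householder_swap[OF finP this r]
    have "V (R 0 (state x 0)) r = V (R 0 \<chi>\<^sub>0) r"
      by (rule V_cong[OF isometry_on_cong[OF R] r]) (auto simp: init)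
    with sw show "\<Psi> x 0 r = L 0 (\<lambda>r. of_bool (r = (1, False, s0))) r"
      using T unfolding \<Psi>_def L_def e_def by simp
  next
    fix x t r assume x: "x \<in> cube N" and t: "t < T" and r: "r \<in> ?P"
    define B where "B = (if Suc t < T then R (Suc t) else G)"
    have B: "isometry_on S B" by (simp add: B_def R G)
    have "\<Psi> x (Suc t) = V (B (state x (Suc t)))"
      using t by (auto simp: \<Psi>_def B_def not_less intro!: arg_cong[of _ _ V] arg_cong[of _ _ G] arg_cong[of _ _ "state x"])
    then have "\<Psi> x (Suc t) r = V (B (F (D x (R t (state x t))))) r"
      using D_step[OF x t] by (auto intro!: V_cong[OF _ r] isometry_on_cong[OF B])
    also have "\<dots> = ext (\<lambda>g. B (F g)) (V (D x (R t (state x t)))) r"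
      by (rule ext_V[symmetric, OF isometry_on_comp[OF B F] r])
    also have "V (D x (R t (state x t))) = (\<lambda>(i, b, s). \<Psi> x t (i, b \<noteq> x i, s))"
      using t by (simp only: \<Psi>_def if_True oracle_V)
    also have "ext (\<lambda>g. B (F g)) = L (Suc t)" by (simp add: L_def B_def)
    finally show "\<Psi> x (Suc t) r = L (Suc t) (\<lambda>(i, b, s). \<Psi> x t (i, b \<noteq> x i, s)) r" .
  next
    fix x assume x: "x \<in> cube N"
    let ?S = "{s \<in> S. (s \<in> A) \<noteq> f x}"
    have "(\<Sum>(i, b, s)\<in>{1..N} \<times> UNIV \<times> ?S. (\<Psi> x T (i, b, s))\<^sup>2) =
          (\<Sum>i\<in>{1..N}. \<Sum>b\<in>UNIV. \<Sum>s\<in>?S. (\<Psi> x T (i, b, s))\<^sup>2)"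
      by (simp add: sum.cartesian_product case_prod_unfold)
    also have "\<dots> = (\<Sum>s\<in>?S. \<Sum>b\<in>UNIV. \<Sum>i\<in>{1..N}. (\<Psi> x T (i, b, s))\<^sup>2)"
      by (subst sum.swap, subst (2) sum.swap, subst sum.swap) simp
    also have "\<dots> = (\<Sum>s\<in>?S. (G (state x T) s)\<^sup>2)"
    proof (rule sum.cong[OF refl])
      fix s assume "s \<in> ?S"
      then have "s \<in> S" by simp
      have *: "(\<Sum>i\<in>{1..N}. (\<Psi> x T (i, b, s))\<^sup>2) = (G (state x T) s)\<^sup>2 / 2" for b
      proof -
        have "(\<Sum>i\<in>{1..N}. (\<Psi> x T (i, b, s))\<^sup>2) =
              (\<Sum>i\<in>{1..N}. if i = p s then (h s b * G (state x T) s)\<^sup>2 else 0)"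
          by (rule sum.cong) (auto simp: \<Psi>_def V_def)
        then show ?thesis
          using p[OF \<open>s \<in> S\<close>] hh[of s b] by (simp add: power_mult_distrib power2_eq_square)
      qed
      show "(\<Sum>b\<in>UNIV. \<Sum>i\<in>{1..N}. (\<Psi> x T (i, b, s))\<^sup>2) = (G (state x T) s)\<^sup>2"
        unfolding * by (simp add: UNIV_bool)
    qed
    also have "\<dots> \<le> 1 / 3" by (rule err[OF x])
    finally show "(\<Sum>(i, b, s)\<in>{1..N} \<times> UNIV \<times> ?S. (\<Psi> x T (i, b, s))\<^sup>2) \<le> 1 / 3" .
  qed
qed


section \<open>The dual adversary bound and its conversion into a quantum algorithm\<close>

text \<open>A feasible solution of the dual of the general adversary bound: the coordinates
  \<open>e\<close> with \<open>q e = i\<close> form the vectors that belong to position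
  \<open>i\<close>. The size \<open>\<phi>\<close> may vary with the input, the domain
  \<open>X\<close> may be partial and the output need not be Boolean, because subroutines are
  composed in this form. Keeping \<open>U\<close> and \<open>V\<close> distinct makes room for the
  asymmetric blocks of \<open>adv_bound_bool\<close>.\<close>

definition adv_system ::
  "nat \<Rightarrow> (nat \<Rightarrow> bool) set \<Rightarrow> ((nat \<Rightarrow> bool) \<Rightarrow> nat) \<Rightarrow> ((nat \<Rightarrow> bool) \<Rightarrow> real) \<Rightarrow>
   nat set \<Rightarrow> (nat \<Rightarrow> nat) \<Rightarrow> ((nat \<Rightarrow> bool) \<Rightarrow> nat \<Rightarrow> real) \<Rightarrow> ((nat \<Rightarrow> bool) \<Rightarrow> nat \<Rightarrow> real) \<Rightarrow> bool" where
  "adv_system N X g \<phi> E q U V \<longleftrightarrow> finite E \<and> (\<forall>e\<in>E. q e \<in> {1..N}) \<and>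
     (\<forall>x\<in>X. \<forall>y\<in>X. (\<Sum>e\<in>E. of_bool (x (q e) \<noteq> y (q e)) * (U x e * V y e)) = of_bool (g x \<noteq> g y)) \<and>
     (\<forall>x\<in>X. (\<Sum>e\<in>E. (U x e)\<^sup>2) \<le> \<phi> x) \<and> (\<forall>x\<in>X. (\<Sum>e\<in>E. (V x e)\<^sup>2) \<le> \<phi> x)"

definition adv_bound ::
  "nat \<Rightarrow> (nat \<Rightarrow> bool) set \<Rightarrow> ((nat \<Rightarrow> bool) \<Rightarrow> nat) \<Rightarrow> ((nat \<Rightarrow> bool) \<Rightarrow> real) \<Rightarrow> bool" where
  "adv_bound N X g \<phi> \<longleftrightarrow> X \<subseteq> cube N \<and> (\<exists>E q U V. adv_system N X g \<phi> E q U V)"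

lemma adv_systemD:
  assumes "adv_system N X g \<phi> E q U V"
  shows "finite E" "e \<in> E \<Longrightarrow> q e \<in> {1..N}"
    "x \<in> X \<Longrightarrow> y \<in> X \<Longrightarrow> (\<Sum>e\<in>E. of_bool (x (q e) \<noteq> y (q e)) * (U x e * V y e)) = of_bool (g x \<noteq> g y)"
    "x \<in> X \<Longrightarrow> (\<Sum>e\<in>E. (U x e)\<^sup>2) \<le> \<phi> x" "x \<in> X \<Longrightarrow> (\<Sum>e\<in>E. (V x e)\<^sup>2) \<le> \<phi> x"
  using assms by (auto simp: adv_system_def)

lemma adv_boundI:
  fixes E :: "nat set"
  assumes "X \<subseteq> cube N" "finite E" "\<And>e. e \<in> E \<Longrightarrow> q e \<in> {1..N}"
    and "\<And>x y. x \<in> X \<Longrightarrow> y \<in> X \<Longrightarrow>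
      (\<Sum>e\<in>E. of_bool (x (q e) \<noteq> y (q e)) * (U x e * V y e)) = of_bool (g x \<noteq> g y)"
    and "\<And>x. x \<in> X \<Longrightarrow> (\<Sum>e\<in>E. (U x e)\<^sup>2) \<le> \<phi> x" "\<And>x. x \<in> X \<Longrightarrow> (\<Sum>e\<in>E. (V x e)\<^sup>2) \<le> \<phi> x"
  shows "adv_bound N X g \<phi>"
proof -
  have "adv_system N X g \<phi> E q U V" unfolding adv_system_def by (intro conjI ballI assms)
  with assms(1) show ?thesis unfolding adv_bound_def by blast
qed

lemma isometry_on_cong_map:
  assumes "isometry_on S A" "\<And>f s. s \<in> S \<Longrightarrow> A f s = B f s"
  shows "isometry_on S B"
proof -
  have "inner_on S (B f) (B g) = inner_on S (A f) (A g)" for f g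
    using assms(2) by (intro inner_on_cong) auto
  with assms show ?thesis unfolding isometry_on_def by auto
qed

lemma inner_on_Times:
  "inner_on (A \<times> B) f g = (\<Sum>a\<in>A. inner_on B (\<lambda>b. f (a, b)) (\<lambda>b. g (a, b)))"
  by (simp add: inner_on_def sum.cartesian_product case_prod_unfold)

lemma isometry_on_fibers:
  assumes L: "\<And>a. a \<in> A \<Longrightarrow> isometry_on B (L a)"
  shows "isometry_on (A \<times> B) (\<lambda>f (a, b). L a (\<lambda>b. f (a, b)) b)"
proof -
  have "inner_on (A \<times> B) (\<lambda>(a, b). L a (\<lambda>b. f (a, b)) b) (\<lambda>(a, b). L a (\<lambda>b. g (a, b)) b) =
        inner_on (A \<times> B) f g" for f g
    unfolding inner_on_Times by (intro sum.cong refl) (simp add: isometry_on_inner[OF L])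
  moreover have "L a (\<lambda>b. f (a, b)) b = L a (\<lambda>b. g (a, b)) b"
    if "\<forall>s\<in>A \<times> B. f s = g s" "a \<in> A" "b \<in> B" for f g a b
    using that by (intro isometry_on_cong[OF L]) auto
  ultimately show ?thesis
    unfolding isometry_on_def by (auto simp: isometry_on_linear[OF L])
qed

lemma isometry_on_fibers_swap:
  assumes L: "\<And>b. b \<in> B \<Longrightarrow> isometry_on A (L b)"
  shows "isometry_on (A \<times> B) (\<lambda>f (a, b). L b (\<lambda>a. f (a, b)) a)"
proof -
  have sw: "inner_on (A \<times> B) f g = (\<Sum>b\<in>B. inner_on A (\<lambda>a. f (a, b)) (\<lambda>a. g (a, b)))" for f g
    unfolding inner_on_Times unfolding inner_on_def by (rule sum.swap)
  have "inner_on (A \<times> B) (\<lambda>(a, b). L b (\<lambda>a. f (a, b)) a) (\<lambda>(a, b). L b (\<lambda>a. g (a, b)) a) =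
        inner_on (A \<times> B) f g" for f g
    unfolding sw by (intro sum.cong refl) (simp add: isometry_on_inner[OF L])
  moreover have "L b (\<lambda>a. f (a, b)) a = L b (\<lambda>a. g (a, b)) a"
    if "\<forall>s\<in>A \<times> B. f s = g s" "a \<in> A" "b \<in> B" for f g a b
    using that by (intro isometry_on_cong[OF L]) auto
  ultimately show ?thesis
    unfolding isometry_on_def by (auto simp: isometry_on_linear[OF L])
qed

lemma isometry_on_signs:
  assumes "\<And>s. s \<in> S \<Longrightarrow> c s = 1 \<or> c s = (-1 :: real)"
  shows "isometry_on S (\<lambda>f s. c s * f s)"
proof -
  have "c s * c s = 1" if "s \<in> S" for s using assms[OF that] by auto
  then have "c s * f s * (c s * g s) = f s * g s" if "s \<in> S" for s f g
    using that by (metis mult.assoc mult.commute mult.left_commute mult_1)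
  then have "inner_on S (\<lambda>s. c s * f s) (\<lambda>s. c s * g s) = inner_on S f g" for f g
    unfolding inner_on_def by (intro sum.cong) auto
  then show ?thesis unfolding isometry_on_def by (simp add: algebra_simps)
qed

lemma isometry_on_funpow: "isometry_on S U \<Longrightarrow> isometry_on S (U ^^ k)"
proof (induction k)
  case 0
  then show ?case by (simp add: isometry_on_id id_def)
next
  case (Suc k)
  then show ?case using isometry_on_comp[of S U "U ^^ k"] by (simp add: comp_def)
qed

text \<open>
  This replaces phase estimation: the average of the orbit of \<open>e\<close> under \<open>U\<close> is long
  if \<open>e\<close> overlaps a fixed vector of \<open>U\<close>, and short if \<open>e\<close> is a coboundary \<open>w - U w\<close>, since then the
  sum telescopes.
\<close>

definition orbit_average :: "nat \<Rightarrow> (('b \<Rightarrow> real) \<Rightarrow> 'b \<Rightarrow> real) \<Rightarrow> ('b \<Rightarrow> real) \<Rightarrow> 'b \<Rightarrow> real" where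
  "orbit_average T U e = (\<lambda>s. (\<Sum>t<T. (U ^^ t) e s) / T)"

lemma orbit_average_le:
  assumes U: "isometry_on S U" and T: "T \<ge> 1"
  shows "inner_on S (orbit_average T U e) (orbit_average T U e) \<le> inner_on S e e"
proof -
  have "inner_on S (orbit_average T U e) (orbit_average T U e) = (\<Sum>s\<in>S. (\<Sum>t<T. (U ^^ t) e s)\<^sup>2) / T\<^sup>2"
    by (simp add: inner_on_def orbit_average_def power2_eq_square flip: sum_divide_distrib)
  also have "\<dots> \<le> (\<Sum>s\<in>S. real T * (\<Sum>t<T. ((U ^^ t) e s)\<^sup>2)) / T\<^sup>2"
  proof (intro divide_right_mono sum_mono)
    fix s
    show "(\<Sum>t<T. (U ^^ t) e s)\<^sup>2 \<le> real T * (\<Sum>t<T. ((U ^^ t) e s)\<^sup>2)"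
      using Cauchy_Schwarz_ineq_sum[of "\<lambda>_. 1" "\<lambda>t. (U ^^ t) e s" "{..<T}"] by simp
  qed simp
  also have "\<dots> = (\<Sum>t<T. inner_on S ((U ^^ t) e) ((U ^^ t) e)) / T"
  proof -
    have "(\<Sum>s\<in>S. \<Sum>t<T. ((U ^^ t) e s)\<^sup>2) = (\<Sum>t<T. \<Sum>s\<in>S. ((U ^^ t) e s)\<^sup>2)"
      by (rule sum.swap)
    then show ?thesis by (simp add: inner_on_def power2_eq_square flip: sum_distrib_left)
  qed
  also have "\<dots> = inner_on S e e"
    using T by (simp add: isometry_on_inner[OF isometry_on_funpow[OF U]])
  finally show ?thesis .
qed

text \<open>A fixed vector has the same overlap with every element of the orbit, hence with the
  average; Cauchy-Schwarz turns this into a lower bound on the length.\<close>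

lemma orbit_average_ge:
  assumes U: "isometry_on S U" and T: "T \<ge> 1"
    and fixed: "\<And>s. s \<in> S \<Longrightarrow> U \<psi> s = \<psi> s"
  shows "(inner_on S \<psi> e)\<^sup>2 \<le> inner_on S \<psi> \<psi> * inner_on S (orbit_average T U e) (orbit_average T U e)"
proof -
  have pow: "(U ^^ t) \<psi> s = \<psi> s" if "s \<in> S" for t s
    using that
  proof (induction t arbitrary: s)
    case (Suc t)
    have "U ((U ^^ t) \<psi>) s = U \<psi> s" by (rule isometry_on_cong[OF U Suc.prems Suc.IH])
    then show ?case using fixed[OF Suc.prems] by simp
  qed simp
  have "inner_on S \<psi> ((U ^^ t) e) = inner_on S \<psi> e" for t
    using isometry_on_inner[OF isometry_on_funpow[OF U], of t \<psi> e] pow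
      inner_on_cong[of S "(U ^^ t) \<psi>" \<psi> "(U ^^ t) e" "(U ^^ t) e"] by simp
  then have "inner_on S \<psi> (orbit_average T U e) = inner_on S \<psi> e"
    using T by (simp add: orbit_average_def inner_on_linear inner_on_sum_right)
  then show ?thesis using inner_on_Cauchy_Schwarz[of S \<psi> "orbit_average T U e"] by simp
qed

lemma orbit_average_coboundary:
  assumes U: "isometry_on S U" and T: "T \<ge> 1"
    and cob: "\<And>s. s \<in> S \<Longrightarrow> 2 * e s = w s - U w s"
  shows "inner_on S (orbit_average T U e) (orbit_average T U e) \<le> inner_on S w w / T\<^sup>2"
proof -
  have pow: "(U ^^ t) e s = ((U ^^ t) w s - (U ^^ Suc t) w s) / 2" if "s \<in> S" for t s
  proof -
    note P = isometry_on_funpow[OF U, of t]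
    have "2 * (U ^^ t) e s = (U ^^ t) (\<lambda>s. 2 * e s) s"
      by (simp add: isometry_on_scale[OF P that])
    also have "\<dots> = (U ^^ t) (\<lambda>s. w s - U w s) s" by (rule isometry_on_cong[OF P that cob])
    also have "\<dots> = (U ^^ t) w s - (U ^^ t) (U w) s" by (rule isometry_on_diff[OF P that])
    finally show ?thesis by (simp add: funpow_swap1)
  qed
  have avg: "orbit_average T U e s = (w s - (U ^^ T) w s) / (2 * T)" if "s \<in> S" for s
  proof -
    have "(\<Sum>t<T. (U ^^ t) e s) = (\<Sum>t<T. (U ^^ t) w s - (U ^^ Suc t) w s) / 2"
      unfolding sum_divide_distrib by (intro sum.cong refl pow that)
    also have "\<dots> = (w s - (U ^^ T) w s) / 2" by (subst sum_lessThan_telescope') simp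
    finally show ?thesis using T by (simp add: orbit_average_def field_simps)
  qed
  have "inner_on S (orbit_average T U e) (orbit_average T U e) =
        inner_on S (\<lambda>s. (w s - (U ^^ T) w s) / (2 * T)) (\<lambda>s. (w s - (U ^^ T) w s) / (2 * T))"
    by (intro inner_on_cong avg)
  also have "\<dots> = inner_on S (\<lambda>s. w s - (U ^^ T) w s) (\<lambda>s. w s - (U ^^ T) w s) / (2 * T)\<^sup>2"
    by (simp add: inner_on_divide_left inner_on_divide_right power2_eq_square)
  also have "\<dots> \<le> (2 * inner_on S w w + 2 * inner_on S ((U ^^ T) w) ((U ^^ T) w)) / (2 * T)\<^sup>2"
    by (intro divide_right_mono inner_on_diff_le) simp
  also have "\<dots> = inner_on S w w / T\<^sup>2"
    using T by (simp add: isometry_on_inner[OF isometry_on_funpow[OF U]] power2_eq_square field_simps)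
  finally show ?thesis .
qed

text \<open>\<open>None\<close> is the start state and \<open>Some (e, b)\<close> stands for edge
  \<open>e\<close> with guess \<open>b\<close> for the bit at \<open>q e\<close>.
  \<open>\<psi> x\<close> sits on the right guesses and \<open>w x\<close> on the wrong ones, so the
  adversary identity says exactly that \<open>\<psi> x\<close> is orthogonal to \<open>w y\<close>
  when \<open>x\<close> has value 1 and \<open>y\<close> value 0. The reflection \<open>R\<close>
  negates the span of these \<open>w y\<close> and does not depend on \<open>x\<close>; the sign of
  a guess is the only place where the input enters. For value 1, \<open>\<psi> x\<close> is fixed by
  both factors; for value 0, \<open>w x\<close> changes under their product only at
  \<open>None\<close>.\<close>

lemma quantum_walk_amplitude:
  fixes E :: "nat set" and X :: "(nat \<Rightarrow> bool) set"
  assumes "finite E"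
    and \<phi>: "\<And>x y. x \<in> X \<Longrightarrow> y \<in> X \<Longrightarrow>
      (\<Sum>e\<in>E. of_bool (x (q e) \<noteq> y (q e)) * (U x e * V y e)) = of_bool (f x \<noteq> f y)"
    and W: "\<And>x. x \<in> X \<Longrightarrow> (\<Sum>e\<in>E. (U x e)\<^sup>2) \<le> W" "\<And>x. x \<in> X \<Longrightarrow> (\<Sum>e\<in>E. (V x e)\<^sup>2) \<le> W"
    and "W \<ge> 1" and T: "real T \<ge> 10 * W" and "finite X"
  defines "H \<equiv> insert None (Some ` (E \<times> (UNIV :: bool set)))"
  shows "\<exists>R. isometry_on H R \<and>
    (\<forall>x\<in>X. let a = orbit_average T (\<lambda>g h. (case h of None \<Rightarrow> 1 | Some (e, b) \<Rightarrow> if b = x (q e) then 1 else -1) * R g h)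
                     (\<lambda>h. of_bool (h = None))
           in (f x \<longrightarrow> inner_on H a a \<ge> 9 / 10) \<and> (\<not> f x \<longrightarrow> inner_on H a a \<le> 1 / 10))"
proof -
  have fin: "finite H" using \<open>finite E\<close> by (simp add: H_def)
  have inH: "inner_on H g k = g None * k None + (\<Sum>e\<in>E. \<Sum>b\<in>UNIV. g (Some (e, b)) * k (Some (e, b)))"
    for g k :: "(nat \<times> bool) option \<Rightarrow> real"
    using \<open>finite E\<close> unfolding H_def inner_on_def
    by (subst sum.insert) (auto simp: sum.reindex sum.cartesian_product case_prod_unfold)
  have T1: "T \<ge> 1" using T \<open>W \<ge> 1\<close> by linarith
  \<comment> \<open>\<open>\<epsilon>\<close> balances the two lengths: the square of the fixed
    vector's length is at most 1 + 1/9, which gives 9/10, and that of the transfer vector at most 1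
    + 9 W^2, hence at most 10 W^2, which \<open>T \<ge> 10 * W\<close> reduces to 1/10.\<close>
  define \<epsilon> where "\<epsilon> = 1 / (3 * sqrt W)"
  have \<epsilon>: "\<epsilon> > 0" "\<epsilon>\<^sup>2 * W = 1 / 9" "1 / \<epsilon>\<^sup>2 = 9 * W"
    using \<open>W \<ge> 1\<close> by (auto simp: \<epsilon>_def power_divide power_mult_distrib)
  define \<psi> :: "(nat \<Rightarrow> bool) \<Rightarrow> (nat \<times> bool) option \<Rightarrow> real" where
    "\<psi> x h = (case h of None \<Rightarrow> 1 | Some (e, b) \<Rightarrow> \<epsilon> * U x e * of_bool (b = x (q e)))" for x h
  define w :: "(nat \<Rightarrow> bool) \<Rightarrow> (nat \<times> bool) option \<Rightarrow> real" where
    "w x h = (case h of None \<Rightarrow> 1 | Some (e, b) \<Rightarrow> - V x e * of_bool (b \<noteq> x (q e)) / \<epsilon>)" for x h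
  obtain R where R: "isometry_on H R"
    and neg: "\<And>y h. y \<in> X \<Longrightarrow> \<not> f y \<Longrightarrow> h \<in> H \<Longrightarrow> R (w y) h = - w y h"
    and pos: "\<And>g h. (\<And>y. y \<in> X \<Longrightarrow> \<not> f y \<Longrightarrow> inner_on H g (w y) = 0) \<Longrightarrow> h \<in> H \<Longrightarrow> R g h = g h"
    using ex_reflection[OF fin, of "w ` {y\<in>X. \<not> f y}"] \<open>finite X\<close> by auto
  define \<pi> :: "(nat \<Rightarrow> bool) \<Rightarrow> (nat \<times> bool) option \<Rightarrow> real" where
    "\<pi> x h = (case h of None \<Rightarrow> 1 | Some (e, b) \<Rightarrow> if b = x (q e) then 1 else -1)" for x h
  define e0 :: "(nat \<times> bool) option \<Rightarrow> real" where "e0 = (\<lambda>h. of_bool (h = None))"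
  have iso: "isometry_on H (\<lambda>g h. \<pi> x h * R g h)" for x
    by (rule isometry_on_comp[OF isometry_on_signs R]) (auto simp: \<pi>_def split: option.splits)
  have "inner_on H a a \<ge> 9 / 10" if "x \<in> X" "f x" "a = orbit_average T (\<lambda>g h. \<pi> x h * R g h) e0" for x a
  proof -
    have "inner_on H (\<psi> x) (w y) = 0" if "y \<in> X" "\<not> f y" for y
    proof -
      have "inner_on H (\<psi> x) (w y) = 1 - (\<Sum>e\<in>E. of_bool (x (q e) \<noteq> y (q e)) * (U x e * V y e))"
        unfolding inH using \<epsilon>(1)
        by (auto simp: \<psi>_def w_def UNIV_bool sum_negf[symmetric] of_bool_def intro!: sum.cong)
      then show ?thesis using \<phi>[OF \<open>x \<in> X\<close> that(1)] that \<open>f x\<close> by simp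
    qed
    then have "R (\<psi> x) h = \<psi> x h" if "h \<in> H" for h using pos that by blast
    then have "\<pi> x h * R (\<psi> x) h = \<psi> x h" if "h \<in> H" for h
      using that by (auto simp: \<pi>_def \<psi>_def split: option.splits)
    from orbit_average_ge[OF iso T1 this, of e0]
    have "(inner_on H (\<psi> x) e0)\<^sup>2 \<le> inner_on H (\<psi> x) (\<psi> x) * inner_on H a a"
      by (simp add: that(3))
    moreover have "inner_on H (\<psi> x) e0 = 1"
      unfolding inH by (simp add: \<psi>_def e0_def)
    moreover have "inner_on H (\<psi> x) (\<psi> x) \<le> 10 / 9"
    proof -
      have *: "(\<Sum>b\<in>UNIV. \<psi> x (Some (e, b)) * \<psi> x (Some (e, b))) = \<epsilon>\<^sup>2 * (U x e)\<^sup>2" for e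
        by (cases "x (q e)") (simp_all add: \<psi>_def UNIV_bool power2_eq_square)
      have "inner_on H (\<psi> x) (\<psi> x) = 1 + \<epsilon>\<^sup>2 * (\<Sum>e\<in>E. (U x e)\<^sup>2)"
        unfolding inH * by (simp add: \<psi>_def sum_distrib_left)
      also have "\<dots> \<le> 1 + \<epsilon>\<^sup>2 * W" using W(1)[OF \<open>x \<in> X\<close>] by (simp add: mult_left_mono)
      finally show ?thesis using \<epsilon> by simp
    qed
    moreover have "inner_on H a a \<ge> 0" by (rule inner_on_self_nonneg)
    ultimately have "1 \<le> 10 / 9 * inner_on H a a"
      using mult_right_mono[of "inner_on H (\<psi> x) (\<psi> x)" "10 / 9" "inner_on H a a"] by simp
    then show ?thesis by simp
  qed
  moreover have "inner_on H a a \<le> 1 / 10"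
    if "x \<in> X" "\<not> f x" "a = orbit_average T (\<lambda>g h. \<pi> x h * R g h) e0" for x a
  proof -
    have *: "(\<Sum>b\<in>UNIV. w x (Some (e, b)) * w x (Some (e, b))) = (1 / \<epsilon>\<^sup>2) * (V x e)\<^sup>2" for e
      by (cases "x (q e)") (simp_all add: w_def UNIV_bool power2_eq_square)
    have TW: "(10 * W)\<^sup>2 \<le> (real T)\<^sup>2" using T \<open>W \<ge> 1\<close> by (intro power_mono) auto
    have "2 * e0 h = w x h - \<pi> x h * R (w x) h" if "h \<in> H" for h
      using neg[OF \<open>x \<in> X\<close> \<open>\<not> f x\<close> that]
      by (auto simp: e0_def w_def \<pi>_def split: option.splits)
    from orbit_average_coboundary[OF iso T1 this]
    have "inner_on H a a \<le> inner_on H (w x) (w x) / T\<^sup>2" by (simp add: that(3))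
    also have "inner_on H (w x) (w x) = 1 + (1 / \<epsilon>\<^sup>2) * (\<Sum>e\<in>E. (V x e)\<^sup>2)"
      unfolding inH * by (simp add: w_def sum_distrib_left)
    also have "(1 + (1 / \<epsilon>\<^sup>2) * (\<Sum>e\<in>E. (V x e)\<^sup>2)) / T\<^sup>2 \<le> (W\<^sup>2 + 9 * W * W) / (10 * W)\<^sup>2"
    proof (intro frac_le add_mono power_mono)
      show "1 / \<epsilon>\<^sup>2 * (\<Sum>e\<in>E. (V x e)\<^sup>2) \<le> 9 * W * W"
        unfolding \<epsilon>(3) using W(2)[OF \<open>x \<in> X\<close>] \<open>W \<ge> 1\<close> by (intro mult_left_mono) auto
    qed (use TW \<open>W \<ge> 1\<close> in auto)
    also have "\<dots> = 1 / 10" using \<open>W \<ge> 1\<close> by (simp add: power2_eq_square)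
    finally show ?thesis .
  qed
  ultimately show ?thesis
    using R unfolding Let_def \<pi>_def e0_def by (intro exI[of _ R]) auto
qed

text \<open>The circuit runs in uniform superposition over \<open>\<omega>\<close> and over a time
  register, so that it accepts with the mean over \<open>\<omega>\<close> of the squared length of
  the orbit average. At most one eighth of the \<open>\<omega>\<close> carry no guarantee for a
  given input, and 1/10 + 1/8 is below 1/3.\<close>

lemma quantum_query_complexity_le_adv_bound:
  fixes \<Omega> :: "'w set" and X :: "'w \<Rightarrow> (nat \<Rightarrow> bool) set"
  assumes N: "N \<ge> 1" and \<Omega>: "finite \<Omega>" "\<Omega> \<noteq> {}" and W: "W \<ge> 1"
    and adv: "\<And>\<omega>. \<omega> \<in> \<Omega> \<Longrightarrow> adv_bound N (X \<omega>) (\<lambda>x. of_bool (f x)) (\<lambda>_. W)"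
    and bad: "\<And>x. x \<in> cube N \<Longrightarrow> 8 * card {\<omega>\<in>\<Omega>. x \<notin> X \<omega>} \<le> card \<Omega>"
  shows "real (quantum_query_complexity N f) \<le> 10 * W + 1"
proof -
  define T where "T = nat \<lceil>10 * W\<rceil>"
  have T: "real T \<ge> 10 * W" "T \<ge> 1" "real T \<le> 10 * W + 1"
    using W by (auto simp: T_def) linarith+
  have "\<exists>E q U V. adv_system N (X \<omega>) (\<lambda>x. of_bool (f x)) (\<lambda>_. W) E q U V" if "\<omega> \<in> \<Omega>" for \<omega>
    using adv[OF that] by (simp add: adv_bound_def)
  then obtain E q U V where
    Q: "\<And>\<omega>. \<omega> \<in> \<Omega> \<Longrightarrow> adv_system N (X \<omega>) (\<lambda>x. of_bool (f x)) (\<lambda>_. W) (E \<omega>) (q \<omega>) (U \<omega>) (V \<omega>)"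
    by metis
  note E = adv_systemD(1)[OF Q] and q = adv_systemD(2)[OF Q] and UW = adv_systemD(4)[OF Q]
    and VW = adv_systemD(5)[OF Q]
  have UV: "(\<Sum>e\<in>E \<omega>. of_bool (x (q \<omega> e) \<noteq> y (q \<omega> e)) * (U \<omega> x e * V \<omega> y e)) = of_bool (f x \<noteq> f y)"
    if "\<omega> \<in> \<Omega>" "x \<in> X \<omega>" "y \<in> X \<omega>" for \<omega> x y
    using adv_systemD(3)[OF Q[OF that(1)] that(2,3)] by simp
  have X: "X \<omega> \<subseteq> cube N" if "\<omega> \<in> \<Omega>" for \<omega> using adv[OF that] by (simp add: adv_bound_def)
  have finX: "finite (X \<omega>)" if "\<omega> \<in> \<Omega>" for \<omega>
    using X[OF that] by (rule finite_subset) (auto simp: cube_def intro: finite_PiE)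
  define EE where "EE = (\<Union>\<omega>\<in>\<Omega>. E \<omega>)"
  have EE: "finite EE" using \<Omega>(1) E by (auto simp: EE_def)
  \<comment> \<open>All \<open>\<omega>\<close> must share one state space, so each solution is
    padded to the union of the edge sets; padded edges have weight zero and query the dummy position
    1.\<close>
  define p where "p \<omega> e = (if e \<in> E \<omega> then q \<omega> e else 1)" for \<omega> e
  have p: "p \<omega> e \<in> {1..N}" if "\<omega> \<in> \<Omega>" for \<omega> e using q[OF that, of e] N by (auto simp: p_def)
  define H where "H = insert None (Some ` (EE \<times> (UNIV :: bool set)))"
  define \<pi> :: "'w \<Rightarrow> (nat \<Rightarrow> bool) \<Rightarrow> (nat \<times> bool) option \<Rightarrow> real" where
    "\<pi> \<omega> x h = (case h of None \<Rightarrow> 1 | Some (e, b) \<Rightarrow> if b = x (p \<omega> e) then 1 else -1)" for \<omega> x h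
  define e0 :: "(nat \<times> bool) option \<Rightarrow> real" where "e0 = (\<lambda>h. of_bool (h = None))"
  define Q' where "Q' \<omega> R \<longleftrightarrow> isometry_on H R \<and>
    (\<forall>x\<in>X \<omega>. let a = orbit_average T (\<lambda>g h. \<pi> \<omega> x h * R g h) e0
           in (f x \<longrightarrow> inner_on H a a \<ge> 9 / 10) \<and> (\<not> f x \<longrightarrow> inner_on H a a \<le> 1 / 10))" for \<omega> R
  have "\<exists>R. Q' \<omega> R" if \<omega>: "\<omega> \<in> \<Omega>" for \<omega>
  proof -
    have sub: "E \<omega> \<subseteq> EE" using \<omega> by (auto simp: EE_def)
    define U' where "U' x e = (if e \<in> E \<omega> then U \<omega> x e else 0)" for x e
    define V' where "V' x e = (if e \<in> E \<omega> then V \<omega> x e else 0)" for x e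
    have sum0: "(\<Sum>e\<in>EE. g e) = (\<Sum>e\<in>E \<omega>. g e)" if "\<And>e. e \<notin> E \<omega> \<Longrightarrow> g e = (0 :: real)" for g
      using that EE sub by (intro sum.mono_neutral_right) auto
    show ?thesis
      unfolding Q'_def \<pi>_def e0_def H_def
    proof (rule quantum_walk_amplitude[OF EE _ _ _ W T(1) finX[OF \<omega>], of _ U' V'])
      show "(\<Sum>e\<in>EE. of_bool (x (p \<omega> e) \<noteq> y (p \<omega> e)) * (U' x e * V' y e)) = of_bool (f x \<noteq> f y)"
        if "x \<in> X \<omega>" "y \<in> X \<omega>" for x y
        using UV[OF \<omega> that] by (subst sum0) (auto simp: U'_def V'_def p_def)
      show "(\<Sum>e\<in>EE. (U' x e)\<^sup>2) \<le> W" if "x \<in> X \<omega>" for x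
        using UW[OF \<omega> that] by (subst sum0) (auto simp: U'_def)
      show "(\<Sum>e\<in>EE. (V' x e)\<^sup>2) \<le> W" if "x \<in> X \<omega>" for x
        using VW[OF \<omega> that] by (subst sum0) (auto simp: V'_def)
    qed
  qed
  then obtain R where Q': "\<And>\<omega>. \<omega> \<in> \<Omega> \<Longrightarrow> Q' \<omega> (R \<omega>)" by metis
  then have R: "isometry_on H (R \<omega>)" if "\<omega> \<in> \<Omega>" for \<omega> using that by (simp add: Q'_def)
  have amp: "(f x \<longrightarrow> inner_on H a a \<ge> 9 / 10) \<and> (\<not> f x \<longrightarrow> inner_on H a a \<le> 1 / 10)"
    if "\<omega> \<in> \<Omega>" "x \<in> X \<omega>" "a = orbit_average T (\<lambda>g h. \<pi> \<omega> x h * R \<omega> g h) e0" for \<omega> x a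
    using Q'[OF that(1)] that(2,3) by (simp add: Q'_def Let_def)
  define Us where "Us \<omega> x = (\<lambda>g h. \<pi> \<omega> x h * R \<omega> g h)" for \<omega> x
  have Us: "isometry_on H (Us \<omega> x)" if "\<omega> \<in> \<Omega>" for \<omega> x
    unfolding Us_def
    by (rule isometry_on_comp[OF isometry_on_signs R[OF that]]) (auto simp: \<pi>_def split: option.splits)
  define c where "c = 1 / sqrt (real (card \<Omega>) * real T)"
  have card\<Omega>: "card \<Omega> > 0" using \<Omega> by (simp add: card_gt_0_iff)
  have c2: "c * c = 1 / (real (card \<Omega>) * real T)" by (simp add: c_def)
  have finH: "finite H" using EE by (simp add: H_def)
  have e0: "inner_on H e0 e0 = 1"
    unfolding e0_def using finH by (subst inner_on_of_bool) (auto simp: H_def)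
  define S where "S = \<Omega> \<times> {..<T} \<times> H"
  have finS: "finite S" using \<Omega> finH by (simp add: S_def)
  define pos :: "'w \<times> nat \<times> (nat \<times> bool) option \<Rightarrow> nat" where
    "pos = (\<lambda>(\<omega>, t, h). case h of None \<Rightarrow> 0 | Some (e, b) \<Rightarrow> p \<omega> e)"
  define sgn' :: "'w \<times> nat \<times> (nat \<times> bool) option \<Rightarrow> real" where
    "sgn' = (\<lambda>(\<omega>, t, h). case h of None \<Rightarrow> 1 | Some (e, b) \<Rightarrow> if b then -1 else 1)"
  \<comment> \<open>Component \<open>t\<close> waits in \<open>e0\<close>, where the oracle acts trivially, until \<open>t\<close> of the \<open>T\<close> steps are left.\<close>
  define st where "st x s = (\<lambda>(\<omega>, t, h). c * (Us \<omega> x ^^ (s + t - T)) e0 h)" for x s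
  define Rs where "Rs s g = (\<lambda>(\<omega>, t, h). (if T < s + 1 + t then R \<omega> (\<lambda>h. g (\<omega>, t, h)) h else g (\<omega>, t, h)))"
    for s and g :: "'w \<times> nat \<times> (nat \<times> bool) option \<Rightarrow> real"
  \<comment> \<open>The reflection along \<open>v\<close> takes the uniform vector on the time
    register to time 0; measuring time 0 therefore projects onto the average over the steps.\<close>
  define v where "v t = 1 / sqrt (real T) - of_bool (t = 0)" for t :: nat
  define G where "G g = (\<lambda>(\<omega>, t, h). householder {..<T} v (\<lambda>t. g (\<omega>, t, h)) t)"
    for g :: "'w \<times> nat \<times> (nat \<times> bool) option \<Rightarrow> real"
  have RsI: "isometry_on S (Rs s)" for s
    unfolding S_def
  proof (rule isometry_on_cong_map)
    show "isometry_on (\<Omega> \<times> {..<T} \<times> H) (\<lambda>f (\<omega>, r). (\<lambda>f (t, h).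
         (if T < s + 1 + t then R \<omega> else (\<lambda>f. f)) (\<lambda>h. f (t, h)) h) (\<lambda>r. f (\<omega>, r)) r)"
      by (intro isometry_on_fibers) (auto simp: R isometry_on_id)
  qed (auto simp: Rs_def)
  have GI: "isometry_on S G"
    unfolding S_def
  proof (rule isometry_on_cong_map)
    show "isometry_on (\<Omega> \<times> {..<T} \<times> H) (\<lambda>f (\<omega>, r). (\<lambda>f (t, h).
         householder {..<T} v (\<lambda>t. f (t, h)) t) (\<lambda>r. f (\<omega>, r)) r)"
      by (intro isometry_on_fibers isometry_on_fibers_swap isometry_on_householder)
  qed (auto simp: G_def)
  have st_norm: "inner_on S (st x s) (st x s) = 1" for x s
  proof -
    have "inner_on H (\<lambda>h. st x s (\<omega>, t, h)) (\<lambda>h. st x s (\<omega>, t, h)) = c * c" if "\<omega> \<in> \<Omega>" for \<omega> t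
      by (simp add: st_def inner_on_scale_left inner_on_scale_right
          isometry_on_inner[OF isometry_on_funpow[OF Us[OF that]]] e0)
    then have "inner_on S (st x s) (st x s) = (\<Sum>\<omega>\<in>\<Omega>. \<Sum>t<T. c * c)"
      unfolding S_def inner_on_Times by (intro sum.cong) auto
    then show ?thesis using card\<Omega> T(2) by (simp add: c2)
  qed
  have G0: "G g (\<omega>, 0, h) = (\<Sum>t<T. g (\<omega>, t, h)) / sqrt T" for g \<omega> h
  proof -
    let ?u = "\<lambda>t :: nat. 1 / sqrt (real T)" and ?e = "\<lambda>t :: nat. of_bool (t = 0) :: real"
    have "inner_on {..<T} ?u ?u = inner_on {..<T} ?e ?e"
      using T(2) by (subst inner_on_of_bool) (auto simp: inner_on_def)
    then have sw: "householder {..<T} v ?u t = ?e t" if "t < T" for t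
      unfolding v_def[abs_def] using that by (intro householder_swap) auto
    have "G g (\<omega>, 0, h) = inner_on {..<T} (householder {..<T} v (\<lambda>t. g (\<omega>, t, h))) ?e"
      using T(2) by (subst inner_on_of_bool) (auto simp: G_def)
    also have "\<dots> = inner_on {..<T} (householder {..<T} v (\<lambda>t. g (\<omega>, t, h))) (householder {..<T} v ?u)"
      by (intro inner_on_cong) (auto simp: sw)
    also have "\<dots> = inner_on {..<T} (\<lambda>t. g (\<omega>, t, h)) ?u"
      by (rule isometry_on_inner[OF isometry_on_householder])
    finally show ?thesis by (simp add: inner_on_def sum_divide_distrib)
  qed
  define avg where "avg \<omega> x = orbit_average T (Us \<omega> x) e0" for \<omega> x
  define acc where "acc x = (\<Sum>\<omega>\<in>\<Omega>. inner_on H (avg \<omega> x) (avg \<omega> x)) / card \<Omega>" for x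
  have G_st: "G (st x T) (\<omega>, 0, h) = avg \<omega> x h / sqrt (card \<Omega>)" for x \<omega> h
  proof -
    have "G (st x T) (\<omega>, 0, h) = c * (\<Sum>t<T. (Us \<omega> x ^^ t) e0 h) / sqrt T"
      by (simp add: G0 st_def sum_distrib_left)
    also have "\<dots> = avg \<omega> x h / sqrt (card \<Omega>)"
      using T(2) by (simp add: avg_def orbit_average_def c_def real_sqrt_mult field_simps)
    finally show ?thesis .
  qed
  define A where "A = {s :: 'w \<times> nat \<times> (nat \<times> bool) option. fst (snd s) = 0}"
  have sum_acc: "(\<Sum>s | s \<in> S \<and> s \<in> A. (G (st x T) s)\<^sup>2) = acc x" for x
  proof -
    have "{s. s \<in> S \<and> s \<in> A} = \<Omega> \<times> {0} \<times> H" using T(2) by (auto simp: S_def A_def)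
    then have "(\<Sum>s | s \<in> S \<and> s \<in> A. (G (st x T) s)\<^sup>2) = (\<Sum>\<omega>\<in>\<Omega>. \<Sum>h\<in>H. (G (st x T) (\<omega>, 0, h))\<^sup>2)"
      by (simp add: sum.cartesian_product[symmetric] case_prod_unfold[symmetric] sum.cartesian_product')
    then show ?thesis
      by (simp add: G_st acc_def inner_on_def power_divide power2_eq_square sum_divide_distrib)
  qed
  have sum_rej: "(\<Sum>s | s \<in> S \<and> s \<notin> A. (G (st x T) s)\<^sup>2) = 1 - acc x" for x
  proof -
    have "(\<Sum>s\<in>S. (G (st x T) s)\<^sup>2) = 1"
      using isometry_on_inner[OF GI, of "st x T" "st x T"] st_norm[of x T]
      by (simp add: inner_on_def power2_eq_square)
    moreover have "(\<Sum>s\<in>S. (G (st x T) s)\<^sup>2) =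
        (\<Sum>s | s \<in> S \<and> s \<in> A. (G (st x T) s)\<^sup>2) + (\<Sum>s | s \<in> S \<and> s \<notin> A. (G (st x T) s)\<^sup>2)"
      using finS by (subst sum.union_disjoint[symmetric]) (auto intro!: sum.cong)
    ultimately show ?thesis by (simp add: sum_acc)
  qed
  have avg_le: "inner_on H (avg \<omega> x) (avg \<omega> x) \<le> 1" if "\<omega> \<in> \<Omega>" for \<omega> x
    using orbit_average_le[OF Us[OF that] T(2), of x e0] by (simp add: avg_def e0)
  have acc_false: "acc x \<le> 1 / 3" if x: "x \<in> cube N" "\<not> f x" for x
  proof -
    have "(\<Sum>\<omega>\<in>\<Omega>. inner_on H (avg \<omega> x) (avg \<omega> x)) \<le> (\<Sum>\<omega>\<in>\<Omega>. 1 / 10 + of_bool (x \<notin> X \<omega>))"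
    proof (rule sum_mono)
      fix \<omega> assume "\<omega> \<in> \<Omega>"
      then show "inner_on H (avg \<omega> x) (avg \<omega> x) \<le> 1 / 10 + of_bool (x \<notin> X \<omega>)"
        using avg_le[of \<omega> x] amp[of \<omega> x "avg \<omega> x"] x(2) by (auto simp: avg_def Us_def)
    qed
    also have "\<dots> = card \<Omega> / 10 + card {\<omega>\<in>\<Omega>. x \<notin> X \<omega>}"
      using \<Omega> by (simp add: sum.distrib Int_def)
    finally show ?thesis
      using bad[OF x(1)] card\<Omega> by (simp add: acc_def field_simps)
  qed
  have acc_true: "1 - acc x \<le> 1 / 3" if x: "x \<in> cube N" "f x" for x
  proof -
    have "(\<Sum>\<omega>\<in>\<Omega>. 9 / 10 - of_bool (x \<notin> X \<omega>)) \<le> (\<Sum>\<omega>\<in>\<Omega>. inner_on H (avg \<omega> x) (avg \<omega> x))"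
    proof (rule sum_mono)
      fix \<omega> assume "\<omega> \<in> \<Omega>"
      then show "9 / 10 - of_bool (x \<notin> X \<omega>) \<le> inner_on H (avg \<omega> x) (avg \<omega> x)"
        using inner_on_self_nonneg[of H "avg \<omega> x"] amp[of \<omega> x "avg \<omega> x"] x(2)
        by (auto simp: avg_def Us_def)
    qed
    moreover have "(\<Sum>\<omega>\<in>\<Omega>. 9 / 10 - of_bool (x \<notin> X \<omega>)) = 9 * card \<Omega> / 10 - real (card {\<omega>\<in>\<Omega>. x \<notin> X \<omega>})"
      using \<Omega> by (simp add: sum_subtractf Int_def)
    ultimately show ?thesis
      using bad[OF x(1)] card\<Omega> by (simp add: acc_def field_simps)
  qed
  have "quantum_query_complexity N f \<le> T"
  proof (rule quantum_query_complexity_le_phase_circuit[OF N T(2) finS, where q = pos and A = A and f = f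
        and R = Rs and G = G and F = "\<lambda>g s. sgn' s * g s" and state = st and \<chi>\<^sub>0 = "\<lambda>(\<omega>, t, h). c * e0 h"])
    show "pos s \<le> N" if "s \<in> S" for s
      using that p by (auto simp: pos_def S_def split: option.splits)
    have st0: "st x 0 (\<omega>, t, h) = c * e0 h" if "t < T" for x \<omega> t h
      using that by (simp add: st_def)
    have "inner_on S (st undefined 0) (st undefined 0) =
        inner_on S (\<lambda>(\<omega>, t, h). c * e0 h) (\<lambda>(\<omega>, t, h). c * e0 h)"
      by (intro inner_on_cong) (auto simp: S_def st0)
    then show "inner_on S (\<lambda>(\<omega>, t, h). c * e0 h) (\<lambda>(\<omega>, t, h). c * e0 h) = 1"
      by (simp add: st_norm)
    show "isometry_on S (\<lambda>g s. sgn' s * g s)"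
      by (rule isometry_on_signs) (auto simp: sgn'_def split: option.splits)
  next
    fix x t s assume x: "x \<in> cube N" and t: "t < T" and s: "s \<in> S"
    obtain \<omega> \<tau> h where s_eq: "s = (\<omega>, \<tau>, h)" by (cases s)
    then have \<omega>: "\<omega> \<in> \<Omega>" and \<tau>: "\<tau> < T" and h: "h \<in> H" using s by (auto simp: S_def)
    have p0: "p \<omega> e \<noteq> 0" for e using p[OF \<omega>, of e] by auto
    define r where "r = Rs t (st x t) (\<omega>, \<tau>, h)"
    have "sgn' s * (if pos s \<noteq> 0 \<and> x (pos s) then - Rs t (st x t) s else Rs t (st x t) s) = \<pi> \<omega> x h * r"
      by (auto simp: p0 s_eq sgn'_def pos_def \<pi>_def r_def split: option.splits)
    also have "\<dots> = st x (Suc t) s"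
    proof (cases "T < t + 1 + \<tau>")
      case True
      then have "Suc t + \<tau> - T = Suc (t + \<tau> - T)" by simp
      then show ?thesis
        using True isometry_on_scale[OF R[OF \<omega>] h]
        by (simp add: r_def Rs_def s_eq st_def Us_def)
    next
      case False
      then show ?thesis
        by (auto simp: r_def Rs_def s_eq st_def e0_def \<pi>_def split: option.splits)
    qed
    finally show "st x (Suc t) s = sgn' s * (if pos s \<noteq> 0 \<and> x (pos s) then - Rs t (st x t) s else Rs t (st x t) s)"
      by simp
  next
    fix x assume x: "x \<in> cube N"
    show "(\<Sum>s | s \<in> S \<and> (s \<in> A) \<noteq> f x. (G (st x T) s)\<^sup>2) \<le> 1 / 3"
      using acc_true[OF x] acc_false[OF x] sum_acc[of x] sum_rej[of x] by (cases "f x") simp_all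
  qed (auto simp: RsI[unfolded S_def] GI[unfolded S_def] S_def st_def)
  then show ?thesis using T(3) by linarith
qed

section \<open>Composition of query algorithms\<close>

text \<open>Only the partition of the inputs by \<open>g\<close> enters the constraints, so
  relabelling outputs is free.\<close>

lemma adv_bound_mono:
  assumes "adv_bound N X g \<phi>" "Y \<subseteq> X" "\<And>x. x \<in> Y \<Longrightarrow> \<phi> x \<le> \<psi> x"
    and "\<And>x y. x \<in> Y \<Longrightarrow> y \<in> Y \<Longrightarrow> g' x = g' y \<longleftrightarrow> g x = g y"
  shows "adv_bound N Y g' \<psi>"
proof -
  from assms(1) obtain E q U V where S: "adv_system N X g \<phi> E q U V" and X: "X \<subseteq> cube N"
    unfolding adv_bound_def by blast
  note E = adv_systemD(1,2)[OF S] and 1 = adv_systemD(3)[OF S] and 2 = adv_systemD(4,5)[OF S]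
  show ?thesis
  proof (rule adv_boundI[of Y N E q U V])
    show "Y \<subseteq> cube N" "finite E" using X assms(2) E by auto
    show "q e \<in> {1..N}" if "e \<in> E" for e using E(2) that by auto
  next
    fix x y assume "x \<in> Y" "y \<in> Y"
    then have "x \<in> X" "y \<in> X" "g' x = g' y \<longleftrightarrow> g x = g y" using assms(2,4) by auto
    then show "(\<Sum>e\<in>E. of_bool (x (q e) \<noteq> y (q e)) * (U x e * V y e)) = of_bool (g' x \<noteq> g' y)"
      using 1[of x y] by simp
  next
    fix x assume "x \<in> Y"
    then show "(\<Sum>e\<in>E. (U x e)\<^sup>2) \<le> \<psi> x" "(\<Sum>e\<in>E. (V x e)\<^sup>2) \<le> \<psi> x"
      using 2[of x] assms(2) assms(3)[of x] by auto
  qed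
qed

lemma adv_bound_const: "X \<subseteq> cube N \<Longrightarrow> adv_bound N X (\<lambda>_. a) (\<lambda>_. 0)"
  by (rule adv_boundI[of _ _ "{}"]) auto

lemma adv_bound_bit:
  assumes "X \<subseteq> cube N" "i \<in> {1..N}"
  shows "adv_bound N X (\<lambda>x. of_bool (x i)) (\<lambda>_. 1)"
  by (rule adv_boundI[of X N "{0}" "\<lambda>_. i" "\<lambda>_ _. 1" "\<lambda>_ _. 1"]) (use assms in auto)

text \<open>Block 0 carries the solution for \<open>g\<close> and block \<open>Suc a\<close> the one
  for \<open>h a\<close>, switched on only for inputs with \<open>g x = a\<close>. A pair separated
  by \<open>g\<close> is counted by block 0 alone, any other pair only by the block of their common
  label. Costs add exactly, input by input, without any loss from error reduction.\<close>

lemma adv_bound_bind: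
  assumes g: "adv_bound N X g \<phi>" and h: "\<And>a. adv_bound N {x\<in>X. g x = a} (h a) (\<psi> a)"
  shows "adv_bound N X (\<lambda>x. prod_encode (g x, h (g x) x)) (\<lambda>x. \<phi> x + \<psi> (g x) x)"
proof -
  from g obtain E q U V where S: "adv_system N X g \<phi> E q U V" and X: "X \<subseteq> cube N"
    unfolding adv_bound_def by blast
  note E = adv_systemD(1,2)[OF S] and 1 = adv_systemD(3)[OF S] and 2 = adv_systemD(4,5)[OF S]
  define S' where "S' a = adv_system N {x\<in>X. g x = a} (h a) (\<psi> a)" for a
  have "\<exists>E q U V. S' a E q U V" for a
    using h[of a] by (simp add: adv_bound_def S'_def)
  then obtain Es qs Us Vs where "\<And>a. S' a (Es a) (qs a) (Us a) (Vs a)"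
    by metis
  then have Q: "\<And>a. adv_system N {x\<in>X. g x = a} (h a) (\<psi> a) (Es a) (qs a) (Us a) (Vs a)"
    by (simp add: S'_def)
  note finE = adv_systemD(1)[OF Q] and qE = adv_systemD(2)[OF Q]
  have Q1: "(\<Sum>e\<in>Es a. of_bool (x (qs a e) \<noteq> y (qs a e)) * (Us a x e * Vs a y e)) = of_bool (h a x \<noteq> h a y)"
    if "x \<in> X" "g x = a" "y \<in> X" "g y = a" for a x y
    using that by (intro adv_systemD(3)[OF Q]) auto
  have QU: "(\<Sum>e\<in>Es a. (Us a x e)\<^sup>2) \<le> \<psi> a x" if "x \<in> X" "g x = a" for a x
    using adv_systemD(4)[OF Q, of x a] that by simp
  have QV: "(\<Sum>e\<in>Es a. (Vs a x e)\<^sup>2) \<le> \<psi> a x" if "x \<in> X" "g x = a" for a x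
    using adv_systemD(5)[OF Q, of x a] that by simp
  have finX: "finite X" using X by (rule finite_subset) (auto simp: cube_def intro: finite_PiE)
  define B where "B = insert 0 (Suc ` g ` X)"
  have B: "finite B" using finX by (simp add: B_def)
  define F where "F j = (case j of 0 \<Rightarrow> E | Suc a \<Rightarrow> Es a)" for j
  have F: "finite (F j)" for j using E finE by (auto simp: F_def split: nat.splits)
  define E' where "E' = prod_encode ` Sigma B F"
  define q' where "q' k = (case prod_decode k of (0, e) \<Rightarrow> q e | (Suc a, e) \<Rightarrow> qs a e)" for k
  define U' where "U' x k = (case prod_decode k of (0, e) \<Rightarrow> U x e | (Suc a, e) \<Rightarrow> if g x = a then Us a x e else 0)" for x k
  define V' where "V' x k = (case prod_decode k of (0, e) \<Rightarrow> V x e | (Suc a, e) \<Rightarrow> if g x = a then Vs a x e else 0)" for x k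
  have sumE': "(\<Sum>k\<in>E'. G k) = (\<Sum>e\<in>E. G (prod_encode (0, e))) +
      (\<Sum>a\<in>g ` X. \<Sum>e\<in>Es a. G (prod_encode (Suc a, e)))" for G :: "nat \<Rightarrow> real"
  proof -
    have "(\<Sum>k\<in>E'. G k) = (\<Sum>j\<in>B. \<Sum>e\<in>F j. G (prod_encode (j, e)))"
      unfolding E'_def using B F
      by (subst sum.reindex) (auto simp: inj_prod_encode sum.Sigma case_prod_unfold)
    also have "\<dots> = (\<Sum>e\<in>E. G (prod_encode (0, e))) + (\<Sum>j\<in>Suc ` g ` X. \<Sum>e\<in>F j. G (prod_encode (j, e)))"
      unfolding B_def using finX by (subst sum.insert) (auto simp: F_def)
    finally show ?thesis by (subst (asm) sum.reindex) (auto simp: F_def)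
  qed
  have single: "(\<Sum>a\<in>g ` X. if g x = a then G a else 0) = G (g x)" if "x \<in> X" for x and G :: "nat \<Rightarrow> real"
    using that finX by simp
  show ?thesis
  proof (rule adv_boundI[of X N E' q' U' V'])
    show "X \<subseteq> cube N" by (rule X)
    show "finite E'" using B F by (simp add: E'_def)
    fix k assume "k \<in> E'"
    then show "q' k \<in> {1..N}"
      using E(2) qE by (force simp: E'_def q'_def F_def split: nat.splits)
  next
    fix x y assume x: "x \<in> X" and y: "y \<in> X"
    have "(\<Sum>k\<in>E'. of_bool (x (q' k) \<noteq> y (q' k)) * (U' x k * V' y k)) =
        of_bool (g x \<noteq> g y) + (\<Sum>a\<in>g ` X. \<Sum>e\<in>Es a. of_bool (x (qs a e) \<noteq> y (qs a e)) *
           ((if g x = a then Us a x e else 0) * (if g y = a then Vs a y e else 0)))"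
      unfolding sumE' using 1 x y by (simp add: q'_def U'_def V'_def)
    also have "(\<Sum>a\<in>g ` X. \<Sum>e\<in>Es a. of_bool (x (qs a e) \<noteq> y (qs a e)) *
           ((if g x = a then Us a x e else 0) * (if g y = a then Vs a y e else 0))) =
        (\<Sum>a\<in>g ` X. if g x = a then of_bool (g x = g y \<and> h a x \<noteq> h a y) else 0)"
    proof (rule sum.cong[OF refl])
      fix a
      show "(\<Sum>e\<in>Es a. of_bool (x (qs a e) \<noteq> y (qs a e)) *
           ((if g x = a then Us a x e else 0) * (if g y = a then Vs a y e else 0))) =
        (if g x = a then of_bool (g x = g y \<and> h a x \<noteq> h a y) else 0)"
        using Q1[OF x _ y, of a] by (cases "g x = a"; cases "g y = a") auto
    qed
    also have "\<dots> = of_bool (g x = g y \<and> h (g x) x \<noteq> h (g x) y)" by (rule single[OF x])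
    also have "of_bool (g x \<noteq> g y) + of_bool (g x = g y \<and> h (g x) x \<noteq> h (g x) y) =
        (of_bool (prod_encode (g x, h (g x) x) \<noteq> prod_encode (g y, h (g y) y)) :: real)"
      by auto
    finally show "(\<Sum>k\<in>E'. of_bool (x (q' k) \<noteq> y (q' k)) * (U' x k * V' y k)) =
        of_bool (prod_encode (g x, h (g x) x) \<noteq> prod_encode (g y, h (g y) y))" .
  next
    fix x assume x: "x \<in> X"
    have "(\<Sum>k\<in>E'. (U' x k)\<^sup>2) = (\<Sum>e\<in>E. (U x e)\<^sup>2) + (\<Sum>a\<in>g ` X. if g x = a then \<Sum>e\<in>Es a. (Us a x e)\<^sup>2 else 0)"
      unfolding sumE' by (auto simp: U'_def intro!: sum.cong)
    also have "\<dots> \<le> \<phi> x + \<psi> (g x) x"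
      unfolding single[OF x] using 2(1)[OF x] QU[OF x refl] by (rule add_mono)
    finally show "(\<Sum>k\<in>E'. (U' x k)\<^sup>2) \<le> \<phi> x + \<psi> (g x) x" .
    have "(\<Sum>k\<in>E'. (V' x k)\<^sup>2) = (\<Sum>e\<in>E. (V x e)\<^sup>2) + (\<Sum>a\<in>g ` X. if g x = a then \<Sum>e\<in>Es a. (Vs a x e)\<^sup>2 else 0)"
      unfolding sumE' by (auto simp: V'_def intro!: sum.cong)
    also have "\<dots> \<le> \<phi> x + \<psi> (g x) x"
      unfolding single[OF x] using 2(2)[OF x] QV[OF x refl] by (rule add_mono)
    finally show "(\<Sum>k\<in>E'. (V' x k)\<^sup>2) \<le> \<phi> x + \<psi> (g x) x" .
  qed
qed

text \<open>
  For a Boolean output the label may be coarsened at no cost: \<open>U x\<close> is moved to the block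
  \<open>P (g x)\<close> and \<open>V y\<close> to the block \<open>\<not> P (g y)\<close>, which kills the pairs with equal outputs.
\<close>

lemma adv_bound_bool:
  assumes g: "adv_bound N X g \<phi>"
  shows "adv_bound N X (\<lambda>x. of_bool (P (g x))) \<phi>"
proof -
  from g obtain E q U V where S: "adv_system N X g \<phi> E q U V" and X: "X \<subseteq> cube N"
    unfolding adv_bound_def by blast
  note E = adv_systemD(1,2)[OF S] and 1 = adv_systemD(3)[OF S] and 2 = adv_systemD(4,5)[OF S]
  define E' where "E' = prod_encode ` (E \<times> {0, 1})"
  define q' where "q' k = q (fst (prod_decode k))" for k
  define U' where "U' x k = (if snd (prod_decode k) = of_bool (P (g x)) then U x (fst (prod_decode k)) else 0)" for x k
  define V' where "V' x k = (if snd (prod_decode k) \<noteq> of_bool (P (g x)) then V x (fst (prod_decode k)) else 0)" for x k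
  have sumE': "(\<Sum>k\<in>E'. G k) = (\<Sum>e\<in>E. G (prod_encode (e, 0)) + G (prod_encode (e, 1)))" for G :: "nat \<Rightarrow> real"
  proof -
    have "(\<Sum>k\<in>E'. G k) = (\<Sum>p\<in>E \<times> {0, 1}. G (prod_encode p))"
      unfolding E'_def by (subst sum.reindex) (auto simp: inj_prod_encode)
    also have "\<dots> = (\<Sum>e\<in>E. \<Sum>b\<in>{0, 1}. G (prod_encode (e, b)))"
      by (subst sum.cartesian_product) (simp only: case_prod_unfold prod.collapse)
    finally show ?thesis by simp
  qed
  show ?thesis
  proof (rule adv_boundI[of X N E' q' U' V'])
    show "X \<subseteq> cube N" by (rule X)
    show "finite E'" using E by (simp add: E'_def)
    show "q' k \<in> {1..N}" if "k \<in> E'" for k using E(2) that by (auto simp: E'_def q'_def)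
  next
    fix x y assume x: "x \<in> X" and y: "y \<in> X"
    have "(\<Sum>k\<in>E'. of_bool (x (q' k) \<noteq> y (q' k)) * (U' x k * V' y k)) =
        (\<Sum>e\<in>E. of_bool (P (g x) \<noteq> P (g y)) * (of_bool (x (q e) \<noteq> y (q e)) * (U x e * V y e)))"
      unfolding sumE' by (rule sum.cong) (auto simp: q'_def U'_def V'_def)
    also have "\<dots> = of_bool (P (g x) \<noteq> P (g y)) * of_bool (g x \<noteq> g y)"
      using 1 x y by (simp flip: sum_distrib_left)
    finally show "(\<Sum>k\<in>E'. of_bool (x (q' k) \<noteq> y (q' k)) * (U' x k * V' y k)) =
        of_bool (of_bool (P (g x)) \<noteq> (of_bool (P (g y)) :: nat))" by auto
  next
    fix x assume x: "x \<in> X"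
    have "(\<Sum>k\<in>E'. (U' x k)\<^sup>2) = (\<Sum>e\<in>E. (U x e)\<^sup>2)" "(\<Sum>k\<in>E'. (V' x k)\<^sup>2) = (\<Sum>e\<in>E. (V x e)\<^sup>2)"
      unfolding sumE' by (auto simp: U'_def V'_def intro!: sum.cong)
    with 2 x show "(\<Sum>k\<in>E'. (U' x k)\<^sup>2) \<le> \<phi> x" "(\<Sum>k\<in>E'. (V' x k)\<^sup>2) \<le> \<phi> x" by auto
  qed
qed

text \<open>Both vectors of an input are scaled by \<open>1 / sqrt w\<close> or
  \<open>sqrt w\<close> according to its value. Constraints with right-hand side 0 survive any
  scaling, and for inputs of different value the two factors cancel.\<close>

lemma adv_bound_weight:
  assumes g: "adv_bound N X (\<lambda>x. of_bool (P x)) \<phi>" and w: "w > 0"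
  shows "adv_bound N X (\<lambda>x. of_bool (P x)) (\<lambda>x. if P x then \<phi> x / w else w * \<phi> x)"
proof -
  from g obtain E q U V where S: "adv_system N X (\<lambda>x. of_bool (P x)) \<phi> E q U V" and X: "X \<subseteq> cube N"
    unfolding adv_bound_def by blast
  note E = adv_systemD(1,2)[OF S] and 1 = adv_systemD(3)[OF S] and 2 = adv_systemD(4,5)[OF S]
  define c where "c x = (if P x then 1 / sqrt w else sqrt w)" for x
  have c2: "(c x)\<^sup>2 = (if P x then 1 / w else w)" for x using w by (simp add: c_def power_divide)
  show ?thesis
  proof (rule adv_boundI[of X N E q "\<lambda>x e. c x * U x e" "\<lambda>x e. c x * V x e"])
    show "X \<subseteq> cube N" "finite E" using X E by auto
    show "q k \<in> {1..N}" if "k \<in> E" for k using E(2) that by auto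
  next
    fix x y assume x: "x \<in> X" and y: "y \<in> X"
    have "(\<Sum>e\<in>E. of_bool (x (q e) \<noteq> y (q e)) * (c x * U x e * (c y * V y e))) =
        (\<Sum>e\<in>E. (c x * c y) * (of_bool (x (q e) \<noteq> y (q e)) * (U x e * V y e)))"
      by (rule sum.cong) auto
    also have "\<dots> = (c x * c y) * of_bool (of_bool (P x) \<noteq> (of_bool (P y) :: nat))"
      unfolding sum_distrib_left[symmetric] using 1 x y by simp
    finally show "(\<Sum>e\<in>E. of_bool (x (q e) \<noteq> y (q e)) * (c x * U x e * (c y * V y e))) =
        of_bool (of_bool (P x) \<noteq> (of_bool (P y) :: nat))"
      using w by (auto simp: c_def)
  next
    fix x assume x: "x \<in> X"
    have "(\<Sum>e\<in>E. (c x * U x e)\<^sup>2) = (c x)\<^sup>2 * (\<Sum>e\<in>E. (U x e)\<^sup>2)"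
      "(\<Sum>e\<in>E. (c x * V x e)\<^sup>2) = (c x)\<^sup>2 * (\<Sum>e\<in>E. (V x e)\<^sup>2)"
      by (simp_all add: power_mult_distrib sum_distrib_left)
    moreover have "(c x)\<^sup>2 * (\<Sum>e\<in>E. (U x e)\<^sup>2) \<le> (c x)\<^sup>2 * \<phi> x" "(c x)\<^sup>2 * (\<Sum>e\<in>E. (V x e)\<^sup>2) \<le> (c x)\<^sup>2 * \<phi> x"
      using 2 x by (auto intro!: mult_left_mono)
    ultimately show "(\<Sum>e\<in>E. (c x * U x e)\<^sup>2) \<le> (if P x then \<phi> x / w else w * \<phi> x)"
      "(\<Sum>e\<in>E. (c x * V x e)\<^sup>2) \<le> (if P x then \<phi> x / w else w * \<phi> x)"
      by (auto simp: c2)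
  qed
qed

section \<open>Decision trees as composable subroutines\<close>

definition dt_bound ::
  "nat \<Rightarrow> (nat \<Rightarrow> bool) set \<Rightarrow> ((nat \<Rightarrow> bool) \<Rightarrow> bool) \<Rightarrow> ((nat \<Rightarrow> bool) \<Rightarrow> real) \<Rightarrow> bool" where
  "dt_bound N X h \<phi> \<longleftrightarrow>
     (\<exists>t. dt_queries t \<subseteq> {1..N} \<and> (\<forall>x\<in>X. dt_eval t x = h x \<and> real (dt_cost t x) \<le> \<phi> x))"

text \<open>
  The leaves of a \<^typ>\<open>dtree\<close> are Boolean, so a subroutine with answers in \<^typ>\<open>nat\<close> is described
  by what it costs to put it in front of arbitrary continuations.
\<close>

definition dt_step ::
  "nat \<Rightarrow> (nat \<Rightarrow> bool) set \<Rightarrow> ((nat \<Rightarrow> bool) \<Rightarrow> nat) \<Rightarrow> ((nat \<Rightarrow> bool) \<Rightarrow> real) \<Rightarrow> bool" where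
  "dt_step N X g \<phi> \<longleftrightarrow> (\<forall>Y\<subseteq>X. \<forall>h \<psi>. (\<forall>a. dt_bound N {x\<in>Y. g x = a} h \<psi>) \<longrightarrow> dt_bound N Y h (\<lambda>x. \<phi> x + \<psi> x))"

lemma dt_bound_mono:
  assumes "dt_bound N X h \<phi>" "Y \<subseteq> X" "\<And>x. x \<in> Y \<Longrightarrow> \<phi> x \<le> \<psi> x"
  shows "dt_bound N Y h \<psi>"
  using assms unfolding dt_bound_def by (meson order_trans subsetD)

lemma dt_bound_const: "(\<And>x. x \<in> X \<Longrightarrow> h x = b) \<Longrightarrow> (\<And>x. x \<in> X \<Longrightarrow> \<phi> x \<ge> 0) \<Longrightarrow> dt_bound N X h \<phi>"
  unfolding dt_bound_def by (rule exI[of _ "Answer b"]) simp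

lemma dt_bound_of_step:
  assumes "dt_step N X (\<lambda>x. of_bool (f x)) \<phi>"
  shows "dt_bound N X f \<phi>"
proof -
  have "dt_bound N {x\<in>X. of_bool (f x) = a} f (\<lambda>_. 0)" for a :: nat
    by (rule dt_bound_const[of _ _ "a \<noteq> 0"]) auto
  then have "dt_bound N X f (\<lambda>x. \<phi> x + 0)" using assms unfolding dt_step_def by blast
  then show ?thesis by simp
qed

lemma dt_step_mono:
  assumes g: "dt_step N X g \<phi>" and YX: "Y \<subseteq> X" and le: "\<And>x. x \<in> Y \<Longrightarrow> \<phi> x \<le> \<psi> x"
    and ker: "\<And>x y. x \<in> Y \<Longrightarrow> y \<in> Y \<Longrightarrow> g' x = g' y \<longleftrightarrow> g x = g y"
  shows "dt_step N Y g' \<psi>"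
  unfolding dt_step_def
proof (intro allI impI)
  fix Z h \<xi> assume Z: "Z \<subseteq> Y" and H: "\<forall>a. dt_bound N {x\<in>Z. g' x = a} h \<xi>"
  have "dt_bound N {x\<in>Z. g x = a} h \<xi>" for a
  proof (cases "\<exists>x0\<in>Z. g x0 = a")
    case True
    then obtain x0 where x0: "x0 \<in> Z" "g x0 = a" by (elim bexE)
    have "g' x = g' x0 \<longleftrightarrow> g x = a" if "x \<in> Z" for x
      using ker[of x x0] Z that x0 by (simp add: subsetD)
    then have "{x\<in>Z. g x = a} = {x\<in>Z. g' x = g' x0}" by (intro Collect_cong) (simp cong: conj_cong)
    with H show ?thesis by simp
  next
    case False
    then show ?thesis by (intro dt_bound_const) auto
  qed
  then have "dt_bound N Z h (\<lambda>x. \<phi> x + \<xi> x)"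
    using g Z YX unfolding dt_step_def by (meson subset_trans)
  then show "dt_bound N Z h (\<lambda>x. \<psi> x + \<xi> x)"
    by (rule dt_bound_mono) (use le Z in auto)
qed

lemma dt_step_const: "dt_step N X (\<lambda>_. a) (\<lambda>_. 0)"
  unfolding dt_step_def by (auto dest: spec[of _ a])

lemma dt_step_bit:
  assumes "i \<in> {1..N}"
  shows "dt_step N X (\<lambda>x. of_bool (x i)) (\<lambda>_. 1)"
  unfolding dt_step_def
proof (intro allI impI)
  fix Y h \<psi> assume H: "\<forall>a. dt_bound N {x\<in>Y. of_bool (x i) = (a :: nat)} h \<psi>"
  obtain t1 where t1: "dt_queries t1 \<subseteq> {1..N}"
    "\<And>x. x \<in> Y \<Longrightarrow> x i \<Longrightarrow> dt_eval t1 x = h x \<and> real (dt_cost t1 x) \<le> \<psi> x"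
    using H[THEN spec, of 1] by (auto simp: dt_bound_def)
  obtain t0 where t0: "dt_queries t0 \<subseteq> {1..N}"
    "\<And>x. x \<in> Y \<Longrightarrow> \<not> x i \<Longrightarrow> dt_eval t0 x = h x \<and> real (dt_cost t0 x) \<le> \<psi> x"
    using H[THEN spec, of 0] by (auto simp: dt_bound_def)
  show "dt_bound N Y h (\<lambda>x. 1 + \<psi> x)"
    unfolding dt_bound_def using assms t0 t1 by (intro exI[of _ "Query i t0 t1"]) auto
qed

lemma dt_step_bind:
  assumes g: "dt_step N X g \<phi>" and h: "\<And>a. dt_step N {x\<in>X. g x = a} (h a) (\<psi> a)"
  shows "dt_step N X (\<lambda>x. prod_encode (g x, h (g x) x)) (\<lambda>x. \<phi> x + \<psi> (g x) x)"
  unfolding dt_step_def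
proof (intro allI impI)
  fix Z f \<xi> assume Z: "Z \<subseteq> X" and H: "\<forall>a. dt_bound N {x\<in>Z. prod_encode (g x, h (g x) x) = a} f \<xi>"
  have "dt_bound N {x\<in>Z. g x = a} f (\<lambda>x. \<psi> (g x) x + \<xi> x)" for a
  proof -
    have "dt_bound N {x\<in>{x\<in>Z. g x = a}. h a x = b} f \<xi>" for b
      by (rule dt_bound_mono[OF H[THEN spec, of "prod_encode (a, b)"]]) auto
    then have "dt_bound N {x\<in>Z. g x = a} f (\<lambda>x. \<psi> a x + \<xi> x)"
      using h[of a] Z unfolding dt_step_def by (auto dest: spec[of _ "{x\<in>Z. g x = a}"])
    then show ?thesis by (rule dt_bound_mono) auto
  qed
  then have "dt_bound N Z f (\<lambda>x. \<phi> x + (\<psi> (g x) x + \<xi> x))"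
    using g Z unfolding dt_step_def by blast
  then show "dt_bound N Z f (\<lambda>x. \<phi> x + \<psi> (g x) x + \<xi> x)" by (simp add: add.assoc)
qed

lemma dt_step_bool:
  assumes g: "dt_step N X g \<phi>"
  shows "dt_step N X (\<lambda>x. of_bool (P (g x))) \<phi>"
  unfolding dt_step_def
proof (intro allI impI)
  fix Z f \<xi> assume Z: "Z \<subseteq> X" and H: "\<forall>a. dt_bound N {x\<in>Z. of_bool (P (g x)) = (a :: nat)} f \<xi>"
  have "dt_bound N {x\<in>Z. g x = a} f \<xi>" for a
    by (rule dt_bound_mono[OF H[THEN spec, of "of_bool (P a)"]]) auto
  then show "dt_bound N Z f (\<lambda>x. \<phi> x + \<xi> x)" using g Z unfolding dt_step_def by blast
qed

text \<open>
  Classical and quantum query algorithms obey the same composition rules.  Classically only the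
  weight \<open>1\<close> is available; in the quantum case a Boolean subroutine may be made cheap for one answer
  at the expense of the other, which is how the square-root speed-up of search arises.
\<close>

locale query_model =
  fixes N :: nat and C :: "(nat \<Rightarrow> bool) set \<Rightarrow> ((nat \<Rightarrow> bool) \<Rightarrow> nat) \<Rightarrow> ((nat \<Rightarrow> bool) \<Rightarrow> real) \<Rightarrow> bool"
    and weights :: "real set"
  assumes mono: "\<And>X g \<phi> Y g' \<psi>. C X g \<phi> \<Longrightarrow> Y \<subseteq> X \<Longrightarrow> (\<And>x. x \<in> Y \<Longrightarrow> \<phi> x \<le> \<psi> x) \<Longrightarrow>
      (\<And>x y. x \<in> Y \<Longrightarrow> y \<in> Y \<Longrightarrow> g' x = g' y \<longleftrightarrow> g x = g y) \<Longrightarrow> C Y g' \<psi>"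
    and const: "\<And>X a. X \<subseteq> cube N \<Longrightarrow> C X (\<lambda>_. a) (\<lambda>_. 0)"
    and bit: "\<And>X i. X \<subseteq> cube N \<Longrightarrow> i \<in> {1..N} \<Longrightarrow> C X (\<lambda>x. of_bool (x i)) (\<lambda>_. 1)"
    and bind: "\<And>X g \<phi> h \<psi>. C X g \<phi> \<Longrightarrow> (\<And>a. C {x\<in>X. g x = a} (h a) (\<psi> a)) \<Longrightarrow>
      C X (\<lambda>x. prod_encode (g x, h (g x) x)) (\<lambda>x. \<phi> x + \<psi> (g x) x)"
    and bool: "\<And>X g \<phi> P. C X g \<phi> \<Longrightarrow> C X (\<lambda>x. of_bool (P (g x))) \<phi>"
    and weight: "\<And>X P \<phi> w. w \<in> weights \<Longrightarrow> C X (\<lambda>x. of_bool (P x)) \<phi> \<Longrightarrow>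
      C X (\<lambda>x. of_bool (P x)) (\<lambda>x. if P x then \<phi> x / w else w * \<phi> x)"
    and weights_pos: "\<And>w. w \<in> weights \<Longrightarrow> w > 0"

interpretation classical: query_model N "dt_step N" "{1}" for N
proof (unfold_locales, goal_cases)
  case 1
  then show ?case by (rule dt_step_mono)
next
  case 2
  show ?case by (rule dt_step_const)
next
  case 3
  show ?case by (rule dt_step_bit) (rule 3(2))
next
  case 4
  then show ?case by (rule dt_step_bind)
next
  case 5
  then show ?case by (rule dt_step_bool)
next
  case (6 X P \<phi> w)
  then have "(\<lambda>x. if P x then \<phi> x / w else w * \<phi> x) = \<phi>" by auto
  with 6(2) show ?case by simp
next
  case 7
  then show ?case by simp
qed

interpretation quantum: query_model N "adv_bound N" "{0<..}" for N
proof (unfold_locales, goal_cases)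
  case 1
  then show ?case by (rule adv_bound_mono)
next
  case 2
  then show ?case by (rule adv_bound_const)
next
  case 3
  then show ?case by (rule adv_bound_bit)
next
  case 4
  then show ?case by (rule adv_bound_bind)
next
  case 5
  then show ?case by (rule adv_bound_bool)
next
  case 6
  show ?case by (rule adv_bound_weight[OF 6(2)]) (use 6(1) in simp)
next
  case 7
  then show ?case by simp
qed

section \<open>Sequential search in an abstract query model\<close>

text \<open>The value \<open>n\<close> signals failure. The last index is treated in the recursive
  step because \<open>search\<close> appends one test at a time.\<close>

primrec first_index :: "nat \<Rightarrow> (nat \<Rightarrow> bool) \<Rightarrow> nat" where
  "first_index 0 P = 0"
| "first_index (Suc n) P =
     (if first_index n P < n then first_index n P else if P n then n else Suc n)"

lemma first_index_le: "first_index n P \<le> n"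
  by (induction n) auto

lemma first_index_sat: "first_index n P < n \<Longrightarrow> P (first_index n P)"
  by (induction n) (auto split: if_splits)

lemma first_index_min: "u < first_index n P \<Longrightarrow> \<not> P u"
proof (induction n)
  case (Suc n)
  then show ?case using first_index_le[of n P] by (auto split: if_splits simp: less_Suc_eq)
qed simp

lemma first_index_less_iff: "first_index n P < n \<longleftrightarrow> (\<exists>u<n. P u)"
  by (metis first_index_le first_index_min first_index_sat le_neq_implies_less)

context query_model begin

lemma cost_mono: "C X g \<phi> \<Longrightarrow> Y \<subseteq> X \<Longrightarrow> (\<And>x. x \<in> Y \<Longrightarrow> \<phi> x \<le> \<psi> x) \<Longrightarrow> C Y g \<psi>"
  by (rule mono) auto

lemma bind_bool:
  assumes "C X g \<phi>" "\<And>a. C {x\<in>X. g x = a} (\<lambda>x. of_bool (P a x)) (\<psi> a)"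
  shows "C X (\<lambda>x. of_bool (P (g x) x)) (\<lambda>x. \<phi> x + \<psi> (g x) x)"
  using bool[OF bind[OF assms], where P = "\<lambda>n. snd (prod_decode n) \<noteq> 0"] by simp

lemma read_bits:
  assumes "X \<subseteq> cube N" "set ps \<subseteq> {1..N}"
  shows "C X (\<lambda>x. list_encode (map (\<lambda>p. of_bool (x p)) ps)) (\<lambda>_. real (length ps))"
  using assms(2)
proof (induction ps)
  case Nil
  then show ?case using const[OF assms(1)] by simp
next
  case (Cons p ps)
  have "C X (\<lambda>x. prod_encode (of_bool (x p), list_encode (map (\<lambda>p. of_bool (x p)) ps)))
      (\<lambda>x. 1 + real (length ps))"
    by (rule bind[OF bit[OF assms(1)]]) (use Cons in \<open>auto intro: cost_mono\<close>)
  then show ?case by (rule mono) auto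
qed

lemma read_bind:
  assumes X: "X \<subseteq> cube N" and ps: "set ps \<subseteq> {1..N}"
    and P: "\<And>bs. C {x\<in>X. map x ps = bs} (\<lambda>x. of_bool (P bs x)) (\<psi> bs)"
  shows "C X (\<lambda>x. of_bool (P (map x ps) x)) (\<lambda>x. real (length ps) + \<psi> (map x ps) x)"
proof -
  define d where "d n = map (\<lambda>k. k = (1 :: nat)) (list_decode n)" for n
  define g where "g = (\<lambda>x :: nat \<Rightarrow> bool. list_encode (map (\<lambda>p. of_bool (x p)) ps))"
  have d: "d (g x) = map x ps" for x by (simp add: d_def g_def)
  have "C X (\<lambda>x. of_bool (P (d (g x)) x)) (\<lambda>x. real (length ps) + \<psi> (d (g x)) x)"
  proof (rule bind_bool)
    show "C X g (\<lambda>_. real (length ps))" unfolding g_def by (rule read_bits[OF X ps])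
    show "C {x\<in>X. g x = a} (\<lambda>x. of_bool (P (d a) x)) (\<psi> (d a))" for a
      by (rule cost_mono[OF P[of "d a"]]) (auto simp flip: d)
  qed
  then show ?thesis by (simp add: d)
qed

lemma read_bool:
  assumes "X \<subseteq> cube N" "set ps \<subseteq> {1..N}"
  shows "C X (\<lambda>x. of_bool (P (map x ps))) (\<lambda>_. real (length ps))"
proof -
  have "C X (\<lambda>x. of_bool (P (map x ps))) (\<lambda>x. real (length ps) + 0)"
  proof (rule read_bind[OF assms])
    show "C {x\<in>X. map x ps = bs} (\<lambda>x. of_bool (P bs)) (\<lambda>_. 0)" for bs
      using assms(1) by (intro const) auto
  qed
  then show ?thesis by simp
qed

text \<open>This is plain sequential search built with \<open>bind\<close>: each failed test is
  charged \<open>w\<close> times its cost and the single success \<open>1 / w\<close> times. With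
  \<open>w\<close> about 1 / sqrt n this is already quantum search, with costs that may differ
  between the candidates.\<close>

lemma search:
  assumes w: "w \<in> weights" and X: "X \<subseteq> cube N"
    and g: "\<And>u. u < n \<Longrightarrow> C X (\<lambda>x. of_bool (g u x)) (\<phi> u)"
  shows "C X (\<lambda>x. first_index n (\<lambda>u. g u x))
    (\<lambda>x. w * (\<Sum>u<first_index n (\<lambda>u. g u x). \<phi> u x) +
         (if first_index n (\<lambda>u. g u x) < n then \<phi> (first_index n (\<lambda>u. g u x)) x / w else 0))"
  using g
proof (induction n)
  case 0
  then show ?case using const[OF X] by simp
next
  case (Suc n)
  let ?f = "\<lambda>n x. first_index n (\<lambda>u. g u x)"
  define h where "h a x = (if a < n then 0 else of_bool (g n x) :: nat)" for a x
  define \<psi> where "\<psi> a x = (if a < n then 0 else if g n x then \<phi> n x / w else w * \<phi> n x)" for a x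
  have "C {x\<in>X. ?f n x = a} (h a) (\<psi> a)" for a
  proof (cases "a < n")
    case True
    then have "h a = (\<lambda>_. 0)" "\<psi> a = (\<lambda>_. 0)" by (auto simp: h_def \<psi>_def)
    then show ?thesis using const[of "{x\<in>X. ?f n x = a}" 0] X by auto
  next
    case False
    then have "h a = (\<lambda>x. of_bool (g n x))" "\<psi> a = (\<lambda>x. if g n x then \<phi> n x / w else w * \<phi> n x)"
      by (auto simp: h_def \<psi>_def)
    then show ?thesis using cost_mono[OF weight[OF w Suc.prems[of n]], of "{x\<in>X. ?f n x = a}"] by auto
  qed
  from bind[OF Suc.IH this] Suc.prems
  have "C X (\<lambda>x. prod_encode (?f n x, h (?f n x) x))
      (\<lambda>x. w * (\<Sum>u<?f n x. \<phi> u x) + (if ?f n x < n then \<phi> (?f n x) x / w else 0) + \<psi> (?f n x) x)"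
    by auto
  then show ?case
  proof (rule mono)
    fix x
    show "w * (\<Sum>u<?f n x. \<phi> u x) + (if ?f n x < n then \<phi> (?f n x) x / w else 0) + \<psi> (?f n x) x \<le>
      w * (\<Sum>u<?f (Suc n) x. \<phi> u x) + (if ?f (Suc n) x < Suc n then \<phi> (?f (Suc n) x) x / w else 0)"
      using first_index_le[of n "\<lambda>u. g u x"] by (auto simp: \<psi>_def algebra_simps not_less)
  next
    fix x y
    show "?f (Suc n) x = ?f (Suc n) y \<longleftrightarrow> prod_encode (?f n x, h (?f n x) x) = prod_encode (?f n y, h (?f n y) y)"
      using first_index_le[of n "\<lambda>u. g u x"] first_index_le[of n "\<lambda>u. g u y"]
      by (auto simp: h_def)
  qed auto
qed

lemma search_const:
  assumes w: "w \<in> weights" and X: "X \<subseteq> cube N" and c: "c \<ge> 0"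
    and g: "\<And>u. u < n \<Longrightarrow> C X (\<lambda>x. of_bool (g u x)) (\<lambda>_. c)"
  shows "C X (\<lambda>x. first_index n (\<lambda>u. g u x)) (\<lambda>_. (w * n + 1 / w) * c)"
proof (rule cost_mono[OF search[OF w X g]])
  fix x
  have "w * (first_index n (\<lambda>u. g u x) * c) \<le> w * (n * c)"
    using weights_pos[OF w] c first_index_le[of n "\<lambda>u. g u x"] by (intro mult_left_mono mult_right_mono) auto
  moreover have "0 \<le> c / w" using c weights_pos[OF w] by simp
  moreover have "(w * n + 1 / w) * c = w * (n * c) + c / w" by (simp add: algebra_simps)
  ultimately show "w * (\<Sum>u<first_index n (\<lambda>u. g u x). c) +
      (if first_index n (\<lambda>u. g u x) < n then c / w else 0) \<le> (w * n + 1 / w) * c"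
    unfolding sum_constant card_lessThan by (split if_split) (intro conjI impI; linarith)
qed auto

lemma exists_const:
  fixes n :: nat
  assumes w: "w \<in> weights" and X: "X \<subseteq> cube N" and c: "c \<ge> 0"
    and g: "\<And>u. u < n \<Longrightarrow> C X (\<lambda>x. of_bool (g u x)) (\<lambda>_. c)"
  shows "C X (\<lambda>x. of_bool (\<exists>u<n. g u x)) (\<lambda>_. (w * n + 1 / w) * c)"
  using bool[OF search_const[where n = n and g = g, OF w X c g], where P = "\<lambda>k. k < n"] by (simp add: first_index_less_iff)

lemma negate:
  assumes "C X (\<lambda>x. of_bool (P x)) \<phi>"
  shows "C X (\<lambda>x. of_bool (\<not> P x)) \<phi>"
  using bool[OF assms, where P = "\<lambda>k. k = 0"] by simp

end

section \<open>Exclusive-or arithmetic and translation-invariant decoding\<close>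

lemma xor_self_cancel: "xor (xor a b) b = (a :: nat)" "xor b (xor b a) = (a :: nat)"
  by (metis xor.assoc xor.right_neutral xor_self_eq) (metis xor.assoc xor.left_neutral xor_self_eq)

lemma xor_less_power: "a < 2 ^ m \<Longrightarrow> b < 2 ^ m \<Longrightarrow> xor a b < (2 ^ m :: nat)"
  by (metis take_bit_nat_eq_self_iff take_bit_xor)

lemma xor_div_power: "xor a b div 2 ^ m = xor (a div 2 ^ m) (b div (2 ^ m :: nat))"
  by (metis drop_bit_eq_div drop_bit_xor)

lemma xor_mod_power: "xor a b mod 2 ^ m = xor (a mod 2 ^ m) (b mod (2 ^ m :: nat))"
  by (metis take_bit_eq_mod take_bit_xor)

lemma xor_eq_iff: "xor a b = c \<longleftrightarrow> a = xor c (b :: nat)"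
  by (metis xor_self_cancel(1))

lemma xor_eq_0_iff: "xor a b = 0 \<longleftrightarrow> a = (b :: nat)"
  by (metis xor.left_neutral xor_eq_iff)

lemma xor_less_power_iff: "b < 2 ^ m \<Longrightarrow> xor a b < 2 ^ m \<longleftrightarrow> a < (2 ^ m :: nat)"
  by (metis xor_less_power xor_self_cancel(1))

text \<open>High and low bits do not interact, so a translation acts separately on row and column,
  or on cell and bit position.\<close>

lemma xor_add_mult_power:
  assumes "b < 2 ^ m"
  shows "xor (u * 2 ^ m + b) a = xor u (a div 2 ^ m) * 2 ^ m + xor b (a mod (2 ^ m :: nat))"
proof -
  have "xor (u * 2 ^ m + b) a div 2 ^ m = xor u (a div 2 ^ m)"
    "xor (u * 2 ^ m + b) a mod 2 ^ m = xor b (a mod 2 ^ m)"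
    using assms by (simp_all add: xor_div_power xor_mod_power)
  then show ?thesis by (metis div_mult_mod_eq)
qed

text \<open>The contents are matched injectively with orbits of bit strings under translation. An
  orbit has at most \<open>2 ^ \<kappa>\<close> elements, so the counting hypothesis provides enough
  orbits.\<close>

lemma ex_xor_invariant_surjection:
  assumes \<Gamma>: "finite \<Gamma>" "\<Gamma> \<noteq> {}" and card: "card \<Gamma> * 2 ^ \<kappa> \<le> 2 ^ 2 ^ \<kappa>"
  shows "\<exists>dec :: bool list \<Rightarrow> 'c.
    (\<forall>a y. a < 2 ^ \<kappa> \<longrightarrow> dec (map (\<lambda>k. y (xor k a)) [0..<2 ^ \<kappa>]) = dec (map y [0..<2 ^ \<kappa>])) \<and>
    (\<forall>bs. dec bs \<in> \<Gamma>) \<and> (\<forall>c\<in>\<Gamma>. \<exists>bs. length bs = 2 ^ \<kappa> \<and> dec bs = c)"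
proof -
  define K :: nat where "K = 2 ^ \<kappa>"
  define sh where "sh a bs = map (\<lambda>k. bs ! (xor k a)) [0..<K]" for a and bs :: "bool list"
  define cls where "cls bs = (\<lambda>a. sh a bs) ` {..<K}" for bs
  have lt: "xor k a < K" if "k < K" "a < K" for k a
    using that by (simp add: K_def xor_less_power)
  have sh_sh: "sh a (sh b bs) = sh (xor a b) bs" if "a < K" "b < K" for a b bs
    using lt that by (auto simp: sh_def xor.assoc intro!: nth_equalityI)
  have cls_sh: "cls (sh b bs) = cls bs" if b: "b < K" for b bs
  proof -
    have "cls (sh b bs) = (\<lambda>a. sh (xor a b) bs) ` {..<K}"
      unfolding cls_def using sh_sh b by (intro image_cong) auto
    also have "\<dots> = (\<lambda>a. sh a bs) ` (\<lambda>a. xor a b) ` {..<K}" by (simp add: image_image)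
    also have "(\<lambda>a. xor a b) ` {..<K} = {..<K}"
    proof (intro equalityI subsetI)
      fix a assume "a \<in> {..<K}"
      then show "a \<in> (\<lambda>a. xor a b) ` {..<K}"
        using lt[of a b] b by (intro image_eqI[of _ _ "xor a b"]) (auto simp: xor_self_cancel)
    qed (use lt b in auto)
    finally show ?thesis by (simp add: cls_def)
  qed
  define A where "A = {bs :: bool list. length bs = K}"
  have A: "finite A" "card A = 2 ^ K"
    using finite_lists_length_eq[of "UNIV :: bool set" K] card_lists_length_eq[of "UNIV :: bool set" K]
    by (simp_all add: A_def)
  have "A \<subseteq> \<Union> (cls ` A)"
  proof
    fix bs assume "bs \<in> A"
    then have "sh 0 bs = bs" by (auto simp: sh_def A_def intro!: nth_equalityI)
    moreover have "0 < K" by (simp add: K_def)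
    ultimately show "bs \<in> \<Union> (cls ` A)" using \<open>bs \<in> A\<close> by (force simp: cls_def)
  qed
  moreover have fin_cls: "finite (cls bs)" "card (cls bs) \<le> K" for bs
    unfolding cls_def using card_image_le[of "{..<K}" "\<lambda>a. sh a bs"] by auto
  ultimately have "card A \<le> card (\<Union> (cls ` A))" using A by (intro card_mono) auto
  also have "\<dots> \<le> (\<Sum>B\<in>cls ` A. card B)" using A fin_cls by (intro card_Union_le_sum_card) 
  also have "\<dots> \<le> (\<Sum>B\<in>cls ` A. K)" using fin_cls by (intro sum_mono) auto
  finally have "card \<Gamma> * K \<le> card (cls ` A) * K"
    using card A(2) unfolding K_def sum_constant by (metis of_nat_id order_trans)
  then have "card \<Gamma> \<le> card (cls ` A)" by (simp add: K_def)
  then obtain j where j: "inj_on j \<Gamma>" "j ` \<Gamma> \<subseteq> cls ` A"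
    using \<Gamma> A card_le_inj[of \<Gamma> "cls ` A"] by auto
  obtain c0 where c0: "c0 \<in> \<Gamma>" using \<Gamma> by auto
  \<comment> \<open>Orbits that belong to no content are read as \<open>c0\<close>, so that every
    bit string is a legal cell.\<close>
  define dec where "dec bs = (if cls bs \<in> j ` \<Gamma> then inv_into \<Gamma> j (cls bs) else c0)" for bs
  have "dec (map (\<lambda>k. y (xor k a)) [0..<K]) = dec (map y [0..<K])" if "a < K" for a y
  proof -
    have "map (\<lambda>k. y (xor k a)) [0..<K] = sh a (map y [0..<K])"
      using lt that by (auto simp: sh_def intro!: nth_equalityI)
    then show ?thesis by (simp add: dec_def cls_sh[OF that])
  qed
  moreover have "dec bs \<in> \<Gamma>" for bs using c0 by (auto simp: dec_def intro: inv_into_into)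
  moreover have "\<exists>bs. length bs = K \<and> dec bs = c" if "c \<in> \<Gamma>" for c
  proof -
    from j that obtain bs where bs: "bs \<in> A" "j c = cls bs" by blast
    then have "dec bs = c" using j(1) that by (auto simp: dec_def simp flip: bs(2))
    with bs show ?thesis by (auto simp: A_def)
  qed
  ultimately show ?thesis unfolding K_def by blast
qed

section \<open>The pointer function\<close>

text \<open>
  A cell contains a type (\<open>0\<close>: zero, \<open>2\<close>: root, anything else: plain one), a back pointer (the offset
  of a column) and the pointers to two children (offsets of cells).  Cell \<open>z\<close> lies in row
  \<open>z div 2 ^ L\<close> and column \<open>z mod 2 ^ L\<close>.  All offsets are taken with respect to bitwise exclusive or,
  so that the group of exclusive-or translations acts on everything.
\<close>

type_synonym content = "nat \<times> nat \<times> nat \<times> nat"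

definition ty :: "content \<Rightarrow> nat" where "ty c = fst c"
definition bk :: "content \<Rightarrow> nat" where "bk c = fst (snd c)"
definition child :: "bool \<Rightarrow> content \<Rightarrow> nat" where
  "child b c = (if b then snd (snd (snd c)) else fst (snd (snd c)))"

text \<open>The bits of \<open>d\<close> are consumed from the most significant one down:
  \<open>d\<close> is the address of a leaf in a complete binary tree of depth
  \<open>t\<close>.\<close>

primrec walk :: "(nat \<Rightarrow> content) \<Rightarrow> nat \<Rightarrow> nat \<Rightarrow> nat \<Rightarrow> nat" where
  "walk \<gamma> 0 d z = z"
| "walk \<gamma> (Suc t) d z = walk \<gamma> t d (xor z (child (bit d t) (\<gamma> z)))"

text \<open>The same number \<open>d\<close> is the address of the leaf, the offset of its column
  from \<open>b\<close> and, exclusive-or being an involution, the back pointer that returns to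
  \<open>b\<close>.\<close>

definition leaf_ok :: "nat \<Rightarrow> (nat \<Rightarrow> content) \<Rightarrow> nat \<Rightarrow> nat \<Rightarrow> nat \<Rightarrow> bool" where
  "leaf_ok L \<gamma> b d z \<longleftrightarrow> ty (\<gamma> z) = 0 \<and> z mod 2 ^ L = xor b d \<and> bk (\<gamma> z) = d"

text \<open>Uniqueness of the root leaves a single tree to follow once the root is found. The
  address 0 is left out since it would ask for a zero in column \<open>b\<close> itself.\<close>

definition cert :: "nat \<Rightarrow> (nat \<Rightarrow> content) \<Rightarrow> nat \<Rightarrow> bool" where
  "cert L \<gamma> b \<longleftrightarrow> (\<forall>u<2 ^ L. ty (\<gamma> (u * 2 ^ L + b)) \<noteq> 0) \<and>
     (\<exists>u<2 ^ L. (\<forall>u'<2 ^ L. ty (\<gamma> (u' * 2 ^ L + b)) = 2 \<longleftrightarrow> u' = u) \<and>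
        (\<forall>d\<in>{1..<2 ^ L}. leaf_ok L \<gamma> b d (walk \<gamma> L d (u * 2 ^ L + b))))"

definition pointer_value :: "nat \<Rightarrow> (nat \<Rightarrow> content) \<Rightarrow> bool" where
  "pointer_value L \<gamma> \<longleftrightarrow> (\<exists>b<2 ^ L. cert L \<gamma> b)"

definition contents :: "nat \<Rightarrow> content set" where
  "contents L = {..<2 ^ L} \<times> {..<2 ^ L} \<times> {..<2 ^ (2 * L)} \<times> {..<2 ^ (2 * L)}"

lemma card_contents: "card (contents L) = 2 ^ (6 * L)"
  by (simp add: contents_def card_cartesian_product flip: power_add)

lemma walk_shift: "walk (\<lambda>z. \<gamma> (xor z a)) t d z = xor (walk \<gamma> t d (xor z a)) a"
proof (induction t arbitrary: z)
  case 0
  then show ?case by (simp add: xor_self_cancel)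
next
  case (Suc t)
  have "xor (xor z c) a = xor (xor z a) c" for c by (metis xor.assoc xor.commute)
  then show ?case using Suc by simp
qed

lemma leaf_ok_shift: "leaf_ok L (\<lambda>z. \<gamma> (xor z a)) b d z \<longleftrightarrow> leaf_ok L \<gamma> (xor b (a mod 2 ^ L)) d (xor z a)"
proof -
  have "xor (xor b c) d = xor (xor b d) c" for c by (metis xor.assoc xor.commute)
  then have "xor (z mod 2 ^ L) (a mod 2 ^ L) = xor (xor b (a mod 2 ^ L)) d \<longleftrightarrow> z mod 2 ^ L = xor b d"
    by (metis xor_self_cancel(1))
  then show ?thesis unfolding leaf_ok_def xor_mod_power by blast
qed

lemma cert_shift_imp:
  assumes "cert L (\<lambda>z. \<gamma> (xor z a)) b" and b: "b < 2 ^ L" and a: "a < 2 ^ (2 * L)"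
  shows "cert L \<gamma> (xor b (a mod 2 ^ L))"
proof -
  define r where "r = a div 2 ^ L"
  have r: "r < 2 ^ L" using a by (simp add: r_def less_mult_imp_div_less mult_2 power_add)
  have cell: "xor (u * 2 ^ L + b) a = xor u r * 2 ^ L + xor b (a mod 2 ^ L)" for u
    unfolding r_def by (rule xor_add_mult_power[OF b])
  have cell': "u * 2 ^ L + xor b (a mod 2 ^ L) = xor (xor u r * 2 ^ L + b) a" for u
    by (simp add: cell xor_self_cancel)
  have ur: "xor u r < 2 ^ L" if "u < 2 ^ L" for u using xor_less_power[OF that r] .
  from assms(1) obtain u where u: "u < 2 ^ L"
    and 1: "\<And>u. u < 2 ^ L \<Longrightarrow> ty (\<gamma> (xor (u * 2 ^ L + b) a)) \<noteq> 0"
    and 2: "\<And>u'. u' < 2 ^ L \<Longrightarrow> ty (\<gamma> (xor (u' * 2 ^ L + b) a)) = 2 \<longleftrightarrow> u' = u"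
    and 3: "\<And>d. d \<in> {1..<2 ^ L} \<Longrightarrow>
      leaf_ok L (\<lambda>z. \<gamma> (xor z a)) b d (walk (\<lambda>z. \<gamma> (xor z a)) L d (u * 2 ^ L + b))"
    unfolding cert_def by blast
  show ?thesis
    unfolding cert_def
  proof (intro conjI allI impI exI[of _ "xor u r"] ballI)
    show "ty (\<gamma> (v * 2 ^ L + xor b (a mod 2 ^ L))) \<noteq> 0" if "v < 2 ^ L" for v
      using 1[OF ur[OF that]] unfolding cell' .
    show "ty (\<gamma> (v * 2 ^ L + xor b (a mod 2 ^ L))) = 2 \<longleftrightarrow> v = xor u r" if "v < 2 ^ L" for v
      using 2[OF ur[OF that]] unfolding cell' by (simp add: xor_eq_iff)
    show "leaf_ok L \<gamma> (xor b (a mod 2 ^ L)) d (walk \<gamma> L d (xor u r * 2 ^ L + xor b (a mod 2 ^ L)))"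
      if "d \<in> {1..<2 ^ L}" for d
      using 3[OF that] by (simp add: leaf_ok_shift walk_shift xor_self_cancel flip: cell)
  qed (rule ur[OF u])
qed

lemma pointer_value_shift:
  assumes a: "a < 2 ^ (2 * L)"
  shows "pointer_value L (\<lambda>z. \<gamma> (xor z a)) \<longleftrightarrow> pointer_value L \<gamma>"
proof -
  have imp: "pointer_value L \<gamma>" if "pointer_value L (\<lambda>z. \<gamma> (xor z a))" for \<gamma>
    using that cert_shift_imp[OF _ _ a] xor_less_power[of _ L "a mod 2 ^ L"]
    unfolding pointer_value_def by (metis mod_less_divisor zero_less_numeral zero_less_power)
  show ?thesis using imp[of \<gamma>] imp[of "\<lambda>z. \<gamma> (xor z a)"] by (auto simp: xor_self_cancel)
qed

lemma cert_leaf: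
  assumes "cert L \<gamma> b" "b < 2 ^ L" "c < 2 ^ L" "c \<noteq> b"
  obtains z where "ty (\<gamma> z) = 0" "z mod 2 ^ L = c" "bk (\<gamma> z) = xor c b"
    "\<exists>u<2 ^ L. z = walk \<gamma> L (xor c b) (u * 2 ^ L + b)"
proof -
  have "xor c b \<noteq> 0" using assms by (simp add: xor_eq_0_iff)
  moreover have "xor c b < 2 ^ L" by (rule xor_less_power) (use assms in auto)
  ultimately have "xor c b \<in> {1..<2 ^ L}" by auto
  with assms(1) obtain u where "u < 2 ^ L" "leaf_ok L \<gamma> b (xor c b) (walk \<gamma> L (xor c b) (u * 2 ^ L + b))"
    unfolding cert_def by blast
  with that show thesis
    unfolding leaf_ok_def by (metis xor.commute xor_self_cancel(1))
qed

lemma walk_less: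
  assumes "\<And>z. \<gamma> z \<in> contents L" "z < 2 ^ (2 * L)"
  shows "walk \<gamma> t d z < 2 ^ (2 * L)"
  using assms(2)
proof (induction t arbitrary: z)
  case (Suc t)
  have "child c (\<gamma> z) < 2 ^ (2 * L)" for c
    using assms(1)[of z] by (auto simp: contents_def child_def)
  then show ?case using Suc by (simp add: xor_less_power)
qed simp

lemma cell_less: "u < 2 ^ L \<Longrightarrow> c < 2 ^ L \<Longrightarrow> u * 2 ^ L + c < (2 ^ (2 * L) :: nat)"
proof -
  assume "u < 2 ^ L" "c < (2 ^ L :: nat)"
  then have "u * 2 ^ L + c < (u + 1) * 2 ^ L" by simp
  also have "\<dots> \<le> 2 ^ L * 2 ^ L" using \<open>u < 2 ^ L\<close> by (intro mult_right_mono) auto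
  finally show ?thesis by (simp add: mult_2 power_add)
qed

text \<open>A true certificate leaves in every other column a zero that names its column.
  Completeness of the search and uniqueness of the certificate both rest on this.\<close>

lemma cert_zero_in_column:
  assumes \<gamma>: "\<And>z. \<gamma> z \<in> contents L" and "cert L \<gamma> b" "b < 2 ^ L" "c < 2 ^ L" "c \<noteq> b"
  obtains u where "u < 2 ^ L" "ty (\<gamma> (u * 2 ^ L + c)) = 0" "xor c (bk (\<gamma> (u * 2 ^ L + c))) = b"
proof -
  obtain z u where z: "ty (\<gamma> z) = 0" "z mod 2 ^ L = c" "bk (\<gamma> z) = xor c b"
    and u: "u < 2 ^ L" "z = walk \<gamma> L (xor c b) (u * 2 ^ L + b)"
    using cert_leaf[OF assms(2-5)] by metis
  have "z < 2 ^ (2 * L)" unfolding u(2) by (intro walk_less \<gamma> cell_less u assms)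
  then have "z div 2 ^ L < 2 ^ L" by (simp add: less_mult_imp_div_less mult_2 power_add)
  moreover have "z = z div 2 ^ L * 2 ^ L + c" using z(2) by (metis div_mult_mod_eq)
  ultimately show thesis using z by (intro that[of "z div 2 ^ L"]) (auto simp: xor_self_cancel)
qed

lemma cert_unique:
  assumes "\<And>z. \<gamma> z \<in> contents L" "cert L \<gamma> b" "cert L \<gamma> c" "b < 2 ^ L" "c < 2 ^ L"
  shows "b = c"
proof (rule ccontr)
  assume "b \<noteq> c"
  then obtain u where "u < 2 ^ L" "ty (\<gamma> (u * 2 ^ L + c)) = 0"
    using cert_zero_in_column[OF assms(1,2,4,5)] by metis
  with assms(3) show False by (auto simp: cert_def)
qed

section \<open>The Boolean function on bits and its symmetry group\<close>

locale pointer_function =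
  fixes L \<kappa> :: nat and dec :: "bool list \<Rightarrow> content"
  assumes L_ge: "L \<ge> 2"
    and dec_shift: "\<And>a y. a < 2 ^ \<kappa> \<Longrightarrow> dec (map (\<lambda>k. y (xor k a)) [0..<2 ^ \<kappa>]) = dec (map y [0..<2 ^ \<kappa>])"
    and dec_range: "\<And>bs. dec bs \<in> contents L"
    and dec_surj: "\<And>c. c \<in> contents L \<Longrightarrow> \<exists>bs. length bs = 2 ^ \<kappa> \<and> dec bs = c"
begin

definition K :: nat where "K = 2 ^ \<kappa>"
definition N :: nat where "N = 2 ^ (2 * L) * K"

definition block :: "nat \<Rightarrow> nat list" where "block z = map (\<lambda>k. z * K + k + 1) [0..<K]"
definition cont :: "(nat \<Rightarrow> bool) \<Rightarrow> nat \<Rightarrow> content" where "cont x z = dec (map x (block z))"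
definition f :: "(nat \<Rightarrow> bool) \<Rightarrow> bool" where "f x \<longleftrightarrow> pointer_value L (cont x)"

definition trans :: "nat \<Rightarrow> nat \<Rightarrow> nat" where
  "trans a p = (if p \<in> {1..N} then xor (p - 1) a + 1 else p)"

lemma N_power: "N = 2 ^ (2 * L + \<kappa>)" by (simp add: N_def K_def power_add)

lemma cont_range: "cont x z \<in> contents L" by (simp add: cont_def dec_range)

lemma block_subset: "z < 2 ^ (2 * L) \<Longrightarrow> set (block z) \<subseteq> {1..N}"
proof
  fix p assume z: "z < 2 ^ (2 * L)" and "p \<in> set (block z)"
  then obtain k where "p = z * K + k + 1" "k < K" by (auto simp: block_def)
  moreover have "z * K + k < (z + 1) * K" using \<open>k < K\<close> by simp
  moreover have "(z + 1) * K \<le> N" unfolding N_def using z by (intro mult_right_mono) auto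
  ultimately show "p \<in> {1..N}" by auto
qed

lemma length_block: "length (block z) = K" by (simp add: block_def)

lemma xor_less_N: "p \<in> {1..N} \<Longrightarrow> a < N \<Longrightarrow> xor (p - 1) a < N"
  unfolding N_power by (rule xor_less_power) auto

lemma trans_trans: "a < N \<Longrightarrow> trans a (trans a p) = p"
  using xor_less_N[of p a] by (auto simp: trans_def xor_self_cancel)

lemma trans_permutes: "a < N \<Longrightarrow> trans a permutes {1..N}"
proof (rule bij_imp_permutes)
  assume a: "a < N"
  have "trans a ` {1..N} \<subseteq> {1..N}"
    using xor_less_N[OF _ a] by (auto simp: trans_def Suc_le_eq)
  then show "bij_betw (trans a) {1..N} {1..N}"
    by (intro bij_betw_byWitness[where f' = "trans a"]) (use a trans_trans in auto)
qed (auto simp: trans_def)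

text \<open>The low \<open>\<kappa>\<close> bits of \<open>a\<close> only permute positions inside a
  block, which \<open>dec\<close> cannot see; the remaining bits translate the cells.\<close>

lemma cont_trans:
  assumes x: "x \<in> cube N" and a: "a < N"
  shows "cont (x \<circ> trans a) z = cont x (xor z (a div K))"
proof (cases "z < 2 ^ (2 * L)")
  case True
  have *: "map (x \<circ> trans a) (block z) = map (\<lambda>k. x (xor z (a div K) * K + xor k (a mod K) + 1)) [0..<K]"
  proof -
    have "(x \<circ> trans a) (z * K + k + 1) = x (xor z (a div K) * K + xor k (a mod K) + 1)" if k: "k < K" for k
    proof -
      have "z * K + k + 1 \<in> set (block z)" using k by (auto simp: block_def)
      then have "z * K + k + 1 \<in> {1..N}" using block_subset[OF True] by blast
      moreover have "xor (z * K + k) a = xor z (a div K) * K + xor k (a mod K)"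
        using xor_add_mult_power[of k \<kappa> z a] k by (simp add: K_def)
      ultimately show ?thesis by (simp add: trans_def)
    qed
    then show ?thesis by (simp add: block_def)
  qed
  have "dec (map (\<lambda>k. x (xor z (a div K) * K + xor k (a mod K) + 1)) [0..<K]) =
      dec (map (\<lambda>k. x (xor z (a div K) * K + k + 1)) [0..<K])"
    using dec_shift[of "a mod K" "\<lambda>k. x (xor z (a div K) * K + k + 1)"] by (simp add: K_def)
  then show ?thesis unfolding cont_def * by (simp add: block_def comp_def)
next
  \<comment> \<open>The equation is needed for all numbers \<open>z\<close>. Outside the array every
    input is \<open>undefined\<close>, so all those cells decode alike, and translation keeps them
    outside.\<close>
  case False
  have "a div K < 2 ^ (2 * L)" using a by (simp add: N_def less_mult_imp_div_less)
  with False have False': "\<not> xor z (a div K) < 2 ^ (2 * L)" by (simp add: xor_less_power_iff)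
  have out: "map y (block z) = map (\<lambda>_. undefined) [0..<K]" if "y \<in> cube N" "\<not> z < 2 ^ (2 * L)" for y z
  proof -
    have "N \<le> z * K" unfolding N_def using that(2) by simp
    then have "y (z * K + k + 1) = undefined" for k
      using that(1) by (auto simp: cube_def PiE_def extensional_def)
    then show ?thesis by (simp add: block_def)
  qed
  have "x \<circ> trans a \<in> cube N"
    using x by (auto simp: cube_def PiE_def extensional_def trans_def)
  then show ?thesis using out x False False' by (simp add: cont_def)
qed

lemma f_trans: "x \<in> cube N \<Longrightarrow> a < N \<Longrightarrow> f (x \<circ> trans a) = f x"
proof -
  assume x: "x \<in> cube N" and a: "a < N"
  have "a div K < 2 ^ (2 * L)" using a by (simp add: N_def less_mult_imp_div_less)
  moreover have "cont (x \<circ> trans a) = (\<lambda>z. cont x (xor z (a div K)))"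
    using cont_trans[OF x a] by auto
  ultimately show ?thesis by (simp add: f_def pointer_value_shift)
qed

lemma permuted_in_cube: "x \<in> cube N \<Longrightarrow> \<sigma> permutes {1..N} \<Longrightarrow> x \<circ> \<sigma> \<in> cube N"
  by (auto simp: cube_def PiE_def extensional_def permutes_def)

lemma f_transitive: "transitive_function N f"
proof -
  \<comment> \<open>Taking all symmetries of \<open>f\<close> makes the group axioms immediate; the
    translations only have to supply transitivity.\<close>
  define G where "G = {\<sigma>. \<sigma> permutes {1..N} \<and> (\<forall>x\<in>cube N. f (x \<circ> \<sigma>) = f x)}"
  interpret S: group "sym_group N" by (rule sym_group_is_group)
  have "subgroup G (sym_group N)"
  proof (rule S.subgroupI)
    show "G \<subseteq> carrier (sym_group N)" by (auto simp: G_def sym_group_def)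
    have "id \<in> G" by (simp add: G_def permutes_id)
    then show "G \<noteq> {}" by blast
  next
    fix \<sigma> assume "\<sigma> \<in> G"
    then have \<sigma>: "\<sigma> permutes {1..N}" and inv: "\<And>x. x \<in> cube N \<Longrightarrow> f (x \<circ> \<sigma>) = f x"
      by (auto simp: G_def)
    have "f (x \<circ> inv_into UNIV \<sigma>) = f x" if "x \<in> cube N" for x
      using inv[of "x \<circ> inv_into UNIV \<sigma>"] permuted_in_cube[OF that permutes_inv[OF \<sigma>]] permutes_inv_o(2)[OF \<sigma>]
      by (simp add: comp_assoc)
    then show "inv\<^bsub>sym_group N\<^esub> \<sigma> \<in> G"
      using \<sigma> sym_group_inv_equality[of \<sigma> N] by (simp add: G_def sym_group_def permutes_inv)
  next
    fix \<sigma> \<tau> assume "\<sigma> \<in> G" "\<tau> \<in> G"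
    then show "\<sigma> \<otimes>\<^bsub>sym_group N\<^esub> \<tau> \<in> G"
      using permuted_in_cube by (auto simp: G_def sym_group_def permutes_compose simp flip: comp_assoc)
  qed
  moreover have "\<exists>\<sigma>\<in>G. \<sigma> i = j" if "i \<in> {1..N}" "j \<in> {1..N}" for i j
  proof -
    define a where "a = xor (i - 1) (j - 1)"
    have a: "a < N"
      unfolding a_def N_power by (rule xor_less_power) (use that in \<open>auto simp flip: N_power\<close>)
    then have "trans a \<in> G" 
      unfolding G_def using trans_permutes[OF a] f_trans[OF _ a] by blast
    moreover have "trans a i = j" using that by (simp add: trans_def a_def xor_self_cancel)
    ultimately show ?thesis by blast
  qed
  ultimately have "transitive_perm_group N G" by (simp add: transitive_perm_group_def)
  then show ?thesis unfolding transitive_function_def by (auto simp: G_def)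
qed

end

section \<open>The deterministic lower bound\<close>

lemma walk_cong:
  assumes eq: "\<And>z. z < 2 ^ (2 * L) \<Longrightarrow> \<gamma>' z = \<gamma> z" and \<gamma>: "\<And>z. \<gamma> z \<in> contents L" and "z < 2 ^ (2 * L)"
  shows "walk \<gamma>' t d z = walk \<gamma> t d z"
  using assms(3)
proof (induction t arbitrary: z)
  case (Suc t)
  have "child c (\<gamma> z) < 2 ^ (2 * L)" for c
    using \<gamma>[of z] by (auto simp: contents_def child_def)
  then show ?case using Suc by (simp add: eq xor_less_power)
qed simp

lemma cert_cong:
  assumes eq: "\<And>z. z < 2 ^ (2 * L) \<Longrightarrow> \<gamma>' z = \<gamma> z" and \<gamma>: "\<And>z. \<gamma> z \<in> contents L"
    and b: "b < 2 ^ L" and "cert L \<gamma> b"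
  shows "cert L \<gamma>' b"
proof -
  have cell: "\<gamma>' (u * 2 ^ L + b) = \<gamma> (u * 2 ^ L + b)" if "u < 2 ^ L" for u
    by (rule eq[OF cell_less[OF that b]])
  have leaf: "leaf_ok L \<gamma>' b d (walk \<gamma>' L d (u * 2 ^ L + b)) \<longleftrightarrow> leaf_ok L \<gamma> b d (walk \<gamma> L d (u * 2 ^ L + b))"
    if "u < 2 ^ L" for u d
    using walk_less[of \<gamma> L, OF \<gamma> cell_less[OF that b]]
    by (simp add: walk_cong[OF eq \<gamma> cell_less[OF that b]] leaf_ok_def eq)
  from \<open>cert L \<gamma> b\<close> show ?thesis
    unfolding cert_def by (simp add: cell leaf cong: conj_cong)
qed

context pointer_function begin

definition half :: nat where "half = 2 ^ (L - 1)"

lemma n_half: "2 ^ L = 2 * half" "half \<ge> 2"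
proof -
  have "L = Suc (Suc (L - 2))" using L_ge by simp
  then obtain m where m: "L = Suc (Suc m)" by blast
  then have "L - 1 = Suc m" by simp
  then have h: "half = 2 ^ Suc m" unfolding half_def by (rule arg_cong)
  have "(2 :: nat) ^ L = 2 ^ Suc (Suc m)" using m by (rule arg_cong)
  then show "2 ^ L = 2 * half" "half \<ge> 2" unfolding h by simp_all
qed

abbreviation plain :: content where "plain \<equiv> (1, 0, 0, 0)"

definition revealed :: "(nat \<rightharpoonup> content) \<Rightarrow> nat \<Rightarrow> nat set" where
  "revealed S c = {z\<in>dom S. z mod 2 ^ L = c}"

text \<open>
  The adversary reveals whole cells.  The first half of the cells revealed in a column are plain
  ones; the others are zeros whose back pointers run through the first half of the columns, so that
  a completely revealed column still supports every certificate for a column below \<open>half\<close>.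
\<close>

definition reply :: "(nat \<rightharpoonup> content) \<Rightarrow> nat \<Rightarrow> content" where
  "reply S z = (let m = card (revealed S (z mod 2 ^ L)) in
     if m < half then plain else (0, xor (z mod 2 ^ L) (m - half), 0, 0))"

text \<open>\<open>xor c k\<close> is the offset from column \<open>c\<close> to column
  \<open>k\<close>: the zero number \<open>k\<close> of a column can serve as a leaf of a
  certificate for column \<open>k\<close>.\<close>

definition adv_inv :: "(nat \<rightharpoonup> content) \<Rightarrow> bool" where
  "adv_inv S \<longleftrightarrow> dom S \<subseteq> {..<2 ^ (2 * L)} \<and> ran S \<subseteq> contents L \<and>
     (\<forall>c<2 ^ L. (card (revealed S c) \<le> half \<longrightarrow> (\<forall>z\<in>revealed S c. S z = Some plain)) \<and>
        (\<forall>k. half + k < card (revealed S c) \<longrightarrow> (\<exists>z\<in>revealed S c. S z = Some (0, xor c k, 0, 0))))"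

definition column :: "nat \<Rightarrow> nat set" where
  "column c = {z. z < 2 ^ (2 * L) \<and> z mod 2 ^ L = c}"

lemma finite_column: "finite (column c)"
  by (simp add: column_def)

lemma adv_inv_dom: "adv_inv S \<Longrightarrow> S z = Some c \<Longrightarrow> z < 2 ^ (2 * L)"
  and adv_inv_ran: "adv_inv S \<Longrightarrow> S z = Some c \<Longrightarrow> c \<in> contents L"
  unfolding adv_inv_def by (blast intro: ranI)+

lemma adv_inv_plain:
  "adv_inv S \<Longrightarrow> c < 2 ^ L \<Longrightarrow> card (revealed S c) \<le> half \<Longrightarrow> z \<in> revealed S c \<Longrightarrow> S z = Some plain"
  by (simp add: adv_inv_def)

lemma adv_inv_zero:
  assumes "adv_inv S" "c < 2 ^ L" "half + k < card (revealed S c)"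
  obtains z where "z \<in> revealed S c" "S z = Some (0, xor c k, 0, 0)"
  using assms unfolding adv_inv_def by blast

lemma revealed_subset: "adv_inv S \<Longrightarrow> revealed S c \<subseteq> column c"
  by (auto simp: revealed_def column_def dest: adv_inv_dom)

lemma column_card:
  assumes "c < 2 ^ L"
  shows "card (column c) = 2 ^ L"
proof -
  have "column c = (\<lambda>u. u * 2 ^ L + c) ` {..<2 ^ L}"
  proof (intro equalityI subsetI)
    fix z assume "z \<in> column c"
    then have z: "z < 2 ^ (2 * L)" "z mod 2 ^ L = c" by (auto simp: column_def)
    then have "z div 2 ^ L < 2 ^ L" by (simp add: less_mult_imp_div_less mult_2 power_add)
    moreover have "z = z div 2 ^ L * 2 ^ L + c" using z by (auto simp: div_mult_mod_eq)
    ultimately show "z \<in> (\<lambda>u. u * 2 ^ L + c) ` {..<2 ^ L}" by blast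
  qed (use assms cell_less[of _ L c] in \<open>auto simp: column_def\<close>)
  moreover have "inj_on (\<lambda>u. u * 2 ^ L + c) {..<2 ^ L :: nat}" by (auto simp: inj_on_def)
  ultimately show ?thesis by (simp add: card_image)
qed

lemma finite_dom: "adv_inv S \<Longrightarrow> finite (dom S)"
  unfolding adv_inv_def by (blast intro: finite_subset)

lemma adv_inv_reply:
  assumes S: "adv_inv S" and z: "z < 2 ^ (2 * L)" "z \<notin> dom S"
  shows "adv_inv (S(z \<mapsto> reply S z))"
proof -
  define c where "c = z mod 2 ^ L"
  define S' where "S' = S(z \<mapsto> reply S z)"
  have c: "c < 2 ^ L" by (simp add: c_def)
  have fin: "finite (revealed S c)" using finite_dom[OF S] by (simp add: revealed_def)
  have rev_c: "revealed S' c = insert z (revealed S c)" and z_notin: "z \<notin> revealed S c"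
    using z(2) by (auto simp: revealed_def c_def S'_def)
  have rev_other: "revealed S' c' = revealed S c'" if "c' \<noteq> c" for c'
    using that by (auto simp: revealed_def c_def S'_def)
  have card_c: "card (revealed S' c) = Suc (card (revealed S c))"
    using fin z_notin by (simp add: rev_c)
  have same: "S' z' = S z'" if "z' \<in> dom S" for z' using that z(2) by (auto simp: S'_def)
  have in_dom: "z' \<in> dom S" if "z' \<in> revealed S c'" for z' c' using that by (simp add: revealed_def)
  have new: "S' z = Some (if card (revealed S c) < half then plain else (0, xor c (card (revealed S c) - half), 0, 0))"
    by (simp add: S'_def reply_def Let_def flip: c_def)
  have card_le: "card (revealed S c) < 2 ^ L"
  proof -
    have "insert z (revealed S c) \<subseteq> column c"
      using revealed_subset[OF S] z(1) by (simp add: column_def c_def)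
    then have "card (insert z (revealed S c)) \<le> 2 ^ L"
      using column_card[OF c] card_mono[OF finite_column, of "insert z (revealed S c)" c] by simp
    then show ?thesis using fin z_notin by simp
  qed
  show ?thesis
    unfolding adv_inv_def S'_def[symmetric]
  proof (intro conjI allI impI ballI)
    show "dom S' \<subseteq> {..<2 ^ (2 * L)}" using S z(1) by (auto simp: adv_inv_def S'_def)
    have "xor c (card (revealed S c) - half) < 2 ^ L"
      using card_le by (intro xor_less_power c) auto
    then have "reply S z \<in> contents L"
      using n_half by (auto simp: reply_def Let_def contents_def c_def)
    then show "ran S' \<subseteq> contents L"
      using S z(2) by (auto simp: adv_inv_def S'_def ran_def)
  next
    fix c' z' assume *: "c' < 2 ^ L" "card (revealed S' c') \<le> half" "z' \<in> revealed S' c'"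
    show "S' z' = Some plain"
    proof (cases "z' = z")
      case True
      then have "c' = c" using * by (auto simp: revealed_def c_def)
      then show ?thesis using * card_c new True by simp
    next
      case False
      then have z': "z' \<in> revealed S c'" using * rev_c rev_other by (cases "c' = c") auto
      moreover have "card (revealed S c') \<le> half" using * card_c rev_other by (cases "c' = c") auto
      ultimately have "S z' = Some plain" using S *(1) by (intro adv_inv_plain)
      then show ?thesis using same in_dom[OF z'] by simp
    qed
  next
    fix c' k assume *: "c' < 2 ^ L" "half + k < card (revealed S' c')"
    show "\<exists>z'\<in>revealed S' c'. S' z' = Some (0, xor c' k, 0, 0)"
    proof (cases "half + k < card (revealed S c')")
      case True
      then obtain z' where z': "z' \<in> revealed S c'" "S z' = Some (0, xor c' k, 0, 0)"
        by (rule adv_inv_zero[OF S *(1)])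
      then have "S' z' = Some (0, xor c' k, 0, 0)" using same in_dom by simp
      moreover have "z' \<in> revealed S' c'" using z' rev_c rev_other by (cases "c' = c") auto
      ultimately show ?thesis by blast
    next
      case False
      then have "c' = c" using * rev_other by (cases "c' = c") auto
      with False * card_c have "card (revealed S c) = half + k" by simp
      then have "S' z = Some (0, xor c' k, 0, 0)" using new \<open>c' = c\<close> by simp
      then show ?thesis using \<open>c' = c\<close> rev_c by blast
    qed
  qed
qed

section \<open>Playing the adversary against a decision tree\<close>

definition enc :: "content \<Rightarrow> bool list" where
  "enc c = (SOME bs. length bs = 2 ^ \<kappa> \<and> dec bs = c)"

lemma enc: "c \<in> contents L \<Longrightarrow> length (enc c) = K" "c \<in> contents L \<Longrightarrow> dec (enc c) = c"
  using someI_ex[OF dec_surj] by (auto simp: enc_def K_def)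

text \<open>The tree sees bits, not contents, so a revealed cell is fixed to one particular
  encoding.\<close>

definition consistent :: "(nat \<Rightarrow> bool) \<Rightarrow> (nat \<rightharpoonup> content) \<Rightarrow> bool" where
  "consistent x S \<longleftrightarrow> (\<forall>z c. S z = Some c \<longrightarrow> map x (block z) = enc c)"

text \<open>When a bit is queried, its whole cell is revealed, so a query adds at most one cell. All
  inputs consistent with the final map then follow the same path of the tree.\<close>

lemma adversary:
  assumes "adv_inv S" "dt_queries t \<subseteq> {1..N}"
  shows "\<exists>S' v k. adv_inv S' \<and> S \<subseteq>\<^sub>m S' \<and> card (dom S') \<le> card (dom S) + k \<and>
    (\<forall>x. consistent x S' \<longrightarrow> dt_eval t x = v \<and> dt_cost t x = k)"
  using assms
proof (induction t arbitrary: S)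
  case (Answer b)
  then show ?case by (intro exI[of _ S] exI[of _ b] exI[of _ 0]) simp
next
  case (Query i t0 t1)
  define z where "z = (i - 1) div K"
  define k where "k = (i - 1) mod K"
  have K: "K > 0" by (simp add: K_def)
  have i: "i \<in> {1..N}" using Query.prems by simp
  then have "i - 1 < 2 ^ (2 * L) * K" by (auto simp: N_def)
  then have z: "z < 2 ^ (2 * L)" by (simp add: z_def less_mult_imp_div_less)
  have k: "k < K" using K by (simp add: k_def)
  have "z * K + k = i - 1" by (simp add: z_def k_def)
  then have i_eq: "block z ! k = i" using i k by (simp add: block_def)
  define S1 where "S1 = (if z \<in> dom S then S else S(z \<mapsto> reply S z))"
  have S1: "adv_inv S1" using Query.prems(1) z adv_inv_reply by (simp add: S1_def)
  have le: "S \<subseteq>\<^sub>m S1" by (auto simp: S1_def map_le_def)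
  have card1: "card (dom S1) \<le> Suc (card (dom S))"
    using finite_dom[OF Query.prems(1)] by (auto simp: S1_def card_insert_if)
  obtain c where c: "S1 z = Some c" by (cases "z \<in> dom S") (auto simp: S1_def)
  then have c_in: "c \<in> contents L" using S1 by (auto simp: adv_inv_def ran_def)
  define t where "t = (if enc c ! k then t1 else t0)"
  have "\<exists>S' v k. adv_inv S' \<and> S1 \<subseteq>\<^sub>m S' \<and> card (dom S') \<le> card (dom S1) + k \<and>
    (\<forall>x. consistent x S' \<longrightarrow> dt_eval t x = v \<and> dt_cost t x = k)"
    using Query.IH[OF S1] Query.prems(2) by (auto simp: t_def)
  then obtain S' v j where S': "adv_inv S'" "S1 \<subseteq>\<^sub>m S'" "card (dom S') \<le> card (dom S1) + j"
    and t: "\<And>x. consistent x S' \<Longrightarrow> dt_eval t x = v \<and> dt_cost t x = j" by blast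
  have "dt_eval (Query i t0 t1) x = v \<and> dt_cost (Query i t0 t1) x = Suc j" if "consistent x S'" for x
  proof -
    have "S' z = Some c" using S'(2) c by (metis domI map_le_def)
    then have "map x (block z) = enc c" using that unfolding consistent_def by blast
    then have "x (block z ! k) = enc c ! k" using k by (metis length_block nth_map)
    then show ?thesis using t[OF that] by (simp add: i_eq t_def split: if_splits)
  qed
  then show ?case
    using S' le card1 map_le_trans[OF le S'(2)] by (intro exI[of _ S'] exI[of _ v] exI[of _ "Suc j"]) auto
qed

lemma ex_input:
  assumes "\<And>z. \<gamma> z \<in> contents L"
  shows "\<exists>x\<in>cube N. \<forall>z<2 ^ (2 * L). map x (block z) = enc (\<gamma> z) \<and> cont x z = \<gamma> z"
proof
  define x where "x = (\<lambda>p\<in>{1..N}. enc (\<gamma> ((p - 1) div K)) ! ((p - 1) mod K))"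
  show "x \<in> cube N" by (simp add: x_def cube_def)
  show "\<forall>z<2 ^ (2 * L). map x (block z) = enc (\<gamma> z) \<and> cont x z = \<gamma> z"
  proof (intro allI impI)
    fix z :: nat assume z: "z < 2 ^ (2 * L)"
    have "x (z * K + k + 1) = enc (\<gamma> z) ! k" if k: "k < K" for k
    proof -
      have "z * K + k + 1 \<in> set (block z)" using k by (auto simp: block_def)
      then have "z * K + k + 1 \<in> {1..N}" using block_subset[OF z] by blast
      then show ?thesis using k by (simp add: x_def)
    qed
    then have "map x (block z) = enc (\<gamma> z)"
      by (intro nth_equalityI) (auto simp: enc(1) assms block_def)
    then show "map x (block z) = enc (\<gamma> z) \<and> cont x z = \<gamma> z"
      by (simp add: cont_def enc(2) assms)
  qed
qed

text \<open>Making all unrevealed cells zeros spoils every column that is not completely revealed,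
  and a completely revealed column has been given zeros by the adversary.\<close>

lemma ex_zero_completion:
  assumes S: "adv_inv S"
  shows "\<exists>x\<in>cube N. consistent x S \<and> \<not> f x"
proof -
  define \<gamma> where "\<gamma> z = (case S z of None \<Rightarrow> (0, 0, 0, 0) | Some c \<Rightarrow> c)" for z
  have "\<gamma> z \<in> contents L" for z
    using S by (auto simp: \<gamma>_def adv_inv_def ran_def contents_def split: option.splits)
  then obtain x where x: "x \<in> cube N" "\<And>z. z < 2 ^ (2 * L) \<Longrightarrow> map x (block z) = enc (\<gamma> z)"
    "\<And>z. z < 2 ^ (2 * L) \<Longrightarrow> cont x z = \<gamma> z"
    using ex_input[of \<gamma>] by blast
  have "consistent x S"
    unfolding consistent_def using x(2) adv_inv_dom[OF S] by (simp add: \<gamma>_def)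
  moreover have "\<not> cert L (cont x) b" if b: "b < 2 ^ L" for b
  proof -
    have "\<exists>z<2 ^ (2 * L). z mod 2 ^ L = b \<and> ty (\<gamma> z) = 0"
    proof (cases "card (revealed S b) = 2 ^ L")
      case True
      then have "half + 0 < card (revealed S b)" using n_half by simp
      then obtain z where z: "z \<in> revealed S b" "S z = Some (0, xor b 0, 0, 0)"
        by (rule adv_inv_zero[OF S b])
      then show ?thesis using revealed_subset[OF S, of b]
        by (intro exI[of _ z]) (auto simp: column_def \<gamma>_def ty_def)
    next
      case False
      then have "column b \<noteq> revealed S b"
        using column_card[OF b] by metis
      then obtain z where z: "z \<in> column b" "z \<notin> revealed S b"
        using revealed_subset[OF S, of b] by blast
      then have "S z = None" by (cases "S z") (auto simp: revealed_def column_def)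
      with z(1) show ?thesis by (intro exI[of _ z]) (simp add: column_def \<gamma>_def ty_def)
    qed
    then obtain z where z: "z < 2 ^ (2 * L)" "z mod 2 ^ L = b" "ty (cont x z) = 0" using x(3) by auto
    then have "z div 2 ^ L < 2 ^ L" by (simp add: less_mult_imp_div_less mult_2 power_add)
    moreover have "z = z div 2 ^ L * 2 ^ L + b" using z(2) by (auto simp: div_mult_mod_eq)
    ultimately show ?thesis using z(3) unfolding cert_def by metis
  qed
  ultimately show ?thesis using x(1) by (auto simp: f_def pointer_value_def)
qed

text \<open>Fewer than \<open>half * half\<close> revealed cells leave some column
  \<open>b < half\<close> with fewer than \<open>half\<close> of them, all plain. In every other
  column either a cell is free for a leaf, or all cells are revealed and one of the zeros there
  already points back to \<open>b\<close>. The inner nodes of the tree go into arbitrary free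
  cells.\<close>

lemma ex_one_completion:
  assumes S: "adv_inv S" and card: "card (dom S) < half * half"
  shows "\<exists>x\<in>cube N. consistent x S \<and> f x"
proof -
  have fin: "finite (dom S)" by (rule finite_dom[OF S])
  have h2: "half \<ge> 2" by (rule n_half)
  have "\<exists>b<half. card (revealed S b) < half"
  proof (rule ccontr)
    assume "\<not> ?thesis"
    then have "half \<le> card (revealed S b)" if "b < half" for b using that by (meson not_less)
    then have "(\<Sum>b<half. half) \<le> (\<Sum>b<half. card (revealed S b))"
      by (intro sum_mono) simp
    then have "half * half \<le> (\<Sum>b<half. card (revealed S b))" by simp
    also have "\<dots> = card (\<Union>b<half. revealed S b)"
      using fin by (subst card_UN_disjoint) (auto simp: revealed_def)
    also have "\<dots> \<le> card (dom S)" using fin by (intro card_mono) (auto simp: revealed_def)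
    finally show False using card by simp
  qed
  then obtain b where b: "b < half" "card (revealed S b) < half" by blast
  then have bn: "b < 2 ^ L" by (simp add: n_half)
  note sub = revealed_subset[OF S]
  have free: "\<exists>z<2 ^ (2 * L). z mod 2 ^ L = c \<and> S z = None" if "c < 2 ^ L" "card (revealed S c) \<noteq> 2 ^ L" for c
  proof -
    have "revealed S c \<noteq> column c"
      using that column_card[OF that(1)] by metis
    then show ?thesis
      using sub[of c] by (auto simp: revealed_def column_def domIff)
  qed
  obtain r where r: "r < 2 ^ (2 * L)" "r mod 2 ^ L = b" "S r = None"
    using free[OF bn] b(2) n_half by fastforce
  have leaf_ex: "\<exists>z<2 ^ (2 * L). z mod 2 ^ L = xor b d \<and> (S z = None \<or> S z = Some (0, d, 0, 0))"
    if d: "d < 2 ^ L" for d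
  proof (cases "card (revealed S (xor b d)) = 2 ^ L")
    case True
    have lt: "xor b d < 2 ^ L" by (rule xor_less_power[OF bn d])
    have "half + b < card (revealed S (xor b d))" using True b n_half by simp
    then obtain z where "z \<in> revealed S (xor b d)" "S z = Some (0, xor (xor b d) b, 0, 0)"
      by (rule adv_inv_zero[OF S lt])
    moreover have "xor (xor b d) b = d" by (metis xor.commute xor_self_cancel(1))
    ultimately show ?thesis using sub[of "xor b d"] by (auto simp: column_def)
  next
    case False
    then show ?thesis using free[OF xor_less_power[OF bn d]] by blast
  qed
  define leaf where "leaf d = (SOME z. z < 2 ^ (2 * L) \<and> z mod 2 ^ L = xor b d \<and> (S z = None \<or> S z = Some (0, d, 0, 0)))" for d
  have leaf: "leaf d < 2 ^ (2 * L)" "leaf d mod 2 ^ L = xor b d" "S (leaf d) = None \<or> S (leaf d) = Some (0, d, 0, 0)"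
    if "d < 2 ^ L" for d
    using someI_ex[OF leaf_ex[OF that]] unfolding leaf_def by auto
  define lv where "lv = leaf ` {1..<2 ^ L}"
  have lv_col: "z mod 2 ^ L \<noteq> b" if "z \<in> lv" for z
  proof -
    obtain d where d: "d \<in> {1..<2 ^ L}" "z = leaf d" using \<open>z \<in> lv\<close> unfolding lv_def by blast
    then have "z mod 2 ^ L = xor b d" using leaf(2) by simp
    moreover have "xor b d \<noteq> b" using d(1) by (metis atLeastLessThan_iff not_one_le_zero xor.right_neutral xor_self_cancel(2))
    ultimately show ?thesis by simp
  qed
  define F where "F = {..<2 ^ (2 * L)} - dom S - lv - {r}"
  \<comment> \<open>Of the \<open>4 * half * half\<close> cells, fewer than a quarter are revealed
    and at most \<open>2 * half\<close> are leaves or the root; \<open>2 * half - 2\<close> inner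
    nodes besides the root have to fit into the rest.\<close>
  have "card {2..<(2 :: nat) ^ L} \<le> card F"
  proof -
    have "card lv \<le> 2 ^ L - 1" unfolding lv_def by (rule order_trans[OF card_image_le]) auto
    moreover have "card (dom S \<union> lv \<union> {r}) \<le> card (dom S) + card lv + 1"
      by (rule order_trans[OF card_Un_le] add_mono)+ (auto intro: card_Un_le)
    moreover have "F = {..<2 ^ (2 * L)} - (dom S \<union> lv \<union> {r})" by (auto simp: F_def)
    moreover have "card ({..<2 ^ (2 * L) :: nat} - (dom S \<union> lv \<union> {r})) \<ge> 2 ^ (2 * L) - card (dom S \<union> lv \<union> {r})"
      using diff_card_le_card_Diff[of "dom S \<union> lv \<union> {r}" "{..<2 ^ (2 * L) :: nat}"] fin by (simp add: lv_def)
    ultimately have "card F \<ge> 2 ^ (2 * L) - (half * half + (2 ^ L - 1) + 1)" using card by simp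
    moreover have "2 ^ (2 * L) = 4 * (half * half)"
    proof -
      have "(2 :: nat) ^ (2 * L) = 2 ^ L * 2 ^ L" by (simp add: mult_2 power_add)
      then show ?thesis unfolding n_half(1) by simp
    qed
    moreover have "3 * (half * half) \<ge> 4 * half"
    proof -
      have "2 * half \<le> half * half" using mult_le_mono1[OF h2, of half] .
      then show ?thesis by linarith
    qed
    moreover have "card {2..<(2 :: nat) ^ L} = 2 * half - 2" by (simp add: n_half)
    ultimately show ?thesis unfolding n_half(1) using h2 by linarith
  qed
  then obtain j :: "nat \<Rightarrow> nat" where j: "inj_on j {2..<2 ^ L}" "j ` {2..<2 ^ L} \<subseteq> F"
    using card_le_inj[of "{2..<(2 :: nat) ^ L}" F] by (auto simp: F_def)
  \<comment> \<open>Heap numbering: the root is 1, the children of \<open>h\<close> are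
    \<open>2 * h\<close> and \<open>2 * h + 1\<close>, and leaf \<open>d\<close> is
    \<open>2 ^ L + d\<close>. Leaf 0 lies in column \<open>b\<close> and only serves as the target
    of a pointer, so it may coincide with another node.\<close>
  define node where "node h = (if h = 1 then r else if h < 2 ^ L then j h else leaf (h - 2 ^ L))" for h
  have j_in: "j h \<in> F" "j h \<noteq> r" if "2 \<le> h" "h < 2 ^ L" for h
  proof -
    have "h \<in> {2..<2 ^ L}" using that by simp
    then show "j h \<in> F" using j(2) by blast
    then show "j h \<noteq> r" by (simp add: F_def)
  qed
  have node_eq: "node h = (if h = 1 then r else j h)" if "h < 2 ^ L" for h
    using that by (simp add: node_def)
  have node_in: "node h \<in> {..<2 ^ (2 * L)} - dom S - lv" if "h \<in> {1..<2 ^ L}" for h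
  proof (cases "h = 1")
    case True
    then show ?thesis using r lv_col that by (auto simp: node_eq)
  next
    case False
    then have "j h \<in> F" using that j_in by simp
    then show ?thesis using False that by (auto simp: node_eq F_def)
  qed
  have node_inj: "inj_on node {1..<2 ^ L}"
  proof (rule inj_onI)
    fix h h' assume h: "h \<in> {1..<2 ^ L}" "h' \<in> {1..<2 ^ L}" and eq: "node h = node h'"
    consider "h = 1" | "h' = 1" | "2 \<le> h" "2 \<le> h'" using h by fastforce
    then show "h = h'"
    proof cases
      case 1
      then show ?thesis using eq h j_in(2)[of h'] by (auto simp: node_eq split: if_splits)
    next
      case 2
      then show ?thesis using eq h j_in(2)[of h] by (auto simp: node_eq split: if_splits)
    next
      case 3
      then show ?thesis using eq h inj_onD[OF j(1), of h h'] by (auto simp: node_eq)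
    qed
  qed
  have node_less: "node h < 2 ^ (2 * L)" if "1 \<le> h" "h < 2 * 2 ^ L" for h
  proof (cases "h < 2 ^ L")
    case True
    then show ?thesis using node_in[of h] that by auto
  next
    case False
    then have "node h = leaf (h - 2 ^ L)" "h - 2 ^ L < 2 ^ L"
      using that one_less_power[of "2 :: nat" L] L_ge by (auto simp: node_def)
    then show ?thesis using leaf(1) by simp
  qed
  define idx where "idx z = the_inv_into {1..<2 ^ L} node z" for z
  have idx: "idx (node h) = h" if "h \<in> {1..<2 ^ L}" for h
    unfolding idx_def by (rule the_inv_into_f_f[OF node_inj that])
  define \<gamma> where "\<gamma> z = (case S z of Some c \<Rightarrow> c | None \<Rightarrow>
      if z \<in> lv then (0, xor b (z mod 2 ^ L), 0, 0)
      else if z \<in> node ` {1..<2 ^ L} then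
        (if idx z = 1 then 2 else 1, 0, xor z (node (2 * idx z)), xor z (node (2 * idx z + 1)))
      else plain)" for z
  have n4: "4 \<le> (2 :: nat) ^ L" using n_half by simp
  have \<gamma>_node: "\<gamma> (node h) = (if h = 1 then 2 else 1, 0, xor (node h) (node (2 * h)), xor (node h) (node (2 * h + 1)))"
    if "h \<in> {1..<2 ^ L}" for h
  proof -
    have "S (node h) = None" using node_in[OF that] by (cases "S (node h)") auto
    moreover have "node h \<notin> lv" "node h \<in> node ` {1..<2 ^ L}" using node_in[OF that] that by auto
    ultimately show ?thesis unfolding \<gamma>_def idx[OF that] by simp
  qed
  have \<gamma>_leaf: "\<gamma> (leaf d) = (0, d, 0, 0)" if "d \<in> {1..<2 ^ L}" for d
  proof -
    have "leaf d \<in> lv" using that by (simp add: lv_def)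
    moreover have "xor b (leaf d mod 2 ^ L) = d" using leaf(2) that by (simp add: xor_self_cancel)
    ultimately show ?thesis using leaf(3)[of d] that by (auto simp: \<gamma>_def)
  qed
  have \<gamma>_in: "\<gamma> z \<in> contents L" for z
  proof (cases "S z")
    case (Some c)
    then show ?thesis using adv_inv_ran[OF S Some] by (simp add: \<gamma>_def)
  next
    case None
    consider "z \<in> lv" | h where "h \<in> {1..<2 ^ L}" "z = node h" | "z \<notin> lv" "z \<notin> node ` {1..<2 ^ L}"
      by blast
    then show ?thesis
    proof cases
      case 1
      have "xor b (z mod 2 ^ L) < 2 ^ L" by (intro xor_less_power bn) simp
      then show ?thesis using 1 None by (simp add: \<gamma>_def contents_def)
    next
      case 2
      have "xor z (node (2 * h)) < 2 ^ (2 * L)" "xor z (node (2 * h + 1)) < 2 ^ (2 * L)"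
        using 2 node_less by (auto intro!: xor_less_power)
      then show ?thesis using n4 unfolding 2(2) \<gamma>_node[OF 2(1)] by (simp add: contents_def)
    next
      case 3
      then show ?thesis using n4 None by (simp add: \<gamma>_def contents_def)
    qed
  qed
  \<comment> \<open>Descending \<open>t\<close> levels from \<open>h\<close> appends the last
    \<open>t\<close> bits of \<open>d\<close> to the heap number; the bound on \<open>h\<close>
    keeps the walk at or above the leaf level.\<close>
  have walk_node: "walk \<gamma> t d (node h) = node (h * 2 ^ t + d mod 2 ^ t)"
    if "(h + 1) * 2 ^ t \<le> 2 * 2 ^ L" "h \<ge> 1" for t d h
    using that
  proof (induction t arbitrary: h)
    case (Suc t)
    have "(h + 1) * 2 \<le> (h + 1) * (2 * 2 ^ t)" by (rule mult_le_mono2) simp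
    with Suc.prems have "h < 2 ^ L" by simp
    then have h: "h \<in> {1..<2 ^ L}" using Suc.prems by simp
    define h' where "h' = 2 * h + of_bool (bit d t)"
    have "xor (node h) (child (bit d t) (\<gamma> (node h))) = node h'"
      unfolding \<gamma>_node[OF h] by (simp add: child_def h'_def xor_self_cancel)
    then have "walk \<gamma> (Suc t) d (node h) = walk \<gamma> t d (node h')" by simp
    also have "\<dots> = node (h' * 2 ^ t + d mod 2 ^ t)"
    proof (rule Suc.IH)
      have "(h' + 1) * 2 ^ t \<le> (2 * h + 2) * 2 ^ t" by (intro mult_right_mono) (auto simp: h'_def)
      also have "\<dots> = (h + 1) * 2 ^ Suc t" by simp
      finally show "(h' + 1) * 2 ^ t \<le> 2 * 2 ^ L" using Suc.prems(1) by simp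
      show "h' \<ge> 1" using Suc.prems(2) by (simp add: h'_def)
    qed
    also have "h' * 2 ^ t + d mod 2 ^ t = h * 2 ^ Suc t + d mod 2 ^ Suc t"
    proof -
      have "d mod 2 ^ Suc t = of_bool (bit d t) * 2 ^ t + d mod 2 ^ t"
        using take_bit_Suc_from_most[of t d] by (simp add: take_bit_eq_mod)
      then show ?thesis by (simp add: h'_def algebra_simps)
    qed
    finally show ?case .
  qed simp
  have "cert L \<gamma> b"
    unfolding cert_def
  proof (intro conjI allI impI exI[of _ "r div 2 ^ L"] ballI)
    have r_eq: "r div 2 ^ L * 2 ^ L + b = r" using r(2) div_mult_mod_eq[of r "2 ^ L"] by simp
    have node1: "node 1 = r" by (simp add: node_def)
    have one_in: "1 \<in> {1..<(2 :: nat) ^ L}" using n4 by simp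
    \<comment> \<open>Column \<open>b\<close> must stay free of zeros and contain no second root:
      its revealed cells are plain, leaves lie elsewhere, and of the tree nodes only number 1 gets
      type 2.\<close>
    have col: "ty (\<gamma> z) \<noteq> 0 \<and> (ty (\<gamma> z) = 2 \<longleftrightarrow> z = r)" if z: "z mod 2 ^ L = b" for z
    proof (cases "S z")
      case (Some c)
      then have "z \<in> revealed S b" using z by (auto simp: revealed_def)
      then have "S z = Some plain" using b(2) by (intro adv_inv_plain[OF S bn]) auto
      then show ?thesis using r(3) by (auto simp: \<gamma>_def ty_def)
    next
      case None
      have "z \<notin> lv" using lv_col z by blast
      then have "\<gamma> z = plain" if "z \<notin> node ` {1..<2 ^ L}"
        using None that unfolding \<gamma>_def by simp
      then consider h where "h \<in> {1..<2 ^ L}" "z = node h" | "\<gamma> z = plain" "z \<notin> node ` {1..<2 ^ L}"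
        by blast
      then show ?thesis
      proof cases
        case 1
        have "node h = r \<longleftrightarrow> h = 1" using node1 inj_onD[OF node_inj _ 1(1) one_in] by auto
        then show ?thesis unfolding 1(2) \<gamma>_node[OF 1(1)] by (simp add: ty_def)
      next
        case 2
        then have "z \<noteq> r" using node1 one_in by blast
        with 2 show ?thesis by (simp add: ty_def)
      qed
    qed
    show "r div 2 ^ L < 2 ^ L" using r(1) by (simp add: less_mult_imp_div_less mult_2 power_add)
    show "ty (\<gamma> (u * 2 ^ L + b)) \<noteq> 0" for u using col[of "u * 2 ^ L + b"] bn by simp
    show "ty (\<gamma> (u * 2 ^ L + b)) = 2 \<longleftrightarrow> u = r div 2 ^ L" for u
    proof -
      have "u * 2 ^ L + b = r \<longleftrightarrow> u = r div 2 ^ L" using bn r_eq by auto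
      then show ?thesis using col[of "u * 2 ^ L + b"] bn by simp
    qed
    fix d assume d: "d \<in> {1..<(2 :: nat) ^ L}"
    have "walk \<gamma> L d (r div 2 ^ L * 2 ^ L + b) = node (2 ^ L + d)"
      using walk_node[of 1 L d] d unfolding r_eq node1 by simp
    also have "\<dots> = leaf d" using d by (simp add: node_def)
    finally show "leaf_ok L \<gamma> b d (walk \<gamma> L d (r div 2 ^ L * 2 ^ L + b))"
      using leaf(2)[of d] d by (simp add: leaf_ok_def \<gamma>_leaf ty_def bk_def)
  qed
  moreover obtain x where x: "x \<in> cube N" "\<And>z. z < 2 ^ (2 * L) \<Longrightarrow> map x (block z) = enc (\<gamma> z)"
    "\<And>z. z < 2 ^ (2 * L) \<Longrightarrow> cont x z = \<gamma> z"
    using ex_input[of \<gamma>] \<gamma>_in by blast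
  ultimately have "cert L (cont x) b" using cert_cong[of L "cont x" \<gamma> b] \<gamma>_in bn by blast
  then have "f x" using bn by (auto simp: f_def pointer_value_def)
  moreover have "consistent x S"
    unfolding consistent_def using x(2) adv_inv_dom[OF S] by (simp add: \<gamma>_def)
  ultimately show ?thesis using x(1) by blast
qed

text \<open>The existence of a tree ensures that the \<open>LEAST\<close> is attained. That tree
  gives one answer on a single path, and unless the path has length \<open>half * half\<close>,
  completions of both values are consistent with it.\<close>

lemma det_query_complexity_ge:
  assumes "\<exists>t. dt_computes N f t"
  shows "half * half \<le> det_query_complexity N f"
proof -
  have "\<exists>d t. dt_computes N f t \<and> d = (MAX x\<in>cube N. dt_cost t x)" using assms by blast
  from LeastI_ex[OF this] obtain t where t: "dt_computes N f t"
    and D: "det_query_complexity N f = (MAX x\<in>cube N. dt_cost t x)"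
    unfolding det_query_complexity_def by blast
  have empty: "adv_inv Map.empty"
    by (simp add: adv_inv_def revealed_def)
  obtain S' v k where S': "adv_inv S'" "card (dom S') \<le> k"
    and const: "\<And>x. consistent x S' \<Longrightarrow> dt_eval t x = v \<and> dt_cost t x = k"
    using adversary[OF empty, of t] t by (auto simp: dt_computes_def)
  obtain x where x: "x \<in> cube N" "consistent x S'" "\<not> f x"
    using ex_zero_completion[OF S'(1)] by blast
  have "half * half \<le> k"
  proof (rule ccontr)
    assume "\<not> ?thesis"
    then obtain y where "y \<in> cube N" "consistent y S'" "f y"
      using ex_one_completion[OF S'(1)] S'(2) by auto
    then show False using t x const unfolding dt_computes_def by metis
  qed
  also have "k \<le> (MAX x\<in>cube N. dt_cost t x)"
    using const[OF x(2)] x(1) finite_cube by (intro Max_ge) auto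
  finally show ?thesis by (simp add: D)
qed

end

section \<open>The search algorithm\<close>

text \<open>Rewrites a certificate as searches: for a zero, for the root, for a second root and for
  a wrong leaf below the root that was found.\<close>

lemma cert_iff:
  "cert L \<gamma> b \<longleftrightarrow> \<not> (\<exists>u<2 ^ L. ty (\<gamma> (u * 2 ^ L + b)) = 0) \<and>
     (let u = first_index (2 ^ L) (\<lambda>u. ty (\<gamma> (u * 2 ^ L + b)) = 2) in u < 2 ^ L \<and>
        \<not> (\<exists>u'<2 ^ L. u' \<noteq> u \<and> ty (\<gamma> (u' * 2 ^ L + b)) = 2) \<and>
        \<not> (\<exists>d<2 ^ L. d \<noteq> 0 \<and> \<not> leaf_ok L \<gamma> b d (walk \<gamma> L d (u * 2 ^ L + b))))"
  (is "_ \<longleftrightarrow> ?Z \<and> (let u = ?u in ?R u)")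
proof -
  have "(\<exists>u<2 ^ L. (\<forall>u'<2 ^ L. ty (\<gamma> (u' * 2 ^ L + b)) = 2 \<longleftrightarrow> u' = u) \<and>
        (\<forall>d\<in>{1..<2 ^ L}. leaf_ok L \<gamma> b d (walk \<gamma> L d (u * 2 ^ L + b)))) \<longleftrightarrow> ?R ?u"
  proof
    assume "\<exists>u<2 ^ L. (\<forall>u'<2 ^ L. ty (\<gamma> (u' * 2 ^ L + b)) = 2 \<longleftrightarrow> u' = u) \<and>
        (\<forall>d\<in>{1..<2 ^ L}. leaf_ok L \<gamma> b d (walk \<gamma> L d (u * 2 ^ L + b)))"
    then obtain u where u: "u < 2 ^ L" "\<And>u'. u' < 2 ^ L \<Longrightarrow> ty (\<gamma> (u' * 2 ^ L + b)) = 2 \<longleftrightarrow> u' = u"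
      "\<And>d. d \<in> {1..<2 ^ L} \<Longrightarrow> leaf_ok L \<gamma> b d (walk \<gamma> L d (u * 2 ^ L + b))" by blast
    have leaf: "leaf_ok L \<gamma> b d (walk \<gamma> L d (u * 2 ^ L + b))" if "d < 2 ^ L" "d \<noteq> 0" for d
      using u(3)[of d] that by simp
    have lt: "?u < 2 ^ L" unfolding first_index_less_iff using u(1) u(2)[OF u(1)] by auto
    have "?u = u" using first_index_sat[OF lt] u(2)[OF lt] by simp
    with u(1,2) leaf show "?R ?u" by auto
  next
    assume R: "?R ?u"
    then have "ty (\<gamma> (?u * 2 ^ L + b)) = 2" using first_index_sat by blast
    with R show "\<exists>u<2 ^ L. (\<forall>u'<2 ^ L. ty (\<gamma> (u' * 2 ^ L + b)) = 2 \<longleftrightarrow> u' = u) \<and>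
        (\<forall>d\<in>{1..<2 ^ L}. leaf_ok L \<gamma> b d (walk \<gamma> L d (u * 2 ^ L + b)))"
      by (intro exI[of _ ?u]) auto
  qed
  then show ?thesis unfolding cert_def Let_def by auto
qed

text \<open>
  The phase for a sample \<open>(s, \<rho>)\<close> looks in the
  current column for a zero whose back pointer leads to a column without zeros in the rows
  \<open>\<rho> 0, \<dots>, \<rho> (s - 1)\<close>, and moves there.  A column of a true certificate is never rejected, so if no
  such zero exists then the current column is the only candidate left.
\<close>

definition zeros :: "nat \<Rightarrow> (nat \<Rightarrow> content) \<Rightarrow> nat \<Rightarrow> nat" where
  "zeros L \<gamma> c = card {u. u < 2 ^ L \<and> ty (\<gamma> (u * 2 ^ L + c)) = 0}"

definition target :: "nat \<Rightarrow> (nat \<Rightarrow> content) \<Rightarrow> nat \<Rightarrow> nat \<Rightarrow> nat" where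
  "target L \<gamma> c u = xor c (bk (\<gamma> (u * 2 ^ L + c)))"

definition survives :: "nat \<Rightarrow> nat \<times> (nat \<Rightarrow> nat) \<Rightarrow> (nat \<Rightarrow> content) \<Rightarrow> nat \<Rightarrow> bool" where
  "survives L \<sigma> \<gamma> c \<longleftrightarrow> \<not> (\<exists>t<fst \<sigma>. ty (\<gamma> (snd \<sigma> t * 2 ^ L + c)) = 0)"

definition marked :: "nat \<Rightarrow> nat \<times> (nat \<Rightarrow> nat) \<Rightarrow> (nat \<Rightarrow> content) \<Rightarrow> nat \<Rightarrow> nat \<Rightarrow> bool" where
  "marked L \<sigma> \<gamma> c u \<longleftrightarrow> ty (\<gamma> (u * 2 ^ L + c)) = 0 \<and> survives L \<sigma> \<gamma> (target L \<gamma> c u)"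

primrec pursue :: "nat \<Rightarrow> (nat \<times> (nat \<Rightarrow> nat)) list \<Rightarrow> (nat \<Rightarrow> content) \<Rightarrow> nat \<Rightarrow> bool" where
  "pursue L [] \<gamma> c = cert L \<gamma> c"
| "pursue L (\<sigma> # \<sigma>s) \<gamma> c = (let u = first_index (2 ^ L) (marked L \<sigma> \<gamma> c) in
     if u < 2 ^ L then pursue L \<sigma>s \<gamma> (target L \<gamma> c u) else cert L \<gamma> c)"

text \<open>Every marked row is followed, not only the first, so that the condition does not mention
  the course of the search. The product of zeros and sample size is what governs the cost of a
  phase; the factor 2 comes from sample sizes doubling between phases.\<close>

primrec cheap :: "nat \<Rightarrow> nat \<Rightarrow> (nat \<times> (nat \<Rightarrow> nat)) list \<Rightarrow> (nat \<Rightarrow> content) \<Rightarrow> nat \<Rightarrow> bool" where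
  "cheap L l [] \<gamma> c \<longleftrightarrow> True"
| "cheap L l (\<sigma> # \<sigma>s) \<gamma> c \<longleftrightarrow> zeros L \<gamma> c * fst \<sigma> \<le> 2 * 2 ^ L * l \<and>
     (\<forall>u<2 ^ L. marked L \<sigma> \<gamma> c u \<longrightarrow> cheap L l \<sigma>s \<gamma> (target L \<gamma> c u))"

lemma target_less: "\<gamma> (u * 2 ^ L + c) \<in> contents L \<Longrightarrow> c < 2 ^ L \<Longrightarrow> target L \<gamma> c u < 2 ^ L"
  by (auto simp: target_def contents_def bk_def intro!: xor_less_power)

lemma pursue_sound:
  assumes "\<And>z. \<gamma> z \<in> contents L" "c < 2 ^ L" "pursue L \<sigma>s \<gamma> c"
  shows "pointer_value L \<gamma>"
  using assms(2,3)
proof (induction \<sigma>s arbitrary: c)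
  case (Cons \<sigma> \<sigma>s)
  show ?case
  proof (cases "first_index (2 ^ L) (marked L \<sigma> \<gamma> c) < 2 ^ L")
    case True
    then show ?thesis
      using Cons.IH[OF target_less[OF assms(1) Cons.prems(1)]] Cons.prems(2) by (simp add: Let_def)
  next
    case False
    then show ?thesis using Cons.prems by (auto simp: Let_def pointer_value_def)
  qed
qed (auto simp: pointer_value_def)

text \<open>A column without zeros can only be \<open>b\<close>, as every other column has a leaf.
  The last sample covers the whole column, hence the column reached after the last phase has no
  zeros; an earlier stop is correct because a zero pointing to \<open>b\<close> would have been
  marked.\<close>

lemma pursue_complete:
  assumes \<gamma>: "\<And>z. \<gamma> z \<in> contents L" and b: "b < 2 ^ L" "cert L \<gamma> b" and "c < 2 ^ L"
    and samples: "\<forall>\<sigma>\<in>set \<sigma>s. \<forall>t<fst \<sigma>. snd \<sigma> t < 2 ^ L"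
    and last: "zeros L \<gamma> c = 0 \<or> (\<sigma>s \<noteq> [] \<and> {..<2 ^ L} \<subseteq> snd (last \<sigma>s) ` {..<fst (last \<sigma>s)})"
  shows "pursue L \<sigma>s \<gamma> c"
  using assms(4-6)
proof (induction \<sigma>s arbitrary: c)
  case Nil
  then have "ty (\<gamma> (u * 2 ^ L + c)) \<noteq> 0" if "u < 2 ^ L" for u using that by (auto simp: zeros_def)
  then have "c = b" using cert_zero_in_column[OF \<gamma> b(2,1) Nil(1)] by metis
  then show ?case using b by simp
next
  case (Cons \<sigma> \<sigma>s)
  have nz: "ty (\<gamma> (u * 2 ^ L + b)) \<noteq> 0" if "u < 2 ^ L" for u using b(2) that by (auto simp: cert_def)
  let ?u = "first_index (2 ^ L) (marked L \<sigma> \<gamma> c)"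
  show ?case
  proof (cases "?u < 2 ^ L")
    case True
    then have marked: "marked L \<sigma> \<gamma> c ?u" by (rule first_index_sat)
    have "zeros L \<gamma> c \<noteq> 0"
      using marked True by (auto simp: zeros_def marked_def)
    then have last: "{..<2 ^ L} \<subseteq> snd (last (\<sigma> # \<sigma>s)) ` {..<fst (last (\<sigma> # \<sigma>s))}" using Cons.prems by simp
    have "zeros L \<gamma> (target L \<gamma> c ?u) = 0" if "\<sigma>s = []"
    proof -
      have "ty (\<gamma> (v * 2 ^ L + target L \<gamma> c ?u)) \<noteq> 0" if v: "v < 2 ^ L" for v
      proof -
        have "v \<in> snd \<sigma> ` {..<fst \<sigma>}" using last v \<open>\<sigma>s = []\<close> by auto
        then show ?thesis using marked by (auto simp: marked_def survives_def)
      qed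
      then show ?thesis by (simp add: zeros_def)
    qed
    then have "pursue L \<sigma>s \<gamma> (target L \<gamma> c ?u)"
      using last Cons.prems(2) by (intro Cons.IH target_less \<gamma> Cons.prems(1)) (auto split: if_splits)
    then show ?thesis using True by (simp add: Let_def)
  next
    case False
    have "c = b"
    proof (rule ccontr)
      assume "c \<noteq> b"
      then obtain u where u: "u < 2 ^ L" "ty (\<gamma> (u * 2 ^ L + c)) = 0" "target L \<gamma> c u = b"
        unfolding target_def by (rule cert_zero_in_column[OF \<gamma> b(2,1) Cons.prems(1)])
      then have "marked L \<sigma> \<gamma> c u"
        using Cons.prems(2) nz by (auto simp: marked_def survives_def)
      with u(1) False show False using first_index_less_iff by blast
    qed
    with False b show ?thesis by (simp add: Let_def)
  qed
qed

context query_model begin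

lemma empty: "C {} g \<phi>"
  by (rule mono[OF const[of "{}" 0]]) auto

lemma conj:
  assumes "C X (\<lambda>x. of_bool (P x)) (\<lambda>_. a)" "C X (\<lambda>x. of_bool (Q x)) (\<lambda>_. b)"
  shows "C X (\<lambda>x. of_bool (P x \<and> Q x)) (\<lambda>_. a + b)"
proof -
  have "C {x\<in>X. of_bool (P x) = k} (\<lambda>x. of_bool (k \<noteq> 0 \<and> Q x)) (\<lambda>_. b)" for k :: nat
  proof -
    have "C {x\<in>X. of_bool (P x) = k} (\<lambda>x. of_bool (Q x)) (\<lambda>_. b)"
      by (rule cost_mono[OF assms(2)]) auto
    from bool[OF this, where P = "\<lambda>m. k \<noteq> 0 \<and> m \<noteq> 0"] show ?thesis by simp
  qed
  from bind_bool[OF assms(1) this] show ?thesis by simp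
qed

end

section \<open>Query costs of the search phases\<close>

context pointer_function begin

definition unit_cost :: "real \<Rightarrow> nat \<Rightarrow> real" where "unit_cost w m = (w * m + 1 / w) * K"

definition mark_cost :: "real \<Rightarrow> real \<Rightarrow> nat \<Rightarrow> real" where
  "mark_cost w1 w2 s = K / w1 + (K + unit_cost w2 s)"

text \<open>The cost of a nested search over one column: all \<open>2 ^ L\<close> cells pay the
  weighted zero test, only the \<open>z\<close> zeros pay for testing their target, and the last
  summand pays for the successful candidate.\<close>

definition phase_cost :: "real \<Rightarrow> real \<Rightarrow> real \<Rightarrow> nat \<Rightarrow> nat \<Rightarrow> real" where
  "phase_cost w w1 w2 s z = w * (real (2 ^ L) * (w1 * real K) + z * mark_cost w1 w2 s) + mark_cost w1 w2 s / w"

end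

locale pointer_query = pointer_function L \<kappa> dec + query_model "pointer_function.N L \<kappa>" C weights
  for L \<kappa> :: nat and dec and C and weights
begin

lemma read_cell_bind:
  assumes X: "X \<subseteq> cube N" and z: "z < 2 ^ (2 * L)"
    and P: "\<And>c. c \<in> contents L \<Longrightarrow> C {x\<in>X. cont x z = c} (\<lambda>x. of_bool (P c x)) (\<psi> c)"
  shows "C X (\<lambda>x. of_bool (P (cont x z) x)) (\<lambda>x. real K + \<psi> (cont x z) x)"
proof -
  have "C {x\<in>X. map x (block z) = bs} (\<lambda>x. of_bool (P (dec bs) x)) (\<psi> (dec bs))" for bs
    by (rule cost_mono[OF P[OF dec_range]]) (auto simp: cont_def)
  from read_bind[OF X block_subset[OF z] this] show ?thesis by (simp add: cont_def length_block)
qed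

lemma read_cell_bool:
  assumes "X \<subseteq> cube N" "z < 2 ^ (2 * L)"
  shows "C X (\<lambda>x. of_bool (P (cont x z))) (\<lambda>_. real K)"
  using read_bool[OF assms(1) block_subset[OF assms(2)], of "\<lambda>bs. P (dec bs)"]
  by (simp add: cont_def length_block)

lemma leaf_query:
  assumes "X \<subseteq> cube N" "z < 2 ^ (2 * L)"
  shows "C X (\<lambda>x. of_bool (leaf_ok L (cont x) b d (walk (cont x) t d z))) (\<lambda>_. (real t + 1) * K)"
  using assms
proof (induction t arbitrary: X z)
  case 0
  then show ?case
    using read_cell_bool[OF 0, of "\<lambda>c. ty c = 0 \<and> z mod 2 ^ L = xor b d \<and> bk c = d"]
    by (simp add: leaf_ok_def)
next
  case (Suc t)
  have "C X (\<lambda>x. of_bool (leaf_ok L (cont x) b d (walk (cont x) t d (xor z (child (bit d t) (cont x z))))))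
      (\<lambda>x. real K + (real t + 1) * K)"
  proof (rule read_cell_bind[OF Suc.prems, where \<psi> = "\<lambda>_ _. (real t + 1) * K"
        and P = "\<lambda>c x. leaf_ok L (cont x) b d (walk (cont x) t d (xor z (child (bit d t) c)))"])
    fix c assume "c \<in> contents L"
    then have "child (bit d t) c < 2 ^ (2 * L)" by (auto simp: contents_def child_def)
    then have "xor z (child (bit d t) c) < 2 ^ (2 * L)" by (rule xor_less_power[OF Suc.prems(2)])
    then show "C {x\<in>X. cont x z = c} (\<lambda>x. of_bool (leaf_ok L (cont x) b d
        (walk (cont x) t d (xor z (child (bit d t) c))))) (\<lambda>_. (real t + 1) * K)"
      using Suc.prems(1) by (intro Suc.IH) auto
  qed
  then show ?case by (simp add: algebra_simps)
qed

lemma unit_cost_nonneg: "w \<in> weights \<Longrightarrow> 0 \<le> unit_cost w m"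
  using weights_pos[of w] by (simp add: unit_cost_def)

text \<open>The factor \<open>L + 4\<close> consists of one search each for a zero, for the root and
  for a second root, and a search over the leaves in which one test reads \<open>L + 1\<close>
  cells.\<close>

lemma cert_query:
  assumes w: "w \<in> weights" and X: "X \<subseteq> cube N" and b: "b < 2 ^ L"
  shows "C X (\<lambda>x. of_bool (cert L (cont x) b)) (\<lambda>_. (real L + 4) * unit_cost w (2 ^ L))"
proof -
  note cell = cell_less[OF _ b]
  let ?u = "\<lambda>x. first_index (2 ^ L) (\<lambda>u. ty (cont x (u * 2 ^ L + b)) = 2)"
  have zero: "C X (\<lambda>x. of_bool (\<not> (\<exists>u<2 ^ L. ty (cont x (u * 2 ^ L + b)) = 0))) (\<lambda>_. unit_cost w (2 ^ L))"
    unfolding unit_cost_def by (intro negate exists_const w X read_cell_bool[of X _ "\<lambda>c. ty c = 0"] cell) auto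
  define R where "R u x \<longleftrightarrow> u < 2 ^ L \<and> \<not> (\<exists>u'<2 ^ L. u' \<noteq> u \<and> ty (cont x (u' * 2 ^ L + b)) = 2) \<and>
      \<not> (\<exists>d<2 ^ L. d \<noteq> 0 \<and> \<not> leaf_ok L (cont x) b d (walk (cont x) L d (u * 2 ^ L + b)))" for u x
  have root: "C X ?u (\<lambda>_. unit_cost w (2 ^ L))"
    unfolding unit_cost_def by (intro search_const w X read_cell_bool[of X _ "\<lambda>c. ty c = 2"] cell) auto
  have R: "C {x\<in>X. ?u x = u} (\<lambda>x. of_bool (R u x)) (\<lambda>_. (real L + 2) * unit_cost w (2 ^ L))" for u
  proof (cases "u < 2 ^ L")
    case True
    let ?Y = "{x\<in>X. ?u x = u}"
    have Y: "?Y \<subseteq> cube N" using X by auto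
    have "C ?Y (\<lambda>x. of_bool (\<not> (\<exists>u'<2 ^ L. u' \<noteq> u \<and> ty (cont x (u' * 2 ^ L + b)) = 2))) (\<lambda>_. unit_cost w (2 ^ L))"
      unfolding unit_cost_def
    proof (intro negate exists_const w Y)
      fix u' :: nat assume "u' < 2 ^ L"
      then show "C ?Y (\<lambda>x. of_bool (u' \<noteq> u \<and> ty (cont x (u' * 2 ^ L + b)) = 2)) (\<lambda>_. real K)"
        using read_cell_bool[OF Y cell, of u' "\<lambda>c. u' \<noteq> u \<and> ty c = 2"] by simp
    qed simp
    moreover have "C ?Y (\<lambda>x. of_bool (\<not> (\<exists>d<2 ^ L. d \<noteq> 0 \<and> \<not> leaf_ok L (cont x) b d (walk (cont x) L d (u * 2 ^ L + b)))))
        (\<lambda>_. (w * (2 ^ L :: nat) + 1 / w) * ((real L + 1) * K))"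
    proof (intro negate exists_const w Y)
      fix d :: nat
      have "C ?Y (\<lambda>x. of_bool (leaf_ok L (cont x) b d (walk (cont x) L d (u * 2 ^ L + b)))) (\<lambda>_. (real L + 1) * K)"
        by (rule leaf_query[OF Y cell[OF True]])
      from bool[OF this, where P = "\<lambda>m. d \<noteq> 0 \<and> m = 0"]
      show "C ?Y (\<lambda>x. of_bool (d \<noteq> 0 \<and> \<not> leaf_ok L (cont x) b d (walk (cont x) L d (u * 2 ^ L + b)))) (\<lambda>_. (real L + 1) * K)"
        by simp
    qed simp
    ultimately have "C ?Y (\<lambda>x. of_bool (R u x))
        (\<lambda>_. unit_cost w (2 ^ L) + (w * (2 ^ L :: nat) + 1 / w) * ((real L + 1) * K))"
      using conj True unfolding R_def by simp
    moreover have "unit_cost w (2 ^ L) + (w * (2 ^ L :: nat) + 1 / w) * ((real L + 1) * K) =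
        (real L + 2) * unit_cost w (2 ^ L)"
      by (simp add: unit_cost_def algebra_simps)
    ultimately show ?thesis by simp
  next
    case False
    have "C {x\<in>X. ?u x = u} (\<lambda>_. 0) (\<lambda>_. 0)" using X by (intro const) auto
    then show ?thesis
      using False unit_cost_nonneg[OF w] by (elim mono) (auto simp: R_def)
  qed
  have "C X (\<lambda>x. of_bool (\<not> (\<exists>u<2 ^ L. ty (cont x (u * 2 ^ L + b)) = 0) \<and> R (?u x) x))
      (\<lambda>_. unit_cost w (2 ^ L) + (unit_cost w (2 ^ L) + (real L + 2) * unit_cost w (2 ^ L)))"
    by (intro conj zero bind_bool[OF root R])
  moreover have "cert L (cont x) b \<longleftrightarrow> \<not> (\<exists>u<2 ^ L. ty (cont x (u * 2 ^ L + b)) = 0) \<and> R (?u x) x" for x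
    by (simp only: cert_iff R_def Let_def)
  moreover have "unit_cost w (2 ^ L) + (unit_cost w (2 ^ L) + (real L + 2) * unit_cost w (2 ^ L)) =
      (real L + 4) * unit_cost w (2 ^ L)" by (simp add: algebra_simps)
  ultimately show ?thesis by simp
qed

text \<open>The weight is put on the zero test before anything else is composed with it; this is why
  a cell without zero costs only \<open>w1 * K\<close>. The test reveals one bit of information, so
  the back pointer is read in a second pass.\<close>

lemma mark_query:
  assumes w: "w1 \<in> weights" "w2 \<in> weights" and X: "X \<subseteq> cube N" and c: "c < 2 ^ L" and u: "u < 2 ^ L"
    and \<sigma>: "\<forall>t<fst \<sigma>. snd \<sigma> t < 2 ^ L"
  shows "C X (\<lambda>x. of_bool (marked L \<sigma> (cont x) c u))
    (\<lambda>x. if ty (cont x (u * 2 ^ L + c)) = 0 then mark_cost w1 w2 (fst \<sigma>) else w1 * K)"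
proof -
  define z where "z = u * 2 ^ L + c"
  have z: "z < 2 ^ (2 * L)" unfolding z_def by (rule cell_less[OF u c])
  define P where "P m x \<longleftrightarrow> m \<noteq> 0 \<and> survives L \<sigma> (cont x) (xor c (bk (cont x z)))" for m :: nat and x
  define \<psi> where "\<psi> m = (\<lambda>x :: nat \<Rightarrow> bool. if m = 0 then 0 else K + unit_cost w2 (fst \<sigma>))" for m :: nat
  have "C {x\<in>X. of_bool (ty (cont x z) = 0) = m} (\<lambda>x. of_bool (P m x)) (\<psi> m)" for m
  proof (cases "m = 0")
    case True
    then show ?thesis
      using const[of "{x\<in>X. of_bool (ty (cont x z) = 0) = m}" 0] X by (auto simp: P_def \<psi>_def)
  next
    case False
    let ?Y = "{x\<in>X. of_bool (ty (cont x z) = 0) = m}"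
    have Y: "?Y \<subseteq> cube N" using X by auto
    have "C ?Y (\<lambda>x. of_bool (survives L \<sigma> (cont x) (xor c (bk (cont x z))))) (\<lambda>x. real K + unit_cost w2 (fst \<sigma>))"
    proof (rule read_cell_bind[OF Y z, where P = "\<lambda>v x. survives L \<sigma> (cont x) (xor c (bk v))"])
      fix v assume "v \<in> contents L"
      then have "xor c (bk v) < 2 ^ L" by (auto simp: contents_def bk_def intro!: xor_less_power c)
      then show "C {x\<in>?Y. cont x z = v} (\<lambda>x. of_bool (survives L \<sigma> (cont x) (xor c (bk v)))) (\<lambda>_. unit_cost w2 (fst \<sigma>))"
        unfolding survives_def unit_cost_def
        using Y \<sigma> by (intro negate exists_const w read_cell_bool[where P = "\<lambda>v. ty v = 0"] cell_less) auto
    qed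
    then show ?thesis using False by (simp add: P_def \<psi>_def)
  qed
  from bind_bool[OF weight[OF w(1) read_cell_bool[OF X z, of "\<lambda>v. ty v = 0"]] this]
  have "C X (\<lambda>x. of_bool (P (of_bool (ty (cont x z) = 0)) x))
      (\<lambda>x. (if ty (cont x z) = 0 then K / w1 else w1 * K) + \<psi> (of_bool (ty (cont x z) = 0)) x)" .
  then show ?thesis
    by (elim mono) (auto simp: P_def \<psi>_def marked_def target_def z_def mark_cost_def)
qed

lemma phase_query:
  assumes w: "w \<in> weights" "w1 \<in> weights" "w2 \<in> weights" and X: "X \<subseteq> cube N" and c: "c < 2 ^ L"
    and \<sigma>: "\<forall>t<fst \<sigma>. snd \<sigma> t < 2 ^ L"
  shows "C X (\<lambda>x. first_index (2 ^ L) (marked L \<sigma> (cont x) c))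
    (\<lambda>x. phase_cost w w1 w2 (fst \<sigma>) (zeros L (cont x) c))"
proof (rule cost_mono[OF search[OF w(1) X mark_query[OF w(2,3) X c _ \<sigma>]]])
  fix x
  let ?E = "mark_cost w1 w2 (fst \<sigma>)" and ?m = "first_index (2 ^ L) (marked L \<sigma> (cont x) c)"
  let ?\<phi> = "\<lambda>u. if ty (cont x (u * 2 ^ L + c)) = 0 then ?E else w1 * K"
  have pos: "w > 0" "w1 > 0" "w2 > 0" using w weights_pos by auto
  then have E: "?E \<ge> 0" using unit_cost_nonneg[OF w(3)] by (simp add: mark_cost_def)
  have "(\<Sum>u<?m. ?\<phi> u) \<le> (\<Sum>u<2 ^ L. ?\<phi> u)"
    using E pos first_index_le[of "2 ^ L" "marked L \<sigma> (cont x) c"] by (intro sum_mono2) auto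
  also have "\<dots> \<le> (\<Sum>u<2 ^ L. w1 * K + (if ty (cont x (u * 2 ^ L + c)) = 0 then ?E else 0))"
    using pos by (intro sum_mono) auto
  also have "\<dots> = real (2 ^ L) * (w1 * real K) + zeros L (cont x) c * ?E"
    by (simp add: sum.distrib zeros_def sum.If_cases Int_def)
  finally have "w * (\<Sum>u<?m. ?\<phi> u) \<le> w * (real (2 ^ L) * (w1 * real K) + zeros L (cont x) c * ?E)"
    using pos by (intro mult_left_mono) auto
  moreover have "(if ?m < 2 ^ L then ?\<phi> ?m / w else 0) \<le> ?E / w"
    using first_index_sat[of "2 ^ L" "marked L \<sigma> (cont x) c"] E pos by (auto simp: marked_def)
  ultimately show "w * (\<Sum>u<?m. ?\<phi> u) + (if ?m < 2 ^ L then ?\<phi> ?m / w else 0) \<le>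
      phase_cost w w1 w2 (fst \<sigma>) (zeros L (cont x) c)"
    by (simp add: phase_cost_def)
qed auto

lemma zeros_le: "zeros L \<gamma> c \<le> 2 ^ L"
  unfolding zeros_def by (rule order_trans[OF card_mono[of "{..<2 ^ L}"]]) auto

text \<open>The weights of a phase may depend on its sample but not on the input, so the number of
  zeros enters only through two bounds: \<open>A\<close> for every phase of a cheap run and
  \<open>B\<close> in general. The extra \<open>K\<close> per phase reads the back pointer of the
  row that was found.\<close>

lemma pursue_query:
  fixes A B :: real
  assumes w3: "w3 \<in> weights" and AB: "0 \<le> A" "A \<le> B" and X: "X \<subseteq> cube N" and c: "c < 2 ^ L"
    and \<sigma>s: "\<And>\<sigma> t. \<sigma> \<in> set \<sigma>s \<Longrightarrow> t < fst \<sigma> \<Longrightarrow> snd \<sigma> t < 2 ^ L"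
    and phase: "\<And>\<sigma>. \<sigma> \<in> set \<sigma>s \<Longrightarrow> \<exists>w\<in>weights. \<exists>w1\<in>weights. \<exists>w2\<in>weights. \<forall>z\<le>2 ^ L.
       phase_cost w w1 w2 (fst \<sigma>) z \<le> (if z * fst \<sigma> \<le> 2 * 2 ^ L * l then A else B)"
  shows "C X (\<lambda>x. of_bool (pursue L \<sigma>s (cont x) c))
    (\<lambda>x. length \<sigma>s * ((if cheap L l \<sigma>s (cont x) c then A else B) + K) + (real L + 4) * unit_cost w3 (2 ^ L))"
  using X c \<sigma>s phase
proof (induction \<sigma>s arbitrary: X c)
  case Nil
  then show ?case using cert_query[OF w3] by simp
next
  case (Cons \<sigma> \<sigma>s)
  let ?CC = "(real L + 4) * unit_cost w3 (2 ^ L)"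
  have CC: "?CC \<ge> 0" using unit_cost_nonneg[OF w3] by simp
  obtain w w1 w2 where w: "w \<in> weights" "w1 \<in> weights" "w2 \<in> weights"
    and pc: "\<And>z. z \<le> 2 ^ L \<Longrightarrow> phase_cost w w1 w2 (fst \<sigma>) z \<le> (if z * fst \<sigma> \<le> 2 * 2 ^ L * l then A else B)"
    using Cons.prems(4)[of \<sigma>] by auto
  define D where "D c' x = (if cheap L l \<sigma>s (cont x) c' then A else B)" for c' x
  define P where "P u x = (if u < 2 ^ L then pursue L \<sigma>s (cont x) (target L (cont x) c u) else cert L (cont x) c)" for u x
  define \<psi> where "\<psi> u x = (if u < 2 ^ L then K + (length \<sigma>s * (D (target L (cont x) c u) x + K) + ?CC) else ?CC)" for u x
  have "C {x\<in>X. first_index (2 ^ L) (marked L \<sigma> (cont x) c) = u} (\<lambda>x. of_bool (P u x)) (\<psi> u)" for u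
  proof (cases "u < 2 ^ L")
    case True
    let ?Y = "{x\<in>X. first_index (2 ^ L) (marked L \<sigma> (cont x) c) = u}"
    have Y: "?Y \<subseteq> cube N" using Cons.prems(1) by auto
    have "C ?Y (\<lambda>x. of_bool (pursue L \<sigma>s (cont x) (xor c (bk (cont x (u * 2 ^ L + c))))))
        (\<lambda>x. real K + (length \<sigma>s * (D (xor c (bk (cont x (u * 2 ^ L + c)))) x + K) + ?CC))"
    proof (rule read_cell_bind[OF Y cell_less[OF True Cons.prems(2)],
          where P = "\<lambda>v x. pursue L \<sigma>s (cont x) (xor c (bk v))"
            and \<psi> = "\<lambda>v x. length \<sigma>s * (D (xor c (bk v)) x + K) + ?CC"])
      fix v assume "v \<in> contents L"
      then have lt: "xor c (bk v) < 2 ^ L" by (auto simp: contents_def bk_def intro!: xor_less_power Cons.prems)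
      show "C {x\<in>?Y. cont x (u * 2 ^ L + c) = v} (\<lambda>x. of_bool (pursue L \<sigma>s (cont x) (xor c (bk v))))
          (\<lambda>x. length \<sigma>s * (D (xor c (bk v)) x + K) + ?CC)"
        unfolding D_def
      proof (rule Cons.IH)
        show "{x\<in>?Y. cont x (u * 2 ^ L + c) = v} \<subseteq> cube N" using Y by auto
        show "xor c (bk v) < 2 ^ L" by (rule lt)
        show "snd \<tau> t < 2 ^ L" if "\<tau> \<in> set \<sigma>s" "t < fst \<tau>" for \<tau> t
          using Cons.prems(3) that by auto
        show "\<exists>w\<in>weights. \<exists>w1\<in>weights. \<exists>w2\<in>weights. \<forall>z\<le>2 ^ L.
            phase_cost w w1 w2 (fst \<tau>) z \<le> (if z * fst \<tau> \<le> 2 * 2 ^ L * l then A else B)"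
          if "\<tau> \<in> set \<sigma>s" for \<tau>
          by (rule Cons.prems(4)) (use that in simp)
      qed
    qed
    moreover have "P u = (\<lambda>x. pursue L \<sigma>s (cont x) (xor c (bk (cont x (u * 2 ^ L + c)))))"
      "\<psi> u = (\<lambda>x. real K + (length \<sigma>s * (D (xor c (bk (cont x (u * 2 ^ L + c)))) x + K) + ?CC))"
      using True by (simp_all add: P_def[abs_def] \<psi>_def[abs_def] target_def)
    ultimately show ?thesis by simp
  next
    case False
    then have "P u = (\<lambda>x. cert L (cont x) c)" "\<psi> u = (\<lambda>_. ?CC)"
      by (simp_all add: P_def[abs_def] \<psi>_def[abs_def])
    moreover have "C {x\<in>X. first_index (2 ^ L) (marked L \<sigma> (cont x) c) = u} (\<lambda>x. of_bool (cert L (cont x) c)) (\<lambda>_. ?CC)"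
      using Cons.prems(1) by (intro cert_query[OF w3 _ Cons.prems(2)]) auto
    ultimately show ?thesis by simp
  qed
  then have body: "\<And>u. C {x\<in>X. first_index (2 ^ L) (marked L \<sigma> (cont x) c) = u} (\<lambda>x. of_bool (P u x)) (\<psi> u)" .
  have "\<forall>t<fst \<sigma>. snd \<sigma> t < 2 ^ L" using Cons.prems(3)[of \<sigma>] by simp
  from bind_bool[OF phase_query[OF w Cons.prems(1,2) this] body]
  have *: "C X (\<lambda>x. of_bool (P (first_index (2 ^ L) (marked L \<sigma> (cont x) c)) x))
     (\<lambda>x. phase_cost w w1 w2 (fst \<sigma>) (zeros L (cont x) c) + \<psi> (first_index (2 ^ L) (marked L \<sigma> (cont x) c)) x)" .
  show ?case
  proof (rule mono[OF *])
    fix x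
    let ?u = "first_index (2 ^ L) (marked L \<sigma> (cont x) c)"
    let ?G = "if cheap L l (\<sigma> # \<sigma>s) (cont x) c then A else B"
    have 1: "phase_cost w w1 w2 (fst \<sigma>) (zeros L (cont x) c) \<le> ?G"
      using pc[OF zeros_le, of "cont x" c] AB by (auto split: if_splits)
    have 2: "\<psi> ?u x \<le> K + (length \<sigma>s * (?G + K) + ?CC)"
    proof (cases "?u < 2 ^ L")
      case True
      then have "D (target L (cont x) c ?u) x \<le> ?G"
        using first_index_sat[OF True] AB by (auto simp: D_def)
      then show ?thesis using True by (simp add: \<psi>_def mult_left_mono)
    next
      case False
      have "0 \<le> length \<sigma>s * (?G + K)" using AB by simp
      with False show ?thesis by (simp add: \<psi>_def)
    qed
    have "length (\<sigma> # \<sigma>s) * (?G + K) + ?CC = ?G + (K + (length \<sigma>s * (?G + K) + ?CC))"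
      by (simp add: algebra_simps)
    with 1 2 show "phase_cost w w1 w2 (fst \<sigma>) (zeros L (cont x) c) + \<psi> ?u x \<le>
        length (\<sigma> # \<sigma>s) * (?G + K) + ?CC" by linarith
  next
    fix x y
    have "P (first_index (2 ^ L) (marked L \<sigma> (cont x) c)) x = pursue L (\<sigma> # \<sigma>s) (cont x) c" for x
      by (simp add: P_def Let_def)
    then show "of_bool (pursue L (\<sigma> # \<sigma>s) (cont x) c) = (of_bool (pursue L (\<sigma> # \<sigma>s) (cont y) c) :: nat) \<longleftrightarrow>
        of_bool (P (first_index (2 ^ L) (marked L \<sigma> (cont x) c)) x) =
        (of_bool (P (first_index (2 ^ L) (marked L \<sigma> (cont y) c)) y) :: nat)" by simp
  qed auto
qed

end

section \<open>Degree and zero-error algorithms\<close>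

definition poly_eval :: "nat \<Rightarrow> (nat set \<Rightarrow> real) \<Rightarrow> (nat \<Rightarrow> bool) \<Rightarrow> real" where
  "poly_eval N c x = (\<Sum>S\<in>Pow {1..N}. c S * (\<Prod>i\<in>S. of_bool (x i)))"

definition degree_le :: "nat \<Rightarrow> (nat \<Rightarrow> bool) set \<Rightarrow> ((nat \<Rightarrow> bool) \<Rightarrow> real) \<Rightarrow> nat \<Rightarrow> bool" where
  "degree_le N X F d \<longleftrightarrow>
     (\<exists>c. (\<forall>S. c S \<noteq> 0 \<longrightarrow> S \<subseteq> {1..N} \<and> card S \<le> d) \<and> (\<forall>x\<in>X. poly_eval N c x = F x))"

lemma degree_leE:
  assumes "degree_le N X F d"
  obtains c where "\<forall>S. c S \<noteq> 0 \<longrightarrow> S \<subseteq> {1..N} \<and> card S \<le> d" "\<forall>x\<in>X. poly_eval N c x = F x"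
proof -
  obtain c where *: "(\<forall>S. c S \<noteq> 0 \<longrightarrow> S \<subseteq> {1..N} \<and> card S \<le> d) \<and> (\<forall>x\<in>X. poly_eval N c x = F x)"
    using assms unfolding degree_le_def by (rule exE)
  show thesis by (rule that[of c]) (use * in simp_all)
qed

lemma degree_leI:
  assumes "\<And>S. c S \<noteq> 0 \<Longrightarrow> S \<subseteq> {1..N} \<and> card S \<le> d" "\<And>x. x \<in> X \<Longrightarrow> poly_eval N c x = F x"
  shows "degree_le N X F d"
  unfolding degree_le_def by (rule exI[of _ c]) (intro conjI allI impI ballI assms)

lemma degree_le_zero: "degree_le N X (\<lambda>_. 0) d"
  unfolding degree_le_def by (rule exI[of _ "\<lambda>_. 0"]) (simp add: poly_eval_def)

lemma degree_le_one: "degree_le N X (\<lambda>_. 1) d"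
proof -
  have "poly_eval N (\<lambda>S. of_bool (S = {})) x = 1" for x
  proof -
    have "poly_eval N (\<lambda>S. of_bool (S = {})) x = (\<Sum>S\<in>Pow {1..N}. if S = {} then 1 else 0)"
      unfolding poly_eval_def by (rule sum.cong) auto
    then show ?thesis by simp
  qed
  then show ?thesis
    unfolding degree_le_def by (intro exI[of _ "\<lambda>S. of_bool (S = {})"]) (auto simp: of_bool_def)
qed

lemma degree_le_lin:
  assumes "degree_le N X F d" "degree_le N X G d"
  shows "degree_le N X (\<lambda>x. F x + a * G x) d"
proof -
  obtain c where c: "\<forall>S. c S \<noteq> 0 \<longrightarrow> S \<subseteq> {1..N} \<and> card S \<le> d" "\<forall>x\<in>X. poly_eval N c x = F x"
    by (rule degree_leE[OF assms(1)])
  obtain e where e: "\<forall>S. e S \<noteq> 0 \<longrightarrow> S \<subseteq> {1..N} \<and> card S \<le> d" "\<forall>x\<in>X. poly_eval N e x = G x"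
    by (rule degree_leE[OF assms(2)])
  have "poly_eval N (\<lambda>S. c S + a * e S) x = poly_eval N c x + a * poly_eval N e x" for x
    by (simp add: poly_eval_def sum.distrib sum_distrib_left algebra_simps)
  moreover have "S \<subseteq> {1..N} \<and> card S \<le> d" if "c S + a * e S \<noteq> 0" for S
    using c(1)[rule_format, of S] e(1)[rule_format, of S] that by (cases "c S = 0") auto
  ultimately show ?thesis
    unfolding degree_le_def using c(2) e(2) by (intro exI[of _ "\<lambda>S. c S + a * e S"]) simp
qed

lemma degree_le_sum:
  assumes "finite B" "\<And>b. b \<in> B \<Longrightarrow> degree_le N X (F b) d"
  shows "degree_le N X (\<lambda>x. \<Sum>b\<in>B. F b x) d"
  using assms
proof (induction B rule: finite_induct)
  case empty
  then show ?case by (simp add: degree_le_zero)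
next
  case (insert b B)
  have "degree_le N X (\<lambda>x. F b x + 1 * (\<Sum>b\<in>B. F b x)) d"
    by (rule degree_le_lin) (use insert in auto)
  then show ?case using insert by simp
qed

lemma degree_le_mult_var:
  assumes i: "i \<in> {1..N}" and F: "degree_le N X F d"
  shows "degree_le N X (\<lambda>x. of_bool (x i) * F x) (Suc d)"
proof -
  obtain c where c: "\<forall>S. c S \<noteq> 0 \<longrightarrow> S \<subseteq> {1..N} \<and> card S \<le> d" "\<forall>x\<in>X. poly_eval N c x = F x"
    by (rule degree_leE[OF F])
  \<comment> \<open>On the cube the square of a variable is the variable, so the monomials of
    \<open>T\<close> and of \<open>insert i T\<close> have the same product with variable
    \<open>i\<close> and their coefficients merge.\<close>
  define e where "e S = (\<Sum>T | T \<in> Pow {1..N} \<and> insert i T = S. c T)" for S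
  have "poly_eval N e x = of_bool (x i) * poly_eval N c x" for x
  proof -
    have "poly_eval N e x = (\<Sum>S\<in>Pow {1..N}. \<Sum>T | T \<in> Pow {1..N} \<and> insert i T = S.
        c T * (\<Prod>j\<in>insert i T. of_bool (x j)))"
      unfolding poly_eval_def e_def sum_distrib_right by (intro sum.cong refl) auto
    also have "\<dots> = (\<Sum>T\<in>Pow {1..N}. c T * (\<Prod>j\<in>insert i T. of_bool (x j)))"
      using i by (intro sum.group) auto
    also have "\<dots> = (\<Sum>T\<in>Pow {1..N}. of_bool (x i) * (c T * (\<Prod>j\<in>T. of_bool (x j))))"
    proof (intro sum.cong refl)
      fix T assume "T \<in> Pow {1..N}"
      then have fin: "finite T" using finite_subset by auto
      have "(\<Prod>j\<in>insert i T. of_bool (x j)) = of_bool (x i) * (\<Prod>j\<in>T. of_bool (x j) :: real)"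
        using fin by (cases "i \<in> T") (auto simp: insert_absorb)
      then show "c T * (\<Prod>j\<in>insert i T. of_bool (x j)) = of_bool (x i) * (c T * (\<Prod>j\<in>T. of_bool (x j)))" by simp
    qed
    finally show ?thesis by (simp add: poly_eval_def sum_distrib_left)
  qed
  moreover have "S \<subseteq> {1..N} \<and> card S \<le> Suc d" if S: "e S \<noteq> 0" for S
  proof -
    obtain T where T: "T \<in> Pow {1..N}" "insert i T = S" "c T \<noteq> 0"
      using S unfolding e_def by (auto elim: sum.not_neutral_contains_not_neutral)
    then have "finite T" using finite_subset by auto
    then show ?thesis using T c(1)[rule_format, of T] i by (auto simp: card_insert_if)
  qed
  ultimately show ?thesis
    unfolding degree_le_def using c(2) by (intro exI[of _ e]) simp
qed

lemma degree_le_mono: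
  assumes "degree_le N X F d" "d \<le> d'"
  shows "degree_le N X F d'"
proof -
  obtain c where c: "\<forall>S. c S \<noteq> 0 \<longrightarrow> S \<subseteq> {1..N} \<and> card S \<le> d" "\<forall>x\<in>X. poly_eval N c x = F x"
    by (rule degree_leE[OF assms(1)])
  show ?thesis by (rule degree_leI[OF _ c(2)[rule_format]]) (use c(1) assms(2) le_trans in blast)+
qed

lemma degree_le_dtree:
  assumes "dt_queries t \<subseteq> {1..N}" "\<And>x. x \<in> X \<Longrightarrow> dt_cost t x \<le> d"
  shows "degree_le N X (\<lambda>x. of_bool (dt_eval t x)) d"
  using assms
proof (induction t arbitrary: X d)
  case (Answer b)
  then show ?case using degree_le_zero degree_le_one by (cases b) auto
next
  case (Query i t0 t1)
  show ?case
  proof (cases "X = {}")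
    case True
    then show ?thesis by (simp add: degree_le_def) (rule exI[of _ "\<lambda>_. 0"], simp)
  next
    case False
    then obtain x where "x \<in> X" by blast
    from Query.prems(2)[OF this] obtain d' where d: "d = Suc d'" by (cases d) auto
    have 0: "degree_le N {x\<in>X. \<not> x i} (\<lambda>x. of_bool (dt_eval t0 x)) d'"
      by (rule Query.IH) (use Query.prems d in force)+
    have 1: "degree_le N {x\<in>X. x i} (\<lambda>x. of_bool (dt_eval t1 x)) d'"
      by (rule Query.IH) (use Query.prems d in force)+
    obtain c0 where c0: "\<forall>S. c0 S \<noteq> 0 \<longrightarrow> S \<subseteq> {1..N} \<and> card S \<le> d'"
      "\<forall>x\<in>{x\<in>X. \<not> x i}. poly_eval N c0 x = of_bool (dt_eval t0 x)"
      by (rule degree_leE[OF 0])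
    obtain c1 where c1: "\<forall>S. c1 S \<noteq> 0 \<longrightarrow> S \<subseteq> {1..N} \<and> card S \<le> d'"
      "\<forall>x\<in>{x\<in>X. x i}. poly_eval N c1 x = of_bool (dt_eval t1 x)"
      by (rule degree_leE[OF 1])
    \<comment> \<open>The polynomials of the subtrees match only on their own halves of
      \<open>X\<close>; elsewhere the factor \<open>x i\<close> or \<open>1 - x i\<close> removes
      them.\<close>
    have p0: "degree_le N X (poly_eval N c0) d'" and p1: "degree_le N X (poly_eval N c1) d'"
      by (rule degree_leI[OF c0(1)[rule_format]], simp_all, rule degree_leI[OF c1(1)[rule_format]], simp_all)
    have "degree_le N X (\<lambda>x. poly_eval N c0 x + 1 * (of_bool (x i) * (poly_eval N c1 x + (-1) * poly_eval N c0 x))) d"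
      unfolding d using Query.prems(1)
      by (intro degree_le_lin degree_le_mult_var p0 p1 degree_le_mono[OF p0]) auto
    moreover have "poly_eval N c0 x + 1 * (of_bool (x i) * (poly_eval N c1 x + (-1) * poly_eval N c0 x)) =
        of_bool (dt_eval (Query i t0 t1) x)" if "x \<in> X" for x
      using c0(2) c1(2) that by (cases "x i") auto
    ultimately show ?thesis unfolding degree_le_def by simp
  qed
qed

lemma multilinear_degree_le:
  assumes "degree_le N (cube N) (\<lambda>x. of_bool (f x)) d"
  shows "multilinear_degree N f \<le> d"
proof -
  obtain c where c: "\<forall>S. c S \<noteq> 0 \<longrightarrow> S \<subseteq> {1..N} \<and> card S \<le> d" "\<forall>x\<in>cube N. poly_eval N c x = of_bool (f x)"
    by (rule degree_leE[OF assms])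
  have "represents N f c"
    unfolding represents_def
  proof (intro conjI allI impI ballI)
    fix S assume "\<not> S \<subseteq> {1..N}"
    then show "c S = 0" using c(1)[rule_format, of S] by argo
  next
    fix x assume "x \<in> cube N"
    with c(2) have "poly_eval N c x = of_bool (f x)" by (rule bspec)
    then show "(\<Sum>S\<in>Pow {1..N}. c S * (\<Prod>i\<in>S. of_bool (x i))) = of_bool (f x)"
      unfolding poly_eval_def .
  qed
  then have THE_c: "(THE c. represents N f c) = c" using ex1_represents by (rule the1_equality[rotated])
  have "{S. c S \<noteq> 0} \<subseteq> Pow {1..N}" using c(1) by blast
  then have "finite {S. c S \<noteq> 0}" by (rule finite_subset) simp
  then show ?thesis
    using c(1) by (auto simp: multilinear_degree_def THE_c Let_def)
qed

lemma multilinear_degree_le_sum: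
  assumes "finite B" and dt: "\<And>b. b \<in> B \<Longrightarrow> dt_bound N (cube N) (g b) (\<lambda>_. real d)"
    and f: "\<And>x. x \<in> cube N \<Longrightarrow> f x \<longleftrightarrow> (\<exists>b\<in>B. g b x)"
    and unique: "\<And>x b b'. x \<in> cube N \<Longrightarrow> b \<in> B \<Longrightarrow> b' \<in> B \<Longrightarrow> g b x \<Longrightarrow> g b' x \<Longrightarrow> b = b'"
  shows "multilinear_degree N f \<le> d"
proof (rule multilinear_degree_le)
  have "degree_le N (cube N) (\<lambda>x. of_bool (g b x)) d" if b: "b \<in> B" for b
  proof -
    obtain t where t: "dt_queries t \<subseteq> {1..N}" "\<And>x. x \<in> cube N \<Longrightarrow> dt_eval t x = g b x \<and> real (dt_cost t x) \<le> d"
      using dt[OF b] unfolding dt_bound_def by blast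
    then have "degree_le N (cube N) (\<lambda>x. of_bool (dt_eval t x)) d" by (intro degree_le_dtree) auto
    then show ?thesis using t(2) by (simp add: degree_le_def)
  qed
  then have *: "degree_le N (cube N) (\<lambda>x. \<Sum>b\<in>B. of_bool (g b x)) d" by (intro degree_le_sum assms(1))
  have "(\<Sum>b\<in>B. of_bool (g b x)) = (of_bool (f x) :: real)" if x: "x \<in> cube N" for x
  proof (cases "f x")
    case True
    then obtain b where b: "b \<in> B" "g b x" using f[OF x] by blast
    have eq: "g b' x \<longleftrightarrow> b' = b" if b': "b' \<in> B" for b'
    proof
      show "b' = b" if "g b' x" by (rule unique[OF x b' b(1) that b(2)])
    qed (use b(2) in simp)
    have "(\<Sum>b'\<in>B. of_bool (g b' x)) = (\<Sum>b'\<in>B. if b' = b then 1 else (0 :: real))"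
      by (rule sum.cong[OF refl]) (simp add: eq)
    then show ?thesis using b assms(1) True by simp
  next
    case False
    then show ?thesis using f[OF x] by auto
  qed
  with * show "degree_le N (cube N) (\<lambda>x. of_bool (f x)) d" by (simp add: degree_le_def)
qed

section \<open>Averaging over random samples\<close>

lemma zero_error_query_complexity_le:
  fixes \<Omega> :: "'w set" and V :: real
  assumes \<Omega>: "finite \<Omega>" "\<Omega> \<noteq> {}"
    and dt: "\<And>\<omega>. \<omega> \<in> \<Omega> \<Longrightarrow> dt_bound N (cube N) f (\<phi> \<omega>)"
    and \<phi>: "\<And>x. x \<in> cube N \<Longrightarrow> (\<Sum>\<omega>\<in>\<Omega>. \<phi> \<omega> x) \<le> card \<Omega> * V" and V: "V \<ge> 0"
  shows "zero_error_query_complexity N f \<le> V"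
proof -
  obtain t where t: "\<And>\<omega>. \<omega> \<in> \<Omega> \<Longrightarrow> dt_computes N f (t \<omega>)"
    "\<And>\<omega> x. \<omega> \<in> \<Omega> \<Longrightarrow> x \<in> cube N \<Longrightarrow> real (dt_cost (t \<omega>) x) \<le> \<phi> \<omega> x"
    using dt unfolding dt_bound_def dt_computes_def by metis
  define P where "P = map_pmf t (pmf_of_set \<Omega>)"
  have "P \<in> {P. \<forall>t\<in>set_pmf P. dt_computes N f t}"
    using t(1) \<Omega> by (simp add: P_def set_pmf_of_set)
  moreover have "(SUP x\<in>cube N. \<integral>\<^sup>+ t. of_nat (dt_cost t x) \<partial>measure_pmf P) \<le> ennreal V"
  proof (rule SUP_least)
    fix x assume x: "x \<in> cube N"
    have "(\<integral>\<^sup>+ t. of_nat (dt_cost t x) \<partial>measure_pmf P) =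
        (\<Sum>\<omega>\<in>\<Omega>. of_nat (dt_cost (t \<omega>) x)) / of_nat (card \<Omega>)"
      using \<Omega> by (simp add: P_def nn_integral_map_pmf nn_integral_pmf_of_set)
    also have "\<dots> = ennreal ((\<Sum>\<omega>\<in>\<Omega>. real (dt_cost (t \<omega>) x)) / card \<Omega>)"
      using \<Omega> by (simp add: ennreal_of_nat_eq_real_of_nat sum_nonneg divide_ennreal card_gt_0_iff)
    also have "\<dots> \<le> ennreal V"
    proof (rule ennreal_leI)
      have "(\<Sum>\<omega>\<in>\<Omega>. real (dt_cost (t \<omega>) x)) \<le> (\<Sum>\<omega>\<in>\<Omega>. \<phi> \<omega> x)" using t(2) x by (intro sum_mono) auto
      also have "\<dots> \<le> card \<Omega> * V" by (rule \<phi>[OF x])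
      finally show "(\<Sum>\<omega>\<in>\<Omega>. real (dt_cost (t \<omega>) x)) / card \<Omega> \<le> V"
        using \<Omega> by (simp add: divide_le_eq card_gt_0_iff mult.commute)
    qed
    finally show "(\<integral>\<^sup>+ t. of_nat (dt_cost t x) \<partial>measure_pmf P) \<le> ennreal V" .
  qed
  ultimately have "(INF P \<in> {P :: dtree pmf. \<forall>t\<in>set_pmf P. dt_computes N f t}.
       SUP x\<in>cube N. \<integral>\<^sup>+ t. of_nat (dt_cost t x) \<partial>measure_pmf P) \<le> ennreal V"
    by (rule INF_lower2)
  then show ?thesis
    unfolding zero_error_query_complexity_def by (intro enn2real_leI V)
qed

lemma one_minus_inverse_power_le: "q \<ge> 1 \<Longrightarrow> (1 - 1 / real q) ^ q \<le> 1 / 2"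
proof -
  assume q: "q \<ge> 1"
  have "(1 - 1 / real q) ^ q \<le> exp (- 1 / real q) ^ q"
    using q exp_ge_add_one_self[of "- 1 / real q"] by (intro power_mono) auto
  also have "\<dots> = exp (- 1)" using q by (simp flip: exp_of_nat_mult)
  also have "\<dots> \<le> 1 / 2" using exp_ge_add_one_self[of 1] by (simp add: exp_minus field_simps)
  finally show ?thesis .
qed

text \<open>A set of density at least 1/q is missed by \<open>l * q\<close> independent uniform rows
  with probability at most (1 - 1/q)^(l q), hence at most 2^-l; this is stated by counting.\<close>

lemma card_PiE_avoiding:
  assumes Z: "Z \<subseteq> {..<n}" and big: "n \<le> card Z * q" and q: "q \<ge> 1" and m: "m = l * q" "m \<le> M" and n: "n > 0"
  shows "real (card {\<omega> \<in> {..<M} \<rightarrow>\<^sub>E {..<n}. \<forall>t<m. \<omega> t \<notin> Z}) * 2 ^ l \<le> real n ^ M"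
proof -
  have "{\<omega> \<in> {..<M} \<rightarrow>\<^sub>E {..<n}. \<forall>t<m. \<omega> t \<notin> Z} = (\<Pi>\<^sub>E t\<in>{..<M}. if t < m then {..<n} - Z else {..<n})"
    (is "?A = Pi\<^sub>E _ ?B")
  proof (intro equalityI subsetI)
    fix \<omega> assume "\<omega> \<in> ?A"
    then have \<omega>: "\<omega> \<in> {..<M} \<rightarrow>\<^sub>E {..<n}" "\<And>t. t < m \<Longrightarrow> \<omega> t \<notin> Z" by auto
    show "\<omega> \<in> Pi\<^sub>E {..<M} ?B"
    proof (rule PiE_I)
      show "\<omega> t \<in> ?B t" if "t \<in> {..<M}" for t using PiE_mem[OF \<omega>(1) that] \<omega>(2)[of t] by simp
      show "\<omega> t = undefined" if "t \<notin> {..<M}" for t using PiE_arb[OF \<omega>(1) that] .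
    qed
  next
    fix \<omega> assume \<omega>: "\<omega> \<in> Pi\<^sub>E {..<M} ?B"
    have "\<omega> \<in> {..<M} \<rightarrow>\<^sub>E {..<n}"
    proof (rule PiE_I)
      show "\<omega> t \<in> {..<n}" if "t \<in> {..<M}" for t using PiE_mem[OF \<omega> that] by (auto split: if_splits)
      show "\<omega> t = undefined" if "t \<notin> {..<M}" for t using PiE_arb[OF \<omega> that] .
    qed
    moreover have "\<omega> t \<notin> Z" if "t < m" for t using PiE_mem[OF \<omega>, of t] that m(2) by simp
    ultimately show "\<omega> \<in> ?A" by simp
  qed
  then have "card {\<omega> \<in> {..<M} \<rightarrow>\<^sub>E {..<n}. \<forall>t<m. \<omega> t \<notin> Z} = (\<Prod>t<M. card (if t < m then {..<n} - Z else {..<n}))"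
    by (simp add: card_PiE)
  also have "\<dots> = (\<Prod>t<M. if t < m then n - card Z else n)"
    using Z by (intro prod.cong) (auto simp: card_Diff_subset finite_subset)
  also have "\<dots> = (n - card Z) ^ m * n ^ (M - m)"
  proof -
    have "{..<M} \<inter> {t. t < m} = {..<m}" "{..<M} \<inter> - {t. t < m} = {m..<M}" using m(2) by auto
    then show ?thesis by (simp add: prod.If_cases)
  qed
  finally have card: "card {\<omega> \<in> {..<M} \<rightarrow>\<^sub>E {..<n}. \<forall>t<m. \<omega> t \<notin> Z} = (n - card Z) ^ m * n ^ (M - m)" .
  have Zn: "card Z \<le> n" using card_mono[OF _ Z] by simp
  have "real (n - card Z) \<le> real n * (1 - 1 / real q)"
  proof -
    have "real n \<le> real (card Z) * real q" using big by (metis of_nat_le_iff of_nat_mult)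
    then have "real n / real q \<le> real (card Z)" using q by (simp add: field_simps)
    then show ?thesis using Zn by (simp add: of_nat_diff algebra_simps)
  qed
  then have "real (n - card Z) ^ m \<le> (real n * (1 - 1 / real q)) ^ m" by (intro power_mono) auto
  also have "\<dots> = real n ^ m * ((1 - 1 / real q) ^ q) ^ l"
    by (simp add: power_mult_distrib m(1) mult.commute flip: power_mult)
  also have "\<dots> \<le> real n ^ m * (1 / 2) ^ l"
    using q one_minus_inverse_power_le[OF q] by (intro mult_left_mono power_mono) auto
  finally have "real (n - card Z) ^ m * 2 ^ l \<le> real n ^ m * (1 / 2) ^ l * 2 ^ l" by (intro mult_right_mono) auto
  also have "\<dots> = real n ^ m" by (simp add: power_one_over)
  finally have "real (n - card Z) ^ m * 2 ^ l * real n ^ (M - m) \<le> real n ^ m * real n ^ (M - m)"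
    by (intro mult_right_mono) auto
  then show ?thesis using m(2) by (simp add: card mult_ac flip: power_add)
qed

section \<open>Conclusion\<close>

text \<open>
  The last sample is the whole column, so that the search is correct for every \<open>\<omega>\<close>; only its cost
  depends on whether \<open>\<omega>\<close> is good.
\<close>

definition samples :: "nat \<Rightarrow> nat \<Rightarrow> (nat \<Rightarrow> nat) \<Rightarrow> nat \<Rightarrow> (nat \<times> (nat \<Rightarrow> nat)) list" where
  "samples L l \<omega> k = map (\<lambda>j. (l * 2 ^ j, \<omega>)) [k..<L] @ [(2 ^ L, \<lambda>t. t)]"

text \<open>Columns with at least n / 2^k zeros must be caught by the first \<open>l * 2 ^ k\<close>
  rows. All columns are treated at once because the column in which a phase starts depends on the
  sample; this also allows all phases to use prefixes of one \<open>\<omega>\<close>.\<close>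

definition good :: "nat \<Rightarrow> nat \<Rightarrow> (nat \<Rightarrow> content) \<Rightarrow> (nat \<Rightarrow> nat) \<Rightarrow> bool" where
  "good L l \<gamma> \<omega> \<longleftrightarrow> (\<forall>c<2 ^ L. \<forall>k<L. 2 ^ L \<le> zeros L \<gamma> c * 2 ^ k \<longrightarrow>
     (\<exists>t<l * 2 ^ k. ty (\<gamma> (\<omega> t * 2 ^ L + c)) = 0))"

text \<open>The column of the phase with sample size \<open>l * 2 ^ k\<close> has survived half that
  sample and so has at most n / 2^(k-1) zeros: samples grow as fast as the zeros get rarer.\<close>

lemma cheap_samples:
  assumes \<gamma>: "\<And>z. \<gamma> z \<in> contents L" and l: "l \<ge> 1" and good: "good L l \<gamma> \<omega>"
  shows "1 \<le> k \<Longrightarrow> k \<le> L \<Longrightarrow> c < 2 ^ L \<Longrightarrow> zeros L \<gamma> c * 2 ^ (k - 1) \<le> 2 ^ L \<Longrightarrow> cheap L l (samples L l \<omega> k) \<gamma> c"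
proof (induction "L - k" arbitrary: k c)
  case 0
  then have k: "k = L" by simp
  then have "zeros L \<gamma> c * 2 ^ L = zeros L \<gamma> c * 2 ^ (k - 1) * 2"
    using 0 by (cases L) auto
  also have "\<dots> \<le> 2 ^ L * 2" using 0 by (intro mult_right_mono) auto
  also have "\<dots> \<le> 2 * 2 ^ L * l" using l by simp
  finally have le: "zeros L \<gamma> c * 2 ^ L \<le> 2 * 2 ^ L * l" .
  have s: "samples L l \<omega> k = [(2 ^ L, \<lambda>t. t)]" by (simp add: k samples_def)
  show ?case unfolding s using le by (simp only: cheap.simps fst_conv simp_thms)
next
  case (Suc m)
  then have k: "k < L" by simp
  then have s: "samples L l \<omega> k = (l * 2 ^ k, \<omega>) # samples L l \<omega> (Suc k)"
    by (simp add: samples_def upt_conv_Cons)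
  have "zeros L \<gamma> c * (l * 2 ^ k) = zeros L \<gamma> c * 2 ^ (k - 1) * (2 * l)"
    using Suc.prems(1) by (cases k) auto
  also have "\<dots> \<le> 2 ^ L * (2 * l)" using Suc.prems by (intro mult_right_mono) auto
  also have "\<dots> = 2 * 2 ^ L * l" by (simp only: mult_ac)
  finally have 1: "zeros L \<gamma> c * (l * 2 ^ k) \<le> 2 * 2 ^ L * l" .
  have "cheap L l (samples L l \<omega> (Suc k)) \<gamma> (target L \<gamma> c u)"
    if "u < 2 ^ L" "marked L (l * 2 ^ k, \<omega>) \<gamma> c u" for u
  proof (rule Suc.hyps(1))
    show "m = L - Suc k" using Suc.hyps(2) by simp
    show lt: "target L \<gamma> c u < 2 ^ L" by (rule target_less[OF \<gamma> Suc.prems(3)])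
    have "\<not> (\<exists>t<l * 2 ^ k. ty (\<gamma> (\<omega> t * 2 ^ L + target L \<gamma> c u)) = 0)"
      using that(2) by (simp add: marked_def survives_def)
    with good lt k have "\<not> 2 ^ L \<le> zeros L \<gamma> (target L \<gamma> c u) * 2 ^ k"
      unfolding good_def by blast
    then show "zeros L \<gamma> (target L \<gamma> c u) * 2 ^ (Suc k - 1) \<le> 2 ^ L" by simp
  qed (use k in auto)
  with 1 show ?case by (simp add: s)
qed

section \<open>Choice of parameters and asymptotics\<close>

lemma tilde_OmegaI:
  fixes p :: nat
  assumes "\<And>i. M i / 4 \<le> A i" "\<And>i. B i \<le> a * l i ^ p * M i" "\<And>i. M i \<ge> 0" "a > 0"
    and l: "\<And>i. 0 < l i" "\<And>i. l i \<le> ln (real (N i))"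
  shows "tilde_Omega N A B"
  unfolding tilde_Omega_def
proof (intro exI conjI always_eventually allI)
  show "1 / (4 * a) > 0" using \<open>a > 0\<close> by simp
  show "0 \<le> real p" by simp
  fix i
  have pos: "0 < ln (real (N i))" using l[of i] by linarith
  have "1 / (4 * a) * B i \<le> 1 / (4 * a) * (a * l i ^ p * M i)"
    using assms(2)[of i] \<open>a > 0\<close> by (intro mult_left_mono) auto
  also have "\<dots> = l i ^ p * (M i / 4)" using \<open>a > 0\<close> by simp
  also have "\<dots> \<le> ln (real (N i)) ^ p * A i"
    using l[of i] assms(1,3)[of i] pos by (intro mult_mono power_mono) auto
  also have "\<dots> = A i * ln (real (N i)) ^ p" by (rule mult.commute)
  finally show "1 / (4 * a) * B i / ln (real (N i)) powr real p \<le> A i"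
    unfolding powr_realpow[OF pos] pos_divide_le_eq[OF zero_less_power[OF pos]] .
qed

context pointer_function begin

lemma pointer_query_classical: "pointer_query L \<kappa> dec (dt_step N) {1}"
  by (intro pointer_query.intro pointer_function_axioms classical.query_model_axioms)

lemma pointer_query_quantum: "pointer_query L \<kappa> dec (adv_bound N) {0<..}"
  by (intro pointer_query.intro pointer_function_axioms quantum.query_model_axioms)

text \<open>With s the sample size and z the number of zeros, a phase costs at most n + 4 z s + 4 s
  cell reads. This is at most 13 n l when z s is at most 2 n l, and 9 n^2 l always.\<close>

lemma phase_cost_classical:
  assumes s: "s \<ge> 1" "s \<le> 2 ^ L * l" and z: "z \<le> 2 ^ L"
  shows "phase_cost 1 1 1 s z \<le>
    (if z * s \<le> 2 * 2 ^ L * l then 13 * 2 ^ L * real l * K else 9 * 2 ^ L * 2 ^ L * real l * K)"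
proof -
  define n S Z l' where "n = (2 :: real) ^ L" and "S = real s" and "Z = real z" and "l' = real l"
  have n: "n \<ge> 1" by (simp add: n_def)
  have S: "S \<ge> 1" "S \<le> n * l'" using s(1) of_nat_mono[OF s(2), where ?'a = real] by (simp_all add: S_def n_def l'_def)
  have Z: "0 \<le> Z" "Z \<le> n" using of_nat_mono[OF z, where ?'a = real] by (simp_all add: Z_def n_def)
  have l': "l' \<ge> 1"
    using s by (cases l) (auto simp: l'_def)
  have "phase_cost 1 1 1 s z = (n + Z * (S + 3) + (S + 3)) * K"
    by (simp add: phase_cost_def mark_cost_def unit_cost_def n_def S_def Z_def algebra_simps)
  also have "\<dots> \<le> (n + 4 * (Z * S) + 4 * S) * K"
  proof (intro mult_right_mono add_mono)
    have "Z * (S + 3) \<le> Z * (4 * S)" using S Z by (intro mult_left_mono) auto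
    then show "Z * (S + 3) \<le> 4 * (Z * S)" by simp
  qed (use S in auto)
  finally have *: "phase_cost 1 1 1 s z \<le> (n + 4 * (Z * S) + 4 * S) * K" .
  have nl: "n \<le> n * l'" using n l' by simp
  show ?thesis
  proof (cases "z * s \<le> 2 * 2 ^ L * l")
    case True
    then have "Z * S \<le> 2 * (n * l')"
      using of_nat_mono[OF True, where ?'a = real] by (simp add: Z_def S_def n_def l'_def)
    then have "n + 4 * (Z * S) + 4 * S \<le> 13 * (n * l')" using S nl by simp
    then have "(n + 4 * (Z * S) + 4 * S) * K \<le> 13 * (n * l') * K" by (intro mult_right_mono) auto
    with * True show ?thesis by (simp add: n_def l'_def mult.assoc)
  next
    case False
    have "Z * S \<le> n * (n * l')" using Z S by (intro mult_mono) auto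
    moreover have "n * l' \<le> n * (n * l')" using n l' by simp
    ultimately have "n + 4 * (Z * S) + 4 * S \<le> 9 * (n * (n * l'))" using S nl by linarith
    then have "(n + 4 * (Z * S) + 4 * S) * K \<le> 9 * (n * (n * l')) * K" by (intro mult_right_mono) auto
    with * False show ?thesis by (simp add: n_def l'_def mult.assoc)
  qed
qed

text \<open>The weights equalise three terms. With \<open>w1\<close> and \<open>w2\<close> equal to
  1 / sqrt s, testing a zero costs about 3 sqrt s. With \<open>w\<close> equal to sqrt (s / n), the
  n zero tests then contribute sqrt n, the z tested zeros about z s / sqrt n, and the success term
  about sqrt n; the middle term is of order l sqrt n exactly when z s is of order n l.\<close>

lemma phase_cost_quantum:
  assumes s: "s \<ge> 1" "s \<le> 2 ^ L * l" and z: "z \<le> 2 ^ L"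
  shows "phase_cost (sqrt s / sqrt (2 ^ L)) (1 / sqrt s) (1 / sqrt s) s z \<le>
    (if z * s \<le> 2 * 2 ^ L * l then 13 * sqrt (2 ^ L) * real l * K else 9 * 2 ^ L * sqrt (2 ^ L) * real l * K)"
proof -
  define q r Z l' where "q = sqrt (2 ^ L)" and "r = sqrt (real s)" and "Z = real z" and "l' = real l"
  have q: "q \<ge> 1" "q * q = 2 ^ L" by (simp_all add: q_def)
  have r: "r \<ge> 1" "r * r = real s" using s(1) by (simp_all add: r_def)
  have S: "r * r \<le> q * q * l'" using of_nat_mono[OF s(2), where ?'a = real] by (simp add: r q l'_def)
  have Z: "0 \<le> Z" "Z \<le> q * q" using of_nat_mono[OF z, where ?'a = real] by (simp_all add: Z_def q)
  have l': "l' \<ge> 1"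
    using s by (cases l) (auto simp: l'_def)
  have E: "mark_cost (1 / r) (1 / r) s = (3 * r + 1) * K"
    using r(1) by (simp add: mark_cost_def unit_cost_def field_simps flip: r(2))
  have "phase_cost (r / q) (1 / r) (1 / r) s z = (q + (r / q) * Z * (3 * r + 1) + (3 * r + 1) * q / r) * K"
    using q(1) r(1) unfolding phase_cost_def E of_nat_power of_nat_numeral q(2)[symmetric] Z_def[symmetric]
    by (simp add: field_simps)
  also have "\<dots> \<le> (q + 4 * (Z * (r * r) / q) + 4 * q) * K"
  proof (intro mult_right_mono add_mono)
    have "(r / q) * Z * (3 * r + 1) \<le> (r / q) * Z * (4 * r)"
      using q r Z by (intro mult_left_mono) auto
    then show "(r / q) * Z * (3 * r + 1) \<le> 4 * (Z * (r * r) / q)" by (simp add: mult_ac)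
    have "(3 * r + 1) * q / r \<le> (4 * r) * q / r"
      using q r by (intro divide_right_mono mult_right_mono) auto
    then show "(3 * r + 1) * q / r \<le> 4 * q" using r by simp
  qed auto
  finally have *: "phase_cost (r / q) (1 / r) (1 / r) s z \<le> (q + 4 * (Z * (r * r) / q) + 4 * q) * K" .
  have ql: "q \<le> q * l'" using q l' by simp
  show ?thesis
  proof (cases "z * s \<le> 2 * 2 ^ L * l")
    case True
    then have "Z * (r * r) \<le> 2 * (q * l') * q"
      using of_nat_mono[OF True, where ?'a = real] by (simp add: Z_def r q l'_def mult_ac flip: q(2))
    then have "Z * (r * r) / q \<le> 2 * (q * l')" using q(1) by (simp add: divide_le_eq)
    then have "q + 4 * (Z * (r * r) / q) + 4 * q \<le> 13 * (q * l')" using ql by linarith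
    then have "(q + 4 * (Z * (r * r) / q) + 4 * q) * K \<le> 13 * (q * l') * K" by (intro mult_right_mono) auto
    with * True show ?thesis by (simp add: q_def r_def l'_def mult.assoc)
  next
    case False
    have "Z * (r * r) \<le> (q * q) * (q * q * l')" by (rule mult_mono) (use Z S in auto)
    then have "Z * (r * r) / q \<le> q * q * q * l'" using q(1) by (simp add: divide_le_eq mult_ac)
    moreover have "q * l' \<le> q * q * q * l'"
    proof -
      have "1 * (q * l') \<le> (q * q) * (q * l')" using q l' by (intro mult_right_mono) auto
      then show ?thesis by (simp add: mult_ac)
    qed
    ultimately have "q + 4 * (Z * (r * r) / q) + 4 * q \<le> 9 * (q * q * q * l')" using ql by linarith
    then have "(q + 4 * (Z * (r * r) / q) + 4 * q) * K \<le> 9 * (q * q * q * l') * K" by (intro mult_right_mono) auto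
    moreover have "9 * (q * q * q * l') * K = 9 * 2 ^ L * q * real l * K" by (simp add: q(2) l'_def)
    ultimately have "phase_cost (r / q) (1 / r) (1 / r) s z \<le> 9 * 2 ^ L * q * real l * K"
      using * by linarith
    then show ?thesis using False by (simp add: q_def r_def)
  qed
qed

text \<open>The factor \<open>5 * L\<close> makes a single dense column escape with probability at
  most n^-5; there are enough rows for every prefix \<open>5 * L * 2 ^ j\<close> with
  \<open>j < L\<close>.\<close>

definition \<Omega> :: "(nat \<Rightarrow> nat) set" where "\<Omega> = {..<5 * L * 2 ^ L} \<rightarrow>\<^sub>E {..<2 ^ L}"

lemma \<Omega>: "finite \<Omega>" "\<Omega> \<noteq> {}" "real (card \<Omega>) = (2 ^ L) ^ (5 * L * 2 ^ L)"
  by (auto simp: \<Omega>_def finite_PiE PiE_eq_empty_iff card_PiE lessThan_empty_iff)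

lemma samples_in_range:
  assumes "\<omega> \<in> \<Omega>" "\<sigma> \<in> set (samples L (5 * L) \<omega> 1)"
  shows "1 \<le> fst \<sigma>" "fst \<sigma> \<le> 2 ^ L * (5 * L)" "t < fst \<sigma> \<Longrightarrow> snd \<sigma> t < 2 ^ L"
proof -
  have \<sigma>: "\<sigma> = (2 ^ L, \<lambda>t. t) \<or> (\<exists>j<L. \<sigma> = (5 * L * 2 ^ j, \<omega>))"
    using assms(2) by (auto simp: samples_def)
  have le: "5 * L * 2 ^ j \<le> 5 * L * 2 ^ L" if "j < L" for j using that by (intro mult_left_mono power_increasing) auto
  show "1 \<le> fst \<sigma>" "fst \<sigma> \<le> 2 ^ L * (5 * L)" using \<sigma> le L_ge by (auto simp: mult.commute Suc_le_eq)
  show "snd \<sigma> t < 2 ^ L" if "t < fst \<sigma>"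
  proof -
    have "\<omega> t < 2 ^ L" if "t < 5 * L * 2 ^ j" "j < L" for j
    proof -
      have "t \<in> {..<5 * L * 2 ^ L}" using order_less_le_trans[OF that(1) le[OF that(2)]] by blast
      from PiE_mem[OF assms(1)[unfolded \<Omega>_def] this] show ?thesis by simp
    qed
    with that \<sigma> show ?thesis by auto
  qed
qed

lemma pursue_samples:
  assumes "\<omega> \<in> \<Omega>"
  shows "pursue L (samples L (5 * L) \<omega> 1) (cont x) 0 \<longleftrightarrow> f x"
proof
  show "f x" if "pursue L (samples L (5 * L) \<omega> 1) (cont x) 0"
    unfolding f_def by (rule pursue_sound[OF cont_range _ that]) simp
  assume "f x"
  then obtain b where b: "b < 2 ^ L" "cert L (cont x) b" by (auto simp: f_def pointer_value_def)
  show "pursue L (samples L (5 * L) \<omega> 1) (cont x) 0"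
  proof (rule pursue_complete[OF cont_range b])
    show "\<forall>\<sigma>\<in>set (samples L (5 * L) \<omega> 1). \<forall>t<fst \<sigma>. snd \<sigma> t < 2 ^ L"
      using samples_in_range(3)[OF assms] by blast
  qed (auto simp: samples_def)
qed

text \<open>The samples start with exponent 1, where the condition on the start column says only
  that it has at most \<open>2 ^ L\<close> zeros.\<close>

lemma cheap_of_good:
  assumes "good L (5 * L) (cont x) \<omega>"
  shows "cheap L (5 * L) (samples L (5 * L) \<omega> 1) (cont x) 0"
  using L_ge by (intro cheap_samples[OF cont_range _ assms]) (auto simp: zeros_def intro: order_trans[OF card_mono[of "{..<2 ^ L}"]])

lemma length_samples: "length (samples L l \<omega> 1) = L"
  using L_ge by (simp add: samples_def)

text \<open>Sums the \<open>L\<close> phases and the final check: 65 is 13 times the factor 5 of the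
  sample size, and \<open>\<tau>\<close> stands for sqrt n, n or, for a bad sample, n^2.\<close>

lemma total_cost_le:
  fixes \<tau> D U :: real
  assumes \<tau>: "\<tau> \<ge> 1" and D: "D \<le> 65 * \<tau> * real L * K" and U: "U \<le> 2 * \<tau> * K"
  shows "L * (D + K) + (real L + 4) * U \<le> 80 * real L ^ 2 * \<tau> * K"
proof -
  have L: "real L \<ge> 2" using L_ge by simp
  define k where "k = \<tau> * K"
  have k: "k \<ge> 0" "real K \<le> k" using \<tau> by (simp_all add: k_def mult_right_mono[of 1 \<tau> K, simplified])
  have "L * (D + K) \<le> real L * (65 * k * real L + k)"
    using D k(2) by (intro mult_left_mono) (auto simp: k_def mult_ac)
  moreover have "(real L + 4) * U \<le> (3 * real L) * (2 * k)"
    using U L k by (intro order_trans[OF mult_left_mono[OF U] mult_mono]) (auto simp: k_def)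
  moreover have "real L * k \<le> real L * (real L * k)" using L k(1) by (intro mult_left_mono) (auto simp: mult_le_cancel_right1)
  ultimately have "L * (D + K) + (real L + 4) * U \<le> 65 * (real L * (real L * k)) + 7 * (real L * (real L * k))"
    by (simp add: algebra_simps)
  also have "\<dots> \<le> 80 * (real L * (real L * k))" using k(1) by simp
  finally show ?thesis by (simp add: k_def power2_eq_square mult_ac)
qed

lemma classical_cost:
  assumes \<omega>: "\<omega> \<in> \<Omega>"
  shows "dt_bound N (cube N) f
    (\<lambda>x. 80 * real L ^ 2 * (if good L (5 * L) (cont x) \<omega> then 2 ^ L else 2 ^ L * 2 ^ L) * K)"
proof -
  interpret Q: pointer_query L \<kappa> dec "dt_step N" "{1}" by (rule pointer_query_classical)
  define A where "A = 13 * 2 ^ L * real (5 * L) * K"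
  define B where "B = 9 * 2 ^ L * 2 ^ L * real (5 * L) * K"
  have one: "(1 :: real) \<le> 2 ^ L" by simp
  have AB: "0 \<le> A" "A \<le> B"
  proof -
    have "(13 :: real) \<le> 9 * 2 ^ L" using power_increasing[OF L_ge, of "2 :: real"] by simp
    then have "13 * (2 ^ L * real (5 * L) * K) \<le> 9 * 2 ^ L * (2 ^ L * real (5 * L) * K)"
      by (intro mult_right_mono) auto
    then show "A \<le> B" by (simp add: A_def B_def mult_ac)
  qed (simp add: A_def)
  have "dt_step N (cube N) (\<lambda>x. of_bool (pursue L (samples L (5 * L) \<omega> 1) (cont x) 0))
    (\<lambda>x. length (samples L (5 * L) \<omega> 1) * ((if cheap L (5 * L) (samples L (5 * L) \<omega> 1) (cont x) 0 then A else B) + K)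
       + (real L + 4) * unit_cost 1 (2 ^ L))"
  proof (rule Q.pursue_query[OF _ AB])
    fix \<sigma> assume \<sigma>: "\<sigma> \<in> set (samples L (5 * L) \<omega> 1)"
    show "\<exists>w\<in>{1}. \<exists>w1\<in>{1}. \<exists>w2\<in>{1}. \<forall>z\<le>2 ^ L. phase_cost w w1 w2 (fst \<sigma>) z \<le>
        (if z * fst \<sigma> \<le> 2 * 2 ^ L * (5 * L) then A else B)"
    proof (intro bexI[of _ 1] allI impI)
      show "phase_cost 1 1 1 (fst \<sigma>) z \<le> (if z * fst \<sigma> \<le> 2 * 2 ^ L * (5 * L) then A else B)" if "z \<le> 2 ^ L" for z
        unfolding A_def B_def by (rule phase_cost_classical[OF samples_in_range(1,2)[OF \<omega> \<sigma>] that])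
    qed auto
  qed (use samples_in_range(3)[OF \<omega>] in auto)
  from dt_bound_of_step[OF this]
  have *: "dt_bound N (cube N) f (\<lambda>x. L * ((if cheap L (5 * L) (samples L (5 * L) \<omega> 1) (cont x) 0 then A else B) + K)
       + (real L + 4) * unit_cost 1 (2 ^ L))"
    unfolding pursue_samples[OF \<omega>] length_samples by simp
  show ?thesis
  proof (rule dt_bound_mono[OF * subset_refl])
    fix x
    have U: "unit_cost 1 (2 ^ L) \<le> 2 * 2 ^ L * real K" "unit_cost 1 (2 ^ L) \<le> 2 * (2 ^ L * 2 ^ L) * real K"
    proof -
      have "(2 ^ L + 1) * real K \<le> (2 * 2 ^ L) * real K" by (intro mult_right_mono) auto
      then show 1: "unit_cost 1 (2 ^ L) \<le> 2 * 2 ^ L * real K" by (simp add: unit_cost_def)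
      have "2 * 2 ^ L * real K \<le> 2 * (2 ^ L * 2 ^ L) * real K" by (intro mult_right_mono) auto
      with 1 show "unit_cost 1 (2 ^ L) \<le> 2 * (2 ^ L * 2 ^ L) * real K" by linarith
    qed
    have A: "A \<le> 65 * 2 ^ L * real L * K" by (simp add: A_def)
    have B: "B \<le> 65 * (2 ^ L * 2 ^ L) * real L * K"
    proof -
      have "45 * (2 ^ L * 2 ^ L * real L * K) \<le> 65 * (2 ^ L * 2 ^ L * real L * K)" by (intro mult_right_mono) auto
      then show ?thesis by (simp add: B_def mult_ac)
    qed
    have one2: "(1 :: real) \<le> 2 ^ L * 2 ^ L" using mult_mono[OF one one] by simp
    show "L * ((if cheap L (5 * L) (samples L (5 * L) \<omega> 1) (cont x) 0 then A else B) + K)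
       + (real L + 4) * unit_cost 1 (2 ^ L) \<le>
        80 * real L ^ 2 * (if good L (5 * L) (cont x) \<omega> then 2 ^ L else 2 ^ L * 2 ^ L) * K"
    proof (cases "good L (5 * L) (cont x) \<omega>")
      case True
      then show ?thesis using cheap_of_good[OF True] total_cost_le[OF one A U(1)] by simp
    next
      case False
      have "(if cheap L (5 * L) (samples L (5 * L) \<omega> 1) (cont x) 0 then A else B) \<le> 65 * (2 ^ L * 2 ^ L) * real L * K"
        using AB B by auto
      from total_cost_le[OF one2 this U(2)] False show ?thesis by simp
    qed
  qed
qed

text \<open>The domain is cut down to the inputs for which \<open>\<omega>\<close> is good; on the
  others the general bound of a phase is larger by a factor of order n.\<close>

lemma quantum_cost:
  assumes \<omega>: "\<omega> \<in> \<Omega>"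
  shows "adv_bound N {x\<in>cube N. good L (5 * L) (cont x) \<omega>} (\<lambda>x. of_bool (f x))
    (\<lambda>_. 80 * real L ^ 2 * sqrt (2 ^ L) * K)"
proof -
  interpret Q: pointer_query L \<kappa> dec "adv_bound N" "{0<..}" by (rule pointer_query_quantum)
  let ?X = "{x\<in>cube N. good L (5 * L) (cont x) \<omega>}"
  define A where "A = 13 * sqrt (2 ^ L) * real (5 * L) * K"
  define B where "B = 9 * 2 ^ L * sqrt (2 ^ L) * real (5 * L) * K"
  have one: "1 \<le> sqrt (2 ^ L)" by simp
  have AB: "0 \<le> A" "A \<le> B"
  proof -
    have "(13 :: real) \<le> 9 * 2 ^ L" using power_increasing[OF L_ge, of "2 :: real"] by simp
    then have "13 * (sqrt (2 ^ L) * real (5 * L) * K) \<le> 9 * 2 ^ L * (sqrt (2 ^ L) * real (5 * L) * K)"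
      by (intro mult_right_mono) auto
    then show "A \<le> B" by (simp add: A_def B_def mult_ac)
  qed (simp add: A_def)
  have "adv_bound N ?X (\<lambda>x. of_bool (pursue L (samples L (5 * L) \<omega> 1) (cont x) 0))
    (\<lambda>x. length (samples L (5 * L) \<omega> 1) * ((if cheap L (5 * L) (samples L (5 * L) \<omega> 1) (cont x) 0 then A else B) + K)
       + (real L + 4) * unit_cost (1 / sqrt (2 ^ L)) (2 ^ L))"
  proof (rule Q.pursue_query[OF _ AB])
    fix \<sigma> assume \<sigma>: "\<sigma> \<in> set (samples L (5 * L) \<omega> 1)"
    have s: "1 \<le> fst \<sigma>" "fst \<sigma> \<le> 2 ^ L * (5 * L)" by (rule samples_in_range[OF \<omega> \<sigma>])+
    show "\<exists>w\<in>{0<..}. \<exists>w1\<in>{0<..}. \<exists>w2\<in>{0<..}. \<forall>z\<le>2 ^ L. phase_cost w w1 w2 (fst \<sigma>) z \<le>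
        (if z * fst \<sigma> \<le> 2 * 2 ^ L * (5 * L) then A else B)"
    proof (rule bexI[of _ "sqrt (fst \<sigma>) / sqrt (2 ^ L)"], rule bexI[of _ "1 / sqrt (fst \<sigma>)"],
        rule bexI[of _ "1 / sqrt (fst \<sigma>)"], intro allI impI)
      show "phase_cost (sqrt (fst \<sigma>) / sqrt (2 ^ L)) (1 / sqrt (fst \<sigma>)) (1 / sqrt (fst \<sigma>)) (fst \<sigma>) z \<le>
          (if z * fst \<sigma> \<le> 2 * 2 ^ L * (5 * L) then A else B)" if "z \<le> 2 ^ L" for z
        unfolding A_def B_def by (rule phase_cost_quantum[OF s that])
    qed (use s(1) in auto)
  qed (use samples_in_range(3)[OF \<omega>] in auto)
  then have *: "adv_bound N ?X (\<lambda>x. of_bool (f x))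
    (\<lambda>x. L * ((if cheap L (5 * L) (samples L (5 * L) \<omega> 1) (cont x) 0 then A else B) + K)
       + (real L + 4) * unit_cost (1 / sqrt (2 ^ L)) (2 ^ L))"
    unfolding pursue_samples[OF \<omega>] length_samples .
  show ?thesis
  proof (rule quantum.cost_mono[OF * subset_refl])
    fix x assume "x \<in> ?X"
    then have "cheap L (5 * L) (samples L (5 * L) \<omega> 1) (cont x) 0" by (intro cheap_of_good) simp
    moreover have "A \<le> 65 * sqrt (2 ^ L) * real L * K" by (simp add: A_def)
    moreover have "unit_cost (1 / sqrt (2 ^ L)) (2 ^ L) \<le> 2 * sqrt (2 ^ L) * K"
      by (simp add: unit_cost_def real_div_sqrt)
    ultimately show "L * ((if cheap L (5 * L) (samples L (5 * L) \<omega> 1) (cont x) 0 then A else B) + K)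
       + (real L + 4) * unit_cost (1 / sqrt (2 ^ L)) (2 ^ L) \<le> 80 * real L ^ 2 * sqrt (2 ^ L) * K"
      using total_cost_le[OF one] by simp
  qed
qed

text \<open>Union bound over at most n L, hence at most n^2, pairs of a column and a density, each
  failing with probability at most n^-5.\<close>

lemma card_bad:
  "real (card {\<omega>\<in>\<Omega>. \<not> good L (5 * L) (cont x) \<omega>}) * (2 ^ L) ^ 3 \<le> real (card \<Omega>)"
proof -
  define n where "n = (2 :: real) ^ L"
  define Z where "Z c = {u. u < 2 ^ L \<and> ty (cont x (u * 2 ^ L + c)) = 0}" for c
  define B where "B c k = {\<omega>\<in>\<Omega>. 2 ^ L \<le> zeros L (cont x) c * 2 ^ k \<and> (\<forall>t<5 * L * 2 ^ k. \<omega> t \<notin> Z c)}" for c k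
  have B: "real (card (B c k)) * 2 ^ (5 * L) \<le> real (card \<Omega>)" if "k < L" for c k
  proof (cases "2 ^ L \<le> zeros L (cont x) c * 2 ^ k")
    case True
    have "real (card {\<omega> \<in> {..<5 * L * 2 ^ L} \<rightarrow>\<^sub>E {..<2 ^ L}. \<forall>t<5 * L * 2 ^ k. \<omega> t \<notin> Z c}) * 2 ^ (5 * L)
        \<le> real (2 ^ L) ^ (5 * L * 2 ^ L)"
      by (rule card_PiE_avoiding[where q = "2 ^ k"])
        (use True that in \<open>auto simp: Z_def zeros_def intro!: mult_left_mono power_increasing\<close>)
    then show ?thesis using True by (simp add: B_def \<Omega>_def[symmetric] \<Omega>(3))
  next
    case False
    then show ?thesis by (simp add: B_def)
  qed
  have fin: "finite (B c k)" for c k using \<Omega>(1) by (simp add: B_def)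
  have "{\<omega>\<in>\<Omega>. \<not> good L (5 * L) (cont x) \<omega>} \<subseteq> (\<Union>c<2 ^ L. \<Union>k<L. B c k)"
  proof
    fix \<omega> assume "\<omega> \<in> {\<omega>\<in>\<Omega>. \<not> good L (5 * L) (cont x) \<omega>}"
    then have \<omega>: "\<omega> \<in> \<Omega>" "\<not> good L (5 * L) (cont x) \<omega>" by auto
    show "\<omega> \<in> (\<Union>c<2 ^ L. \<Union>k<L. B c k)"
    proof (rule ccontr)
      assume notin: "\<omega> \<notin> (\<Union>c<2 ^ L. \<Union>k<L. B c k)"
      have "good L (5 * L) (cont x) \<omega>"
        unfolding good_def
      proof (intro allI impI)
        fix c k assume ck: "c < 2 ^ L" "k < L" "2 ^ L \<le> zeros L (cont x) c * 2 ^ k"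
        show "\<exists>t<5 * L * 2 ^ k. ty (cont x (\<omega> t * 2 ^ L + c)) = 0"
        proof (rule ccontr)
          assume "\<not> ?thesis"
          then have "\<omega> \<in> B c k" using \<omega>(1) ck(3) by (simp add: B_def Z_def)
          moreover have "\<omega> \<notin> B c k" using notin ck(1,2) by simp
          ultimately show False by contradiction
        qed
      qed
      with \<omega>(2) show False by contradiction
    qed
  qed
  then have "card {\<omega>\<in>\<Omega>. \<not> good L (5 * L) (cont x) \<omega>} \<le> card (\<Union>c<2 ^ L. \<Union>k<L. B c k)"
    using fin by (intro card_mono) auto
  also have "\<dots> \<le> (\<Sum>c<2 ^ L. card (\<Union>k<L. B c k))" by (rule card_UN_le) simp
  also have "\<dots> \<le> (\<Sum>c<2 ^ L. \<Sum>k<L. card (B c k))" by (intro sum_mono card_UN_le) simp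
  finally have c: "card {\<omega>\<in>\<Omega>. \<not> good L (5 * L) (cont x) \<omega>} \<le> (\<Sum>c<(2 :: nat) ^ L. \<Sum>k<L. card (B c k))" .
  have "real (card {\<omega>\<in>\<Omega>. \<not> good L (5 * L) (cont x) \<omega>}) \<le> (\<Sum>c<(2 :: nat) ^ L. \<Sum>k<L. real (card (B c k)))"
    using of_nat_mono[OF c, where ?'a = real] by (simp only: of_nat_sum)
  then have "real (card {\<omega>\<in>\<Omega>. \<not> good L (5 * L) (cont x) \<omega>}) * 2 ^ (5 * L) \<le>
      (\<Sum>c<(2 :: nat) ^ L. \<Sum>k<L. real (card (B c k))) * 2 ^ (5 * L)" by (intro mult_right_mono) auto
  also have "\<dots> = (\<Sum>c<(2 :: nat) ^ L. \<Sum>k<L. real (card (B c k)) * 2 ^ (5 * L))"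
    by (simp add: sum_distrib_right)
  also have "\<dots> \<le> (\<Sum>c<(2 :: nat) ^ L. \<Sum>k<L. real (card \<Omega>))" by (intro sum_mono B) auto
  also have "\<dots> = n * L * card \<Omega>" by (simp add: n_def)
  also have "\<dots> \<le> n * n * card \<Omega>"
    using less_exp[of L] by (intro mult_right_mono mult_left_mono) (auto simp: n_def intro: less_imp_le)
  finally have "real (card {\<omega>\<in>\<Omega>. \<not> good L (5 * L) (cont x) \<omega>}) * n ^ 3 * (n * n) \<le> card \<Omega> * (n * n)"
    by (simp add: n_def power_mult mult.commute[of 5] power_numeral_reduce mult_ac)
  moreover have "n * n > 0" by (simp add: n_def)
  ultimately show ?thesis unfolding n_def by (meson mult_le_cancel_right_pos)
qed

lemma n_ge: "(4 :: real) \<le> 2 ^ L"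
  using power_increasing[OF L_ge, of "2 :: real"] by simp

lemma zero_error_bound: "zero_error_query_complexity N f \<le> 160 * real L ^ 2 * 2 ^ L * K"
proof (rule zero_error_query_complexity_le[OF \<Omega>(1,2) classical_cost])
  fix x
  define n where "n = (2 :: real) ^ L"
  define b where "b = real (card {\<omega>\<in>\<Omega>. \<not> good L (5 * L) (cont x) \<omega>})"
  define a where "a = 80 * real L ^ 2 * K"
  have n: "n \<ge> 4" using n_ge by (simp add: n_def)
  have "b * n \<le> b * n ^ 3"
    using n power_increasing[of 1 3 n] by (intro mult_left_mono) (auto simp: b_def)
  also have "\<dots> \<le> card \<Omega>" using card_bad[of x] by (simp add: b_def n_def)
  \<comment> \<open>Bad samples cost n times more than good ones, so a bad fraction of at most 1/n
    merely doubles the bound on the mean.\<close>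
  finally have bn: "b * n \<le> card \<Omega>" .
  have "(\<Sum>\<omega>\<in>\<Omega>. 80 * real L ^ 2 * (if good L (5 * L) (cont x) \<omega> then 2 ^ L else 2 ^ L * 2 ^ L) * K)
      \<le> (\<Sum>\<omega>\<in>\<Omega>. a * n + a * n * n * of_bool (\<not> good L (5 * L) (cont x) \<omega>))"
    using n by (intro sum_mono) (auto simp: a_def n_def)
  also have "\<dots> = card \<Omega> * (a * n) + a * n * (b * n)"
    using \<Omega>(1) by (simp add: sum.distrib b_def Int_def flip: sum_distrib_left)
  also have "\<dots> \<le> card \<Omega> * (a * n) + a * n * card \<Omega>"
    using bn n by (intro add_left_mono mult_left_mono) (auto simp: a_def)
  also have "\<dots> = card \<Omega> * (160 * real L ^ 2 * 2 ^ L * K)" by (simp add: a_def n_def algebra_simps)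
  finally show "(\<Sum>\<omega>\<in>\<Omega>. 80 * real L ^ 2 * (if good L (5 * L) (cont x) \<omega> then 2 ^ L else 2 ^ L * 2 ^ L) * K)
      \<le> card \<Omega> * (160 * real L ^ 2 * 2 ^ L * K)" .
qed auto

lemma quantum_bound: "real (quantum_query_complexity N f) \<le> 10 * (80 * real L ^ 2 * sqrt (2 ^ L) * K) + 1"
proof (rule quantum_query_complexity_le_adv_bound[OF _ \<Omega>(1,2) _ quantum_cost])
  show "1 \<le> N" by (simp add: N_power)
  have ge1: "1 \<le> a * b" if "1 \<le> a" "1 \<le> b" for a b :: real
    using mult_mono[OF that] that by simp
  show "1 \<le> 80 * real L ^ 2 * sqrt (2 ^ L) * real K"
    using L_ge by (intro ge1) (auto simp: K_def)
next
  fix x assume x: "x \<in> cube N"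
  define b where "b = real (card {\<omega>\<in>\<Omega>. \<not> good L (5 * L) (cont x) \<omega>})"
  have "8 \<le> (2 ^ L :: real) ^ 3" using power_mono[OF n_ge, of 3] by simp
  then have "b * 8 \<le> b * (2 ^ L) ^ 3" by (intro mult_left_mono) (auto simp: b_def)
  also have "\<dots> \<le> card \<Omega>" using card_bad[of x] by (simp add: b_def)
  finally have "8 * card {\<omega>\<in>\<Omega>. \<not> good L (5 * L) (cont x) \<omega>} \<le> card \<Omega>" unfolding b_def by linarith
  then show "8 * card {\<omega>\<in>\<Omega>. x \<notin> {x\<in>cube N. good L (5 * L) (cont x) \<omega>}} \<le> card \<Omega>" using x by simp
qed

lemma degree_bound: "multilinear_degree N f \<le> (L + 4) * (2 ^ L + 1) * K"
proof (rule multilinear_degree_le_sum[where B = "{..<2 ^ L}" and g = "\<lambda>b x. cert L (cont x) b"])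
  interpret Q: pointer_query L \<kappa> dec "dt_step N" "{1}" by (rule pointer_query_classical)
  fix b :: nat assume "b \<in> {..<2 ^ L}"
  then have "dt_bound N (cube N) (\<lambda>x. cert L (cont x) b) (\<lambda>_. (real L + 4) * unit_cost 1 (2 ^ L))"
    by (intro dt_bound_of_step Q.cert_query) auto
  then show "dt_bound N (cube N) (\<lambda>x. cert L (cont x) b) (\<lambda>_. real ((L + 4) * (2 ^ L + 1) * K))"
    by (rule dt_bound_mono) (auto simp: unit_cost_def algebra_simps)
next
  show "f x \<longleftrightarrow> (\<exists>b\<in>{..<2 ^ L}. cert L (cont x) b)" for x by (auto simp: f_def pointer_value_def)
  show "b = b'" if "b \<in> {..<2 ^ L}" "b' \<in> {..<2 ^ L}" "cert L (cont x) b" "cert L (cont x) b'" for x b b'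
    using cert_unique[OF cont_range that(3,4)] that(1,2) by simp
qed simp

lemma deterministic_bound: "half * half \<le> det_query_complexity N f"
proof (rule det_query_complexity_ge)
  obtain \<omega> where "\<omega> \<in> \<Omega>" using \<Omega>(2) by blast
  from classical_cost[OF this] show "\<exists>t. dt_computes N f t"
    unfolding dt_bound_def dt_computes_def by blast
qed

lemma bounds:
  assumes K: "K = 16 * L"
  shows "(2 ^ L)\<^sup>2 / 4 \<le> real (det_query_complexity N f)"
    and "real (quantum_query_complexity N f) ^ 4 \<le> 20000 ^ 4 * real L ^ 12 * (2 ^ L)\<^sup>2"
    and "zero_error_query_complexity N f ^ 2 \<le> 2560 ^ 2 * real L ^ 6 * (2 ^ L)\<^sup>2"
    and "real (multilinear_degree N f) ^ 2 \<le> 96 ^ 2 * real L ^ 6 * (2 ^ L)\<^sup>2"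
    and "real L \<le> ln (real N)" and "L \<le> N" and "L \<le> det_query_complexity N f"
proof -
  have L: "real L \<ge> 2" using L_ge by simp
  define n where "n = (2 :: real) ^ L"
  have n: "n \<ge> 4" using n_ge by (simp add: n_def)
  have half: "n = 2 * real half" using arg_cong[OF n_half(1), of real] by (simp add: n_def)
  have "real half * real half \<le> real (det_query_complexity N f)"
    using of_nat_mono[OF deterministic_bound, where ?'a = real] by simp
  then show "(2 ^ L)\<^sup>2 / 4 \<le> real (det_query_complexity N f)"
    by (simp add: half power2_eq_square flip: n_def)
  have L3: "1 \<le> real L ^ 3 * sqrt n"
    using L n mult_mono[of 1 "real L ^ 3" 1 "sqrt n"] by simp
  have "real (quantum_query_complexity N f) \<le> 10 * (80 * real L ^ 2 * sqrt n * (16 * L)) + 1"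
    using quantum_bound by (simp add: K n_def)
  also have "\<dots> = 12800 * (real L ^ 3 * sqrt n) + 1" by (simp add: power3_eq_cube power2_eq_square)
  also have "\<dots> \<le> 20000 * (real L ^ 3 * sqrt n)" using L3 by linarith
  finally have "real (quantum_query_complexity N f) ^ 4 \<le> (20000 * (real L ^ 3 * sqrt n)) ^ 4"
    by (intro power_mono) auto
  also have "\<dots> = 20000 ^ 4 * real L ^ 12 * n\<^sup>2"
  proof -
    have "sqrt n ^ 4 = n\<^sup>2" using n by (simp add: power4_eq_xxxx power2_eq_square)
    moreover have "(real L ^ 3) ^ 4 = real L ^ 12" by (simp flip: power_mult)
    ultimately show ?thesis by (simp add: power_mult_distrib)
  qed
  finally show "real (quantum_query_complexity N f) ^ 4 \<le> 20000 ^ 4 * real L ^ 12 * (2 ^ L)\<^sup>2"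
    by (simp add: n_def)
  have "zero_error_query_complexity N f \<le> 2560 * real L ^ 3 * n"
    using zero_error_bound by (simp add: K n_def power3_eq_cube power2_eq_square mult_ac)
  moreover have "0 \<le> zero_error_query_complexity N f"
    by (simp add: zero_error_query_complexity_def)
  ultimately have "zero_error_query_complexity N f ^ 2 \<le> (2560 * real L ^ 3 * n) ^ 2" by (intro power_mono)
  then show "zero_error_query_complexity N f ^ 2 \<le> 2560 ^ 2 * real L ^ 6 * (2 ^ L)\<^sup>2"
    by (simp add: n_def power_mult_distrib flip: power_mult)
  have "real (multilinear_degree N f) \<le> (real L + 4) * (n + 1) * (16 * real L)"
  proof -
    have "real ((L + 4) * (2 ^ L + 1) * K) = (real L + 4) * (n + 1) * (16 * real L)"
      by (simp only: of_nat_mult of_nat_add of_nat_power of_nat_numeral of_nat_1 K n_def)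
    then show ?thesis using of_nat_mono[OF degree_bound, where ?'a = real] by linarith
  qed
  also have "\<dots> \<le> (3 * real L) * (2 * n) * (16 * real L)"
    using L n by (intro mult_right_mono mult_mono) auto
  also have "\<dots> = 96 * (real L * real L) * n" by simp
  also have "\<dots> \<le> 96 * (real L * real L * real L) * n"
    using L n by (intro mult_right_mono mult_left_mono) (auto simp: mult_le_cancel_left1)
  finally have "real (multilinear_degree N f) ^ 2 \<le> (96 * real L ^ 3 * n) ^ 2"
    by (intro power_mono) (auto simp: power3_eq_cube mult_ac)
  then show "real (multilinear_degree N f) ^ 2 \<le> 96 ^ 2 * real L ^ 6 * (2 ^ L)\<^sup>2"
    by (simp add: n_def power_mult_distrib flip: power_mult)
  have "real L \<le> (2 * real L + \<kappa>) * (1 / 2)" by simp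
  also have "\<dots> \<le> (2 * real L + \<kappa>) * ln 2" using ln2_ge_two_thirds by (intro mult_left_mono) auto
  also have "\<dots> = ln (real N)" by (simp add: N_power ln_realpow)
  finally show "real L \<le> ln (real N)" .
  have "L \<le> 2 * L + \<kappa>" by simp
  also have "\<dots> \<le> N" unfolding N_power by (rule less_imp_le[OF less_exp])
  finally show "L \<le> N" .
  have "L - 1 < half" unfolding half_def by (rule less_exp)
  then have "L \<le> half" by simp
  also have "\<dots> \<le> half * half" by simp
  also have "\<dots> \<le> det_query_complexity N f" by (rule deterministic_bound)
  finally show "L \<le> det_query_complexity N f" .
qed

end

text \<open>\<open>L\<close> is a power of two so that \<open>K = 16 * L\<close> is one as well, as
  translations of the bit positions require. The count needs \<open>6 * L\<close> bits for a content
  and \<open>i + 5\<close> for the size of an orbit, together at most \<open>16 * L\<close>.\<close>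

lemma ex_pointer_function:
  "\<exists>dec. pointer_function (2 ^ (i + 1)) (i + 5) dec"
proof -
  let ?L = "2 ^ (i + 1) :: nat"
  have "finite (contents ?L)" "contents ?L \<noteq> {}" by (auto simp: contents_def lessThan_empty_iff)
  moreover have "card (contents ?L) * 2 ^ (i + 5) \<le> 2 ^ 2 ^ (i + 5)"
  proof -
    have "i + 1 < ?L" by (rule less_exp)
    then have "6 * ?L + (i + 5) \<le> 16 * ?L" by simp
    also have "16 * ?L = 2 ^ (i + 5)" by (simp add: power_add)
    finally have "(2 :: nat) ^ (6 * ?L + (i + 5)) \<le> 2 ^ 2 ^ (i + 5)" by (intro power_increasing) auto
    then show ?thesis by (simp only: card_contents power_add)
  qed
  ultimately have "\<exists>dec :: bool list \<Rightarrow> content. (\<forall>a y. a < 2 ^ (i + 5) \<longrightarrow> dec (map (\<lambda>k. y (xor k a)) [0..<2 ^ (i + 5)]) = dec (map y [0..<2 ^ (i + 5)])) \<and>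
      (\<forall>bs. dec bs \<in> contents ?L) \<and> (\<forall>c\<in>contents ?L. \<exists>bs. length bs = 2 ^ (i + 5) \<and> dec bs = c)"
    by (rule ex_xor_invariant_surjection)
  then obtain dec :: "bool list \<Rightarrow> content" where
    dec: "(\<forall>a y. a < 2 ^ (i + 5) \<longrightarrow> dec (map (\<lambda>k. y (xor k a)) [0..<2 ^ (i + 5)]) = dec (map y [0..<2 ^ (i + 5)])) \<and>
      (\<forall>bs. dec bs \<in> contents ?L) \<and> (\<forall>c\<in>contents ?L. \<exists>bs. length bs = 2 ^ (i + 5) \<and> dec bs = c)"
    by (rule exE)
  have "pointer_function ?L (i + 5) dec"
  proof
    show "2 \<le> ?L" by simp
  qed (use dec in blast)+
  then show ?thesis by blast
qed

theorem theorem1p1: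
  shows "\<exists>(N :: nat \<Rightarrow> nat) (F :: nat \<Rightarrow> (nat \<Rightarrow> bool) \<Rightarrow> bool).
    (\<forall>i. transitive_function (N i) (F i)) \<and>
    filterlim N at_top sequentially \<and>
    filterlim (\<lambda>i. det_query_complexity (N i) (F i)) at_top sequentially \<and>
    tilde_Omega N (\<lambda>i. real (det_query_complexity (N i) (F i)))
                  (\<lambda>i. real (quantum_query_complexity (N i) (F i)) ^ 4) \<and>
    tilde_Omega N (\<lambda>i. real (det_query_complexity (N i) (F i)))
                  (\<lambda>i. zero_error_query_complexity (N i) (F i) ^ 2) \<and>
    tilde_Omega N (\<lambda>i. real (det_query_complexity (N i) (F i)))
                  (\<lambda>i. real (multilinear_degree (N i) (F i)) ^ 2)"
proof -
  obtain dec where dec: "\<And>i. pointer_function (2 ^ (i + 1)) (i + 5) (dec i)"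
    using ex_pointer_function by metis
  define l :: "nat \<Rightarrow> nat" where "l i = 2 ^ (i + 1)" for i
  define N where "N i = pointer_function.N (l i) (i + 5)" for i
  define F where "F i = pointer_function.f (l i) (i + 5) (dec i)" for i
  have P: "pointer_function (l i) (i + 5) (dec i)" for i using dec by (simp add: l_def)
  have K: "pointer_function.K (i + 5) = 16 * l i" for i
    by (simp add: pointer_function.K_def[OF P] l_def power_add)
  note bounds = pointer_function.bounds[OF P K, folded N_def F_def]
  have l: "i \<le> l i" "0 < real (l i)" for i
    using less_exp[of "i + 1"] by (auto simp: l_def)
  show ?thesis
  proof (intro exI[of _ N] exI[of _ F] conjI allI)
    show "transitive_function (N i) (F i)" for i
      unfolding N_def F_def by (rule pointer_function.f_transitive[OF P])
    show "filterlim N at_top sequentially"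
      by (rule filterlim_at_top_mono[OF filterlim_ident])
        (use order_trans[OF l(1) bounds(6)] in \<open>auto intro: always_eventually\<close>)
    show "filterlim (\<lambda>i. det_query_complexity (N i) (F i)) at_top sequentially"
      by (rule filterlim_at_top_mono[OF filterlim_ident])
        (use order_trans[OF l(1) bounds(7)] in \<open>auto intro: always_eventually\<close>)
  qed (rule tilde_OmegaI[where M = "\<lambda>i. (2 ^ l i)\<^sup>2" and l = "\<lambda>i. real (l i)", OF bounds(1) _ _ _ l(2) bounds(5)],
      (rule bounds(2-4)), simp_all)+
qed

end
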